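(* Let $X$ be a Banach sequence lattice such that $\frac{\|\mathrm{id}:X_n\to\ell_2^n\|}{\|\mathrm{id}:X_n\to\ell_1^n\|}\le\frac1{\sqrt n}$ for each $n$. Then $$\lim_{n\to\infty}\frac{K(B_{X_n})}{\sqrt{\frac{\log n}{n}}}=1.$$
   Context: A Banach sequence lattice $X$ over $\mathbb{N}$ is a Banach space of complex sequences with the ideal property ($|y|\le|x|$, $x\in X$ $\Rightarrow$ $y\in X$, $\|y\|\le\|x\|$). $X_n$ is $\mathbb{C}^n$ with the norm $\|z\|=\|\sum_{k\le n}|z_k|e_k\|_X$, $B_{X_n}$ its open unit ball. $K(B_{X_n})$ is the Bohr radius: the supremum of $r\in(0,1)$ such that $\sup_{z\in rB_{X_n}}\sum_{\alpha\in\mathbb{N}_0^n}|\frac{\partial^\alpha f(0)}{\alpha!}z^\alpha|\le\sup_{B_{X_n}}|f|$ for every bounded holomorphic $f:B_{X_n}\to\mathbb{C}$. *)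

theory Defs
  imports "HOL-Analysis.Analysis"
begin

definition unit_seq :: "nat \<Rightarrow> nat \<Rightarrow> complex" where
  "unit_seq k = (\<lambda>j. if j = k then 1 else 0)"

definition banach_sequence_lattice ::
  "(nat \<Rightarrow> complex) set \<Rightarrow> ((nat \<Rightarrow> complex) \<Rightarrow> real) \<Rightarrow> bool" where
  "banach_sequence_lattice X N \<longleftrightarrow>
     \<comment> \<open>vector subspace\<close>
     (\<lambda>k. 0::complex) \<in> X \<and>
     (\<forall>x\<in>X. \<forall>y\<in>X. (\<lambda>k. x k + y k) \<in> X) \<and>
     (\<forall>x\<in>X. \<forall>c::complex. (\<lambda>k. c * x k) \<in> X) \<and>
     \<comment> \<open>norm\<close>
     (\<forall>x\<in>X. N x \<ge> 0 \<and> (N x = 0 \<longleftrightarrow> x = (\<lambda>k. 0))) \<and>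
     (\<forall>x\<in>X. \<forall>y\<in>X. N (\<lambda>k. x k + y k) \<le> N x + N y) \<and>
     (\<forall>x\<in>X. \<forall>c::complex. N (\<lambda>k. c * x k) = norm c * N x) \<and>
     \<comment> \<open>completeness\<close>
     (\<forall>s::nat \<Rightarrow> nat \<Rightarrow> complex. (\<forall>m. s m \<in> X) \<longrightarrow>
        (\<forall>e>0. \<exists>M. \<forall>m\<ge>M. \<forall>p\<ge>M. N (\<lambda>k. s m k - s p k) < e) \<longrightarrow>
        (\<exists>x\<in>X. \<forall>e>0. \<exists>M. \<forall>m\<ge>M. N (\<lambda>k. s m k - x k) < e)) \<and>
     \<comment> \<open>ideal (lattice) property\<close>
     (\<forall>x\<in>X. \<forall>y. (\<forall>k. norm (y k) \<le> norm (x k)) \<longrightarrow> y \<in> X \<and> N y \<le> N x) \<and>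
     \<comment> \<open>sequence lattice over nat: contains the unit vectors\<close>
     (\<forall>k. unit_seq k \<in> X)"

definition Cn :: "nat \<Rightarrow> (nat \<Rightarrow> complex) set" where
  "Cn n = {z. \<forall>k\<ge>n. z k = 0}"

definition Xn_norm :: "((nat \<Rightarrow> complex) \<Rightarrow> real) \<Rightarrow> nat \<Rightarrow> (nat \<Rightarrow> complex) \<Rightarrow> real" where
  "Xn_norm N n z = N (\<lambda>k. if k < n then complex_of_real (norm (z k)) else 0)"

definition Xn_ball :: "((nat \<Rightarrow> complex) \<Rightarrow> real) \<Rightarrow> nat \<Rightarrow> real \<Rightarrow> (nat \<Rightarrow> complex) set" where
  "Xn_ball N n r = {z \<in> Cn n. Xn_norm N n z < r}"

definition lp_norm :: "real \<Rightarrow> nat \<Rightarrow> (nat \<Rightarrow> complex) \<Rightarrow> real" where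
  "lp_norm p n z = (\<Sum>k<n. norm (z k) powr p) powr (1 / p)"

definition id_Xn_lp_norm :: "((nat \<Rightarrow> complex) \<Rightarrow> real) \<Rightarrow> nat \<Rightarrow> real \<Rightarrow> real" where
  "id_Xn_lp_norm N n p = (SUP z \<in> {z \<in> Cn n. Xn_norm N n z \<le> 1}. lp_norm p n z)"

definition sup_norm_n :: "nat \<Rightarrow> (nat \<Rightarrow> complex) \<Rightarrow> real" where
  "sup_norm_n n h = Max ({0} \<union> (\<lambda>k. norm (h k)) ` {..<n})"

text \<open>Holomorphy on an open subset U of C^n: complex Frechet differentiability at each point.\<close>
definition holomorphic_n :: "nat \<Rightarrow> ((nat \<Rightarrow> complex) \<Rightarrow> complex) \<Rightarrow> (nat \<Rightarrow> complex) set \<Rightarrow> bool" where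
  "holomorphic_n n f U \<longleftrightarrow>
     (\<forall>z\<in>U. \<exists>c::nat \<Rightarrow> complex. \<forall>e>0. \<exists>d>0. \<forall>h\<in>Cn n.
        sup_norm_n n h < d \<longrightarrow>
        norm (f (\<lambda>k. z k + h k) - f z - (\<Sum>k<n. c k * h k)) \<le> e * sup_norm_n n h)"

definition pdiff :: "nat \<Rightarrow> ((nat \<Rightarrow> complex) \<Rightarrow> complex) \<Rightarrow> (nat \<Rightarrow> complex) \<Rightarrow> complex" where
  "pdiff k g = (\<lambda>z. deriv (\<lambda>w. g (z(k := w))) (z k))"

definition pdiff_multi :: "nat \<Rightarrow> (nat \<Rightarrow> nat) \<Rightarrow> ((nat \<Rightarrow> complex) \<Rightarrow> complex) \<Rightarrow> (nat \<Rightarrow> complex) \<Rightarrow> complex" where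
  "pdiff_multi n \<alpha> f = foldr (\<lambda>k g. (pdiff k ^^ \<alpha> k) g) [0..<n] f"

definition multi_indices :: "nat \<Rightarrow> (nat \<Rightarrow> nat) set" where
  "multi_indices n = {\<alpha>. \<forall>k\<ge>n. \<alpha> k = 0}"

definition mfact :: "nat \<Rightarrow> (nat \<Rightarrow> nat) \<Rightarrow> complex" where
  "mfact n \<alpha> = (\<Prod>k<n. of_nat (fact (\<alpha> k)))"

definition mpow :: "nat \<Rightarrow> (nat \<Rightarrow> complex) \<Rightarrow> (nat \<Rightarrow> nat) \<Rightarrow> complex" where
  "mpow n z \<alpha> = (\<Prod>k<n. z k ^ \<alpha> k)"

definition bohr_radius :: "((nat \<Rightarrow> complex) \<Rightarrow> real) \<Rightarrow> nat \<Rightarrow> real" where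
  "bohr_radius N n = Sup {r. 0 < r \<and> r < 1 \<and>
     (\<forall>f. holomorphic_n n f (Xn_ball N n 1) \<and> bounded (f ` Xn_ball N n 1) \<longrightarrow>
        (\<forall>z \<in> Xn_ball N n r.
           (\<Sum>\<^sub>\<infinity>\<alpha>\<in>multi_indices n.
              ennreal (norm (pdiff_multi n \<alpha> f (\<lambda>k. 0) / mfact n \<alpha> * mpow n z \<alpha>)))
           \<le> ennreal (SUP w \<in> Xn_ball N n 1. norm (f w))))}"

end

theory Submission
  imports Defs "HOL-Complex_Analysis.Complex_Analysis" "HOL-Real_Asymp.Real_Asymp"
begin

text \<open>
  Lower bound. Restricting to the polydisc spanned by a point of the ball reduces the problem to
  bounded functions on polydiscs. Their homogeneous parts satisfy $|P_m| \le 2 (S - |c_0|)$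
  (Caratheodory), so it suffices that the Sidon constants $S(m, n)$ satisfy
  $\sum_{m \ge 1} S(m, n) r^m \le 1/2$ for $r = t \sqrt{\log n / n}$ and $t < 1$. Differentiating an
  $m$-homogeneous polynomial $k$ times, applying the Bohnenblust--Hille inequality of the fixed
  degree $k$ pointwise, and comparing $L^p$ and $L^2$ norms for $p = 2k/(k+1)$ gives
  $S(m, n) \le C_k m^k 2^{m/k} n^{(k-1)/2} |\Lambda(m-k, n)|^{1/2}$, where $\Lambda(j, n)$ is the set of
  multi-indices of degree $j$. The generating function bound
  $|\Lambda(j, n)| \rho^j \le (1 - \rho)^{-n}$ with $\rho = b \log n / n$, $b < 1$, is then good enough for
  all $m$ simultaneously.

  Upper bound. For suitable signs the polynomial $\sum_\alpha \pm \frac{m!}{\alpha!} z^\alpha$ is at most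
  $\sqrt{m!}\, \sqrt n$ times powers of $m$ and $\log n$ on the Euclidean unit ball, whereas the
  moduli of its monomials add up to $\|z\|_1^m$. Testing with it for $m = \lceil \log n \rceil$ gives the
  estimate $r \le \frac{\|id : X_n \to \ell_2^n\|}{\|id : X_n \to \ell_1^n\|} (1 + o(1)) \sqrt{\log n}$.
\<close>

section \<open>Multi-indices\<close>

text \<open>The limit constant is 1, so every loss that is exponential in m must have a base tending
  to 1. With k = m the constant \<open>bh_const m\<close> alone would grow like 2^m; with k fixed,
  \<open>bh_const k\<close> and the powers of m are harmless and only 2^(1/k) per degree remains.
  For r = t * \<open>bohr_rate n\<close> the term of degree m is then bounded by about C m^k
  theta^(m-k) n^((b-1)/2), up to powers of log n, where theta = 2^(1/k) t / sqrt b: b < 1 gives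
  decay in n, while b > t^2 and k large give theta < 1 and hence a convergent series in m. In the
  upper bound, m = ceil(log n) nearly minimises (m!)^(1/(2m)) n^(1/(2m)), which is about sqrt(m/e)
  n^(1/(2m)): at m = log n the factors e^(-1/2) and e^(1/2) cancel and sqrt(log n) is left.
  Constants and powers of log n in the bound for the random polynomial disappear in the m-th root,
  so crude subgaussian and covering estimates are enough.\<close>

definition midx :: "nat \<Rightarrow> nat \<Rightarrow> (nat \<Rightarrow> nat) set" where
  "midx n m = {\<alpha> \<in> multi_indices n. (\<Sum>k<n. \<alpha> k) = m}"

text \<open>Coordinatewise constraints, as opposed to the degree constraint of \<open>midx\<close>.
  One device for three sets: the exponents of the torus grid points, the multi-indices below a given
  one, and boxes containing all multi-indices of bounded degree.\<close>

definition index_box :: "nat \<Rightarrow> (nat \<Rightarrow> nat set) \<Rightarrow> (nat \<Rightarrow> nat) set" where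
  "index_box n B = {\<alpha> \<in> multi_indices n. \<forall>k<n. \<alpha> k \<in> B k}"

lemma multi_indices_0: "multi_indices 0 = {\<lambda>k. 0}"
  by (auto simp: multi_indices_def)

text \<open>Members of \<open>multi_indices n\<close> vanish at position n, so an update at n is
  undone by resetting it to 0. This and the next two bijections carry sums over multi-indices
  through inductions on the number of variables.\<close>

lemma bij_betw_multi_indices_Suc:
  "bij_betw (\<lambda>(j, \<beta>). \<beta>(n := j)) (UNIV \<times> multi_indices n) (multi_indices (Suc n))"
  by (rule bij_betw_byWitness[where f' = "\<lambda>\<alpha>. (\<alpha> n, \<alpha>(n := 0))"])
     (auto simp: multi_indices_def fun_eq_iff le_less_Suc_eq Suc_le_eq less_Suc_eq not_less)

lemma bij_betw_index_box_Suc: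
  "bij_betw (\<lambda>(j, \<beta>). \<beta>(n := j)) (B n \<times> index_box n B) (index_box (Suc n) B)"
  by (rule bij_betw_byWitness[where f' = "\<lambda>\<alpha>. (\<alpha> n, \<alpha>(n := 0))"])
     (auto simp: multi_indices_def index_box_def fun_eq_iff le_less_Suc_eq Suc_le_eq less_Suc_eq not_less)

lemma bij_betw_midx_Suc:
  "bij_betw (\<lambda>(j, \<beta>). \<beta>(n := j)) (Sigma {..m} (\<lambda>j. midx n (m - j))) (midx (Suc n) m)"
proof (rule bij_betw_byWitness[where f' = "\<lambda>\<alpha>. (\<alpha> n, \<alpha>(n := 0))"])
  show "\<forall>a\<in>Sigma {..m} (\<lambda>j. midx n (m - j)).
       (\<lambda>\<alpha>. (\<alpha> n, \<alpha>(n := 0))) ((\<lambda>(j, \<beta>). \<beta>(n := j)) a) = a"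
    by (auto simp: midx_def multi_indices_def fun_eq_iff)
  show "\<forall>a'\<in>midx (Suc n) m. (\<lambda>(j, \<beta>). \<beta>(n := j)) ((\<lambda>\<alpha>. (\<alpha> n, \<alpha>(n := 0))) a') = a'"
    by auto
  show "(\<lambda>(j, \<beta>). \<beta>(n := j)) ` Sigma {..m} (\<lambda>j. midx n (m - j)) \<subseteq> midx (Suc n) m"
    by (auto simp: midx_def multi_indices_def)
  show "(\<lambda>\<alpha>. (\<alpha> n, \<alpha>(n := 0))) ` midx (Suc n) m \<subseteq> Sigma {..m} (\<lambda>j. midx n (m - j))"
    by (auto simp: midx_def multi_indices_def le_less_Suc_eq Suc_le_eq less_Suc_eq not_less)
qed

lemma finite_index_box: "(\<And>k. k < n \<Longrightarrow> finite (B k)) \<Longrightarrow> finite (index_box n B)"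
proof (induction n)
  case 0
  then show ?case by (simp add: index_box_def multi_indices_0)
next
  case (Suc n)
  then show ?case
    using bij_betw_finite[OF bij_betw_index_box_Suc[of n B]] by simp
qed

lemma midx_le: "\<alpha> \<in> midx n m \<Longrightarrow> \<alpha> k \<le> m"
proof (cases "k < n")
  assume "\<alpha> \<in> midx n m" "k < n"
  then show "\<alpha> k \<le> m"
    using member_le_sum[of k "{..<n}" \<alpha>] by (auto simp: midx_def)
qed (auto simp: midx_def multi_indices_def)

lemma midx_subset_index_box: "midx n m \<subseteq> index_box n (\<lambda>_. {..m})"
  using midx_le by (auto simp: index_box_def midx_def)

lemma finite_midx [simp, intro]: "finite (midx n m)"
  by (rule finite_subset[OF midx_subset_index_box]) (auto intro: finite_index_box)

lemma midx_0: "midx n 0 = {\<lambda>k. 0}"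
  by (auto simp: midx_def multi_indices_def fun_eq_iff) (metis lessThan_iff not_less)

lemma sum_midx_Suc:
  "(\<Sum>\<alpha>\<in>midx (Suc n) m. F \<alpha>) = (\<Sum>j\<le>m. \<Sum>\<beta>\<in>midx n (m - j). F (\<beta>(n := j)))"
  by (subst sum.reindex_bij_betw[OF bij_betw_midx_Suc, symmetric])
     (simp add: sum.Sigma split_def)

lemma sum_index_box_prod:
  fixes g :: "nat \<Rightarrow> nat \<Rightarrow> 'a :: comm_semiring_1"
  assumes "\<And>k. k < n \<Longrightarrow> finite (B k)"
  shows "(\<Sum>\<alpha>\<in>index_box n B. \<Prod>k<n. g k (\<alpha> k)) = (\<Prod>k<n. \<Sum>j\<in>B k. g k j)"
  using assms
proof (induction n)
  case 0
  then show ?case by (simp add: index_box_def multi_indices_0)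
next
  case (Suc n)
  have *: "(\<Prod>k<n. g k ((\<beta>(n := j)) k)) = (\<Prod>k<n. g k (\<beta> k))" for \<beta> j
    by (intro prod.cong) auto
  have "(\<Sum>\<alpha>\<in>index_box (Suc n) B. \<Prod>k<Suc n. g k (\<alpha> k))
      = (\<Sum>(j,\<beta>)\<in>B n \<times> index_box n B. (\<Prod>k<n. g k (\<beta> k)) * g n j)"
    by (subst sum.reindex_bij_betw[OF bij_betw_index_box_Suc, symmetric])
       (simp add: split_def *)
  also have "\<dots> = (\<Sum>j\<in>B n. g n j) * (\<Sum>\<beta>\<in>index_box n B. (\<Prod>k<n. g k (\<beta> k)))"
    by (simp add: sum_product sum.cartesian_product mult.commute)
  finally show ?case using Suc by (simp add: mult.commute)
qed

text \<open>Induction on n: fixing the last exponent j splits off the binomial coefficient m choose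
  j, and the binomial theorem sums over j.\<close>

lemma multinomial_theorem:
  fixes u :: "nat \<Rightarrow> 'a :: field_char_0"
  shows "(\<Sum>\<alpha>\<in>midx n m. fact m / (\<Prod>k<n. fact (\<alpha> k)) * (\<Prod>k<n. u k ^ \<alpha> k)) = (\<Sum>k<n. u k) ^ m"
proof (induction n arbitrary: m)
  case 0
  have "midx 0 m = (if m = 0 then {\<lambda>k. 0} else {})"
    by (auto simp: midx_def multi_indices_0)
  then show ?case by (simp add: power_0_left)
next
  case (Suc n)
  have *: "(\<Prod>k<n. h k ((\<beta>(n := j)) k)) = (\<Prod>k<n. h k (\<beta> k))"
    for \<beta> j and h :: "nat \<Rightarrow> nat \<Rightarrow> 'a"
    by (intro prod.cong) auto
  have **: "fact m * (Q * v) / (P * fact j) = of_nat (m choose j) * v * (fact (m - j) * Q) / P"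
    if "j \<le> m" for j and P Q v :: 'a
    using that by (simp add: binomial_fact field_simps)
  have "(\<Sum>\<alpha>\<in>midx (Suc n) m. fact m / (\<Prod>k<Suc n. fact (\<alpha> k)) * (\<Prod>k<Suc n. u k ^ \<alpha> k))
     = (\<Sum>j\<le>m. \<Sum>\<beta>\<in>midx n (m - j). of_nat (m choose j) * u n ^ j *
          (fact (m - j) / (\<Prod>k<n. fact (\<beta> k)) * (\<Prod>k<n. u k ^ \<beta> k)))"
    by (subst sum_midx_Suc) (intro sum.cong refl; simp add: *[of "\<lambda>k i. fact i"] *[of "\<lambda>k i. u k ^ i"] **)
  also have "\<dots> = (\<Sum>j\<le>m. of_nat (m choose j) * u n ^ j * (\<Sum>k<n. u k) ^ (m - j))"
    unfolding Suc[symmetric] sum_distrib_left ..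
  also have "\<dots> = (\<Sum>k<Suc n. u k) ^ m"
    by (simp add: binomial_ring add.commute)
  finally show ?case .
qed

text \<open>Multinomial coefficients are positive integers, hence at least 1; this allows them to be
  inserted into sums of monomials for an upper bound.\<close>

lemma prod_fact_le_fact_midx:
  assumes "\<alpha> \<in> midx n m"
  shows "(\<Prod>k<n. fact (\<alpha> k)) \<le> (fact m :: real)"
proof -
  have "(\<Prod>k<n. fact (\<alpha> k)) dvd (fact (\<Sum>k<n. \<alpha> k) :: nat)"
  proof (induction n)
    case (Suc n)
    have "(\<Prod>k<Suc n. fact (\<alpha> k)) dvd (fact (\<Sum>k<n. \<alpha> k) * fact (\<alpha> n) :: nat)"
      unfolding prod.lessThan_Suc by (rule mult_dvd_mono[OF Suc dvd_refl])
    also have "\<dots> dvd fact (\<Sum>k<Suc n. \<alpha> k)"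
      using fact_fact_dvd_fact[where 'a = nat, of "\<Sum>k<n. \<alpha> k" "\<alpha> n"] by simp
    finally show ?case .
  qed simp
  then have "(\<Prod>k<n. fact (\<alpha> k)) \<le> (fact m :: nat)"
    using assms by (auto simp: midx_def intro: dvd_imp_le)
  then have "real (\<Prod>k<n. fact (\<alpha> k)) \<le> real (fact m)"
    by (rule of_nat_mono)
  then show ?thesis by simp
qed

lemma sum_midx_power_le:
  fixes u :: "nat \<Rightarrow> real"
  assumes "\<And>k. k < n \<Longrightarrow> 0 \<le> u k"
  shows "(\<Sum>\<alpha>\<in>midx n m. \<Prod>k<n. u k ^ \<alpha> k) \<le> (\<Sum>k<n. u k) ^ m"
  unfolding multinomial_theorem[symmetric]
proof (rule sum_mono)
  fix \<alpha> assume "\<alpha> \<in> midx n m"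
  then have "1 \<le> fact m / (\<Prod>k<n. fact (\<alpha> k) :: real)"
    using prod_fact_le_fact_midx[of \<alpha> n m] by (simp add: le_divide_eq prod_pos)
  moreover have "0 \<le> (\<Prod>k<n. u k ^ \<alpha> k)"
    using assms by (intro prod_nonneg) auto
  ultimately show "(\<Prod>k<n. u k ^ \<alpha> k) \<le> fact m / (\<Prod>k<n. fact (\<alpha> k)) * (\<Prod>k<n. u k ^ \<alpha> k)"
    using mult_right_mono[of 1 "fact m / (\<Prod>k<n. fact (\<alpha> k) :: real)"] by simp
qed

lemma card_midx_le_power: "real (card (midx n m)) \<le> real n ^ m"
  using sum_midx_power_le[of n "\<lambda>_. 1" m] by simp

text \<open>In the expansion of the n-th power of the geometric series in \<rho>, each multi-index
  of degree m contributes \<rho>^m. The right side does not depend on m, so one choice of \<rho>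
  serves all degrees.\<close>

lemma card_midx_generating:
  fixes \<rho> :: real
  assumes "0 < \<rho>" "\<rho> < 1"
  shows "real (card (midx n m)) * \<rho> ^ m \<le> (1 / (1 - \<rho>)) ^ n"
proof -
  have "real (card (midx n m)) * \<rho> ^ m = (\<Sum>\<alpha>\<in>midx n m. \<Prod>k<n. \<rho> ^ \<alpha> k)"
    by (simp add: power_sum[symmetric] midx_def)
  also have "\<dots> \<le> (\<Sum>\<alpha>\<in>index_box n (\<lambda>_. {..m}). \<Prod>k<n. \<rho> ^ \<alpha> k)"
    using assms by (intro sum_mono2 midx_subset_index_box finite_index_box prod_nonneg) auto
  also have "\<dots> = (\<Sum>j\<le>m. \<rho> ^ j) ^ n"
    using sum_index_box_prod[of n "\<lambda>_. {..m}" "\<lambda>_ j. \<rho> ^ j"] by simp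
  also have "\<dots> \<le> (1 / (1 - \<rho>)) ^ n"
  proof (rule power_mono)
    show "(\<Sum>j\<le>m. \<rho> ^ j) \<le> 1 / (1 - \<rho>)"
      using assms by (simp add: sum_gp0 divide_right_mono)
  qed (use assms in \<open>auto intro: sum_nonneg\<close>)
  finally show ?thesis .
qed

lemma prod_add_power_index_box:
  fixes z w :: "nat \<Rightarrow> 'a :: comm_semiring_1"
  shows "(\<Prod>k<n. (w k + z k) ^ \<alpha> k) =
    (\<Sum>\<gamma>\<in>index_box n (\<lambda>k. {..\<alpha> k}). (\<Prod>k<n. of_nat (\<alpha> k choose \<gamma> k)) * (\<Prod>k<n. w k ^ \<gamma> k) * (\<Prod>k<n. z k ^ (\<alpha> k - \<gamma> k)))"
  using sum_index_box_prod[of n "\<lambda>k. {..\<alpha> k}" "\<lambda>k j. of_nat (\<alpha> k choose j) * w k ^ j * z k ^ (\<alpha> k - j)"]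
  by (simp add: binomial_ring prod.distrib)

section \<open>Orthogonality of characters on roots of unity\<close>

lemma sum_cis_power:
  assumes "L > 0"
  shows "(\<Sum>j<L. cis (2 * pi * real_of_int d / real L) ^ j) = (if int L dvd d then of_nat L else 0)"
proof -
  let ?x = "cis (2 * pi * real_of_int d / real L)"
  have eq1: "?x = 1 \<longleftrightarrow> int L dvd d"
  proof
    assume "?x = 1"
    then have "cos (2 * pi * real_of_int d / real L) = 1"
      by (metis cis.simps(1) one_complex.simps(1))
    then obtain j :: int where "2 * pi * real_of_int d / real L = real_of_int j * 2 * pi"
      using cos_one_2pi_int by blast
    then have "real_of_int d = real_of_int (j * int L)"
      using assms by (simp add: field_simps)
    then have "d = j * int L" using of_int_eq_iff by blast
    then show "int L dvd d" by simp
  next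
    assume "int L dvd d"
    then obtain j where "d = int L * j" by blast
    then have "2 * pi * real_of_int d / real L = 2 * pi * real_of_int j"
      using assms by simp
    then show "?x = 1" by (simp add: cis_multiple_2pi)
  qed
  have "?x ^ L = cis (real L * (2 * pi * real_of_int d / real L))"
    by (rule Complex.DeMoivre)
  also have "real L * (2 * pi * real_of_int d / real L) = 2 * pi * real_of_int d"
    using assms by simp
  also have "cis \<dots> = 1"
    by (simp add: cis_multiple_2pi)
  finally have "?x ^ L = 1" .
  then show ?thesis
    using eq1 by (auto simp: geometric_sum)
qed

section \<open>Moments of homogeneous polynomials on roots of unity\<close>

definition homp :: "nat \<Rightarrow> nat \<Rightarrow> ((nat \<Rightarrow> nat) \<Rightarrow> complex) \<Rightarrow> (nat \<Rightarrow> complex) \<Rightarrow> complex" where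
  "homp n m c z = (\<Sum>\<alpha>\<in>midx n m. c \<alpha> * mpow n z \<alpha>)"

definition coeff_sq :: "nat \<Rightarrow> nat \<Rightarrow> ((nat \<Rightarrow> nat) \<Rightarrow> complex) \<Rightarrow> real" where
  "coeff_sq n m c = (\<Sum>\<alpha>\<in>midx n m. (norm (c \<alpha>))\<^sup>2)"

text \<open>Integrals over the torus are replaced throughout by averages over the grid of $L$-th roots of
unity; for polynomials of degree below $L$ nothing is lost.\<close>

definition torus_point :: "nat \<Rightarrow> (nat \<Rightarrow> nat) \<Rightarrow> nat \<Rightarrow> complex" where
  "torus_point L \<tau> = (\<lambda>k. cis (2 * pi * real (\<tau> k) / real L))"

definition tavg :: "nat \<Rightarrow> nat \<Rightarrow> ((nat \<Rightarrow> complex) \<Rightarrow> real) \<Rightarrow> real" where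
  "tavg L n F = (\<Sum>\<tau>\<in>index_box n (\<lambda>_. {..<L}). F (torus_point L \<tau>)) / real L ^ n"

lemma norm_torus_point [simp]: "norm (torus_point L \<tau> k) = 1"
  by (simp add: torus_point_def)

lemma card_torus: "card (index_box n (\<lambda>_. {..<L})) = L ^ n"
  using sum_index_box_prod[of n "\<lambda>_. {..<L}" "\<lambda>_ _. 1 :: nat"] by simp

lemma tavg_mono:
  assumes "\<And>z. (\<And>k. norm (z k) = 1) \<Longrightarrow> F z \<le> G z"
  shows "tavg L n F \<le> tavg L n G"
  unfolding tavg_def using assms by (intro divide_right_mono sum_mono) auto

lemma tavg_add: "tavg L n (\<lambda>z. F z + G z) = tavg L n F + tavg L n G"
  by (simp add: tavg_def sum.distrib add_divide_distrib)

lemma tavg_cmult: "tavg L n (\<lambda>z. a * F z) = a * tavg L n F"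
  by (simp add: tavg_def sum_distrib_left)

lemma tavg_sum: "tavg L n (\<lambda>z. \<Sum>i\<in>I. F i z) = (\<Sum>i\<in>I. tavg L n (F i))"
  unfolding tavg_def sum_divide_distrib[symmetric] by (subst sum.swap) simp

lemma tavg_const: "L > 0 \<Longrightarrow> tavg L n (\<lambda>z. a) = a"
  by (simp add: tavg_def card_torus)

lemma tavg_nonneg: "(\<And>z. 0 \<le> F z) \<Longrightarrow> 0 \<le> tavg L n F"
  by (auto simp: tavg_def intro!: divide_nonneg_nonneg sum_nonneg)

lemma tavg_pos_iff:
  assumes "L > 0" "\<And>z. 0 \<le> F z"
  shows "tavg L n F = 0 \<longleftrightarrow> (\<forall>\<tau>\<in>index_box n (\<lambda>_. {..<L}). F (torus_point L \<tau>) = 0)"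
  using assms by (simp add: tavg_def finite_index_box sum_nonneg_eq_0_iff)

lemma sum_root_unity:
  assumes "L > 0"
  shows "(\<Sum>j<L. cis (2 * pi * real j / real L) ^ a * cnj (cis (2 * pi * real j / real L) ^ b))
    = (if int L dvd int a - int b then of_nat L else 0)"
proof -
  have "cis (2 * pi * real j / real L) ^ a * cnj (cis (2 * pi * real j / real L) ^ b)
      = cis (2 * pi * real_of_int (int a - int b) / real L) ^ j" for j
  proof -
    have "cis (2 * pi * real j / real L) ^ a * cnj (cis (2 * pi * real j / real L) ^ b)
       = cis (real a * (2 * pi * real j / real L) + real b * - (2 * pi * real j / real L))"
      unfolding complex_cnj_power cis_cnj Complex.DeMoivre cis_mult mult_minus_right ..
    also have "real a * (2 * pi * real j / real L) + real b * - (2 * pi * real j / real L)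
       = real j * (2 * pi * real_of_int (int a - int b) / real L)"
      using assms by (simp add: field_simps)
    also have "cis \<dots> = cis (2 * pi * real_of_int (int a - int b) / real L) ^ j"
      by (rule Complex.DeMoivre[symmetric])
    finally show ?thesis .
  qed
  then show ?thesis
    using sum_cis_power[of L "int a - int b"] assms by simp
qed

lemma dvd_int_diff_iff:
  assumes "a < L" "b < L"
  shows "int L dvd int a - int b \<longleftrightarrow> a = b"
proof (cases "a = b")
  case False
  have "\<bar>int a - int b\<bar> < \<bar>int L\<bar>" using assms by linarith
  then have "\<not> int L dvd int a - int b"
    using False dvd_imp_le_int[of "int a - int b" "int L"] by linarith
  then show ?thesis using False by blast
qed simp

text \<open>The sum factors over the coordinates, and as all entries are at most m < L, congruence
  modulo L is equality.\<close>

lemma torus_orthogonal: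
  assumes "\<alpha> \<in> midx n m" "\<beta> \<in> midx n m" "m < L"
  shows "(\<Sum>\<tau>\<in>index_box n (\<lambda>_. {..<L}). mpow n (torus_point L \<tau>) \<alpha> * cnj (mpow n (torus_point L \<tau>) \<beta>)) =
    (if \<alpha> = \<beta> then of_nat L ^ n else 0)"
proof -
  have inner: "(\<Sum>j<L. cis (2 * pi * real j / real L) ^ a * cnj (cis (2 * pi * real j / real L) ^ b))
      = (if a = b then of_nat L else 0)" if "a < L" "b < L" for a b
    using sum_root_unity[of L a b] dvd_int_diff_iff[OF that] that by simp
  have "(\<Sum>\<tau>\<in>index_box n (\<lambda>_. {..<L}). mpow n (torus_point L \<tau>) \<alpha> * cnj (mpow n (torus_point L \<tau>) \<beta>))
      = (\<Prod>k<n. \<Sum>j<L. cis (2 * pi * real j / real L) ^ \<alpha> k * cnj (cis (2 * pi * real j / real L) ^ \<beta> k))"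
    by (subst sum_index_box_prod[symmetric]) (simp_all add: mpow_def torus_point_def prod.distrib)
  also have "\<dots> = (\<Prod>k<n. if \<alpha> k = \<beta> k then of_nat L else 0)"
    using le_less_trans[OF midx_le[OF assms(1)] assms(3)] le_less_trans[OF midx_le[OF assms(2)] assms(3)]
    by (intro prod.cong refl inner)
  also have "\<dots> = (if \<forall>k<n. \<alpha> k = \<beta> k then of_nat L ^ n else 0)"
    by (auto simp: prod_zero_iff)
  also have "(\<forall>k<n. \<alpha> k = \<beta> k) \<longleftrightarrow> \<alpha> = \<beta>"
  proof safe
    assume eq: "\<forall>k<n. \<alpha> k = \<beta> k"
    show "\<alpha> = \<beta>"
    proof
      fix k show "\<alpha> k = \<beta> k"
        using eq assms(1,2) by (cases "k < n") (auto simp: midx_def multi_indices_def)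
    qed
  qed
  finally show ?thesis .
qed

lemma parseval:
  assumes "m < L"
  shows "tavg L n (\<lambda>z. (norm (homp n m c z))\<^sup>2) = coeff_sq n m c"
proof -
  let ?T = "index_box n (\<lambda>_. {..<L})"
  have "of_real (\<Sum>\<tau>\<in>?T. (norm (homp n m c (torus_point L \<tau>)))\<^sup>2)
      = (\<Sum>\<tau>\<in>?T. \<Sum>\<alpha>\<in>midx n m. \<Sum>\<beta>\<in>midx n m. c \<alpha> * cnj (c \<beta>) * (mpow n (torus_point L \<tau>) \<alpha> * cnj (mpow n (torus_point L \<tau>) \<beta>)))"
    unfolding of_real_sum complex_norm_square homp_def cnj_sum sum_product
    by (simp add: mult_ac)
  also have "\<dots> = (\<Sum>\<alpha>\<in>midx n m. \<Sum>\<beta>\<in>midx n m. c \<alpha> * cnj (c \<beta>) *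
      (\<Sum>\<tau>\<in>?T. mpow n (torus_point L \<tau>) \<alpha> * cnj (mpow n (torus_point L \<tau>) \<beta>)))"
    unfolding sum_distrib_left
    by (rule trans[OF sum.swap], rule sum.cong[OF refl], rule sum.swap)
  also have "\<dots> = (\<Sum>\<alpha>\<in>midx n m. \<Sum>\<beta>\<in>midx n m. c \<alpha> * cnj (c \<beta>) * (if \<alpha> = \<beta> then of_nat L ^ n else 0))"
    using assms by (intro sum.cong refl) (simp only: torus_orthogonal)
  also have "\<dots> = (\<Sum>\<alpha>\<in>midx n m. c \<alpha> * cnj (c \<alpha>) * of_nat L ^ n)"
    by (intro sum.cong refl) (simp add: if_distrib[of "\<lambda>x. _ * x"] cong: if_cong)
  also have "\<dots> = of_real (coeff_sq n m c * real L ^ n)"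
    unfolding coeff_sq_def sum_distrib_right of_real_sum of_real_mult complex_norm_square by simp
  finally have "(\<Sum>\<tau>\<in>?T. (norm (homp n m c (torus_point L \<tau>)))\<^sup>2) = coeff_sq n m c * real L ^ n"
    by (simp only: of_real_eq_iff)
  then show ?thesis
    using assms by (simp add: tavg_def)
qed

definition selfconv :: "nat \<Rightarrow> nat \<Rightarrow> ((nat \<Rightarrow> nat) \<Rightarrow> complex) \<Rightarrow> (nat \<Rightarrow> nat) \<Rightarrow> complex" where
  "selfconv n m c \<gamma> = (\<Sum>\<alpha>\<in>{\<alpha>\<in>midx n m. \<alpha> \<le> \<gamma>}. c \<alpha> * c (\<gamma> - \<alpha>))"

lemma bij_betw_midx_add:
  "bij_betw (\<lambda>(\<gamma>, \<alpha>). (\<alpha>, \<gamma> - \<alpha>)) (Sigma (midx n (j + m)) (\<lambda>\<gamma>. {\<alpha>\<in>midx n j. \<alpha> \<le> \<gamma>})) (midx n j \<times> midx n m)"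
  by (rule bij_betw_byWitness[where f' = "\<lambda>(\<alpha>, \<beta>). (\<lambda>k. \<alpha> k + \<beta> k, \<alpha>)"])
     (auto simp: midx_def multi_indices_def le_fun_def fun_eq_iff sum.distrib sum_subtractf_nat)

lemma mpow_add: "mpow n z (\<lambda>k. \<alpha> k + \<beta> k) = mpow n z \<alpha> * mpow n z \<beta>"
  by (simp add: mpow_def power_add prod.distrib)

lemma mpow_diff: "\<alpha> \<le> \<gamma> \<Longrightarrow> mpow n z \<alpha> * mpow n z (\<gamma> - \<alpha>) = mpow n z \<gamma>"
  using mpow_add[of n z \<alpha> "\<gamma> - \<alpha>"] by (simp add: le_fun_def)

lemma homp_square: "(homp n m c z)\<^sup>2 = homp n (m + m) (selfconv n m c) z"
proof -
  have "(homp n m c z)\<^sup>2 = (\<Sum>(\<alpha>,\<beta>)\<in>midx n m \<times> midx n m. (c \<alpha> * mpow n z \<alpha>) * (c \<beta> * mpow n z \<beta>))"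
    by (simp add: homp_def power2_eq_square sum_product sum.cartesian_product)
  also have "\<dots> = (\<Sum>(\<gamma>,\<alpha>)\<in>Sigma (midx n (m + m)) (\<lambda>\<gamma>. {\<alpha>\<in>midx n m. \<alpha> \<le> \<gamma>}).
      (c \<alpha> * mpow n z \<alpha>) * (c (\<gamma> - \<alpha>) * mpow n z (\<gamma> - \<alpha>)))"
    by (subst sum.reindex_bij_betw[OF bij_betw_midx_add, symmetric]) (simp add: split_def)
  also have "\<dots> = (\<Sum>(\<gamma>,\<alpha>)\<in>Sigma (midx n (m + m)) (\<lambda>\<gamma>. {\<alpha>\<in>midx n m. \<alpha> \<le> \<gamma>}).
      c \<alpha> * c (\<gamma> - \<alpha>) * mpow n z \<gamma>)"
  proof (intro sum.cong refl, clarify)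
    fix \<gamma> \<alpha> :: "nat \<Rightarrow> nat" assume "\<alpha> \<le> \<gamma>"
    show "(c \<alpha> * mpow n z \<alpha>) * (c (\<gamma> - \<alpha>) * mpow n z (\<gamma> - \<alpha>)) = c \<alpha> * c (\<gamma> - \<alpha>) * mpow n z \<gamma>"
      unfolding mpow_diff[OF \<open>\<alpha> \<le> \<gamma>\<close>, of n z, symmetric] by (simp only: mult_ac)
  qed
  also have "\<dots> = homp n (m + m) (selfconv n m c) z"
    by (subst sum.Sigma[symmetric]) (auto simp: homp_def selfconv_def sum_distrib_right)
  finally show ?thesis .
qed

text \<open>The number of multi-indices below \<gamma> is the product of the 1 + \<gamma>_k, and 1 +
  a \<le> 2^a.\<close>

lemma card_midx_below:
  assumes "\<gamma> \<in> midx n q"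
  shows "card {\<alpha>\<in>midx n m. \<alpha> \<le> \<gamma>} \<le> 2 ^ q"
proof -
  have "card {\<alpha>\<in>midx n m. \<alpha> \<le> \<gamma>} \<le> card (index_box n (\<lambda>k. {..\<gamma> k}))"
    by (intro card_mono finite_index_box) (auto simp: index_box_def midx_def le_fun_def)
  also have "\<dots> = (\<Prod>k<n. Suc (\<gamma> k))"
    using sum_index_box_prod[of n "\<lambda>k. {..\<gamma> k}" "\<lambda>_ _. 1 :: nat"] by simp
  also have "\<dots> \<le> (\<Prod>k<n. 2 ^ \<gamma> k)"
    by (intro prod_mono) (auto simp: Suc_leI)
  also have "\<dots> = 2 ^ q"
    using assms by (simp add: midx_def power_sum[symmetric])
  finally show ?thesis .
qed

text \<open>A multi-index of degree $2m$ splits into a sum of two in at most $2^{2m}$ ways, so squaring the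
polynomial bounds its fourth moment by its second one.\<close>

lemma coeff_sq_selfconv_le: "coeff_sq n (m + m) (selfconv n m c) \<le> 4 ^ m * (coeff_sq n m c)\<^sup>2"
proof -
  let ?B = "\<lambda>\<gamma>. {\<alpha>\<in>midx n m. \<alpha> \<le> \<gamma>}"
  have "(norm (selfconv n m c \<gamma>))\<^sup>2 \<le> 4 ^ m * (\<Sum>\<alpha>\<in>?B \<gamma>. (norm (c \<alpha>))\<^sup>2 * (norm (c (\<gamma> - \<alpha>)))\<^sup>2)"
    if "\<gamma> \<in> midx n (m + m)" for \<gamma>
  proof -
    have "(norm (selfconv n m c \<gamma>))\<^sup>2 \<le> (\<Sum>\<alpha>\<in>?B \<gamma>. norm (c \<alpha>) * norm (c (\<gamma> - \<alpha>)))\<^sup>2"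
      unfolding selfconv_def norm_mult[symmetric] by (intro power_mono norm_sum) auto
    also have "\<dots> \<le> (\<Sum>\<alpha>\<in>?B \<gamma>. (norm (c \<alpha>) * norm (c (\<gamma> - \<alpha>)))\<^sup>2) * real (card (?B \<gamma>))"
      by (rule sum_squared_le_sum_of_squares)
    also have "\<dots> \<le> (\<Sum>\<alpha>\<in>?B \<gamma>. (norm (c \<alpha>) * norm (c (\<gamma> - \<alpha>)))\<^sup>2) * 4 ^ m"
    proof (rule mult_left_mono)
      have "real (card (?B \<gamma>)) \<le> real (2 ^ (m + m))"
        using card_midx_below[OF that] by (intro of_nat_mono)
      also have "\<dots> = 4 ^ m"
        by (simp add: power_add flip: power_mult_distrib)
      finally show "real (card (?B \<gamma>)) \<le> 4 ^ m" .
    qed (auto intro: sum_nonneg)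
    finally show ?thesis
      by (simp add: power_mult_distrib mult.commute)
  qed
  then have "coeff_sq n (m + m) (selfconv n m c)
      \<le> (\<Sum>\<gamma>\<in>midx n (m + m). 4 ^ m * (\<Sum>\<alpha>\<in>?B \<gamma>. (norm (c \<alpha>))\<^sup>2 * (norm (c (\<gamma> - \<alpha>)))\<^sup>2))"
    unfolding coeff_sq_def by (rule sum_mono)
  also have "\<dots> = 4 ^ m * (\<Sum>(\<gamma>,\<alpha>)\<in>Sigma (midx n (m + m)) ?B. (norm (c \<alpha>))\<^sup>2 * (norm (c (\<gamma> - \<alpha>)))\<^sup>2)"
    unfolding sum_distrib_left[symmetric] by (subst sum.Sigma) auto
  also have "\<dots> = 4 ^ m * (\<Sum>(\<alpha>,\<beta>)\<in>midx n m \<times> midx n m. (norm (c \<alpha>))\<^sup>2 * (norm (c \<beta>))\<^sup>2)"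
    by (subst sum.reindex_bij_betw[OF bij_betw_midx_add, symmetric]) (simp add: split_def)
  also have "\<dots> = 4 ^ m * (coeff_sq n m c)\<^sup>2"
    by (simp add: coeff_sq_def power2_eq_square sum_product sum.cartesian_product)
  finally show ?thesis .
qed

lemma tavg_norm4_le:
  assumes "m + m < L"
  shows "tavg L n (\<lambda>z. norm (homp n m c z) ^ 4) \<le> 4 ^ m * (coeff_sq n m c)\<^sup>2"
proof -
  have "norm (homp n m c z) ^ 4 = (norm (homp n (m + m) (selfconv n m c) z))\<^sup>2" for z
    by (simp flip: homp_square add: norm_power)
  then show ?thesis
    using parseval[OF assms] coeff_sq_selfconv_le by simp
qed

text \<open>Interpolating the second moment between the $p$-th and the fourth one gives a constant whose
exponential growth in $m$ disappears as $k$ grows, that is, as $p$ tends to $2$.\<close>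

lemma hypercontractive:
  fixes k :: nat
  assumes "m + m < L" "k \<ge> 1" and p: "p = 2 * real k / real (k + 1)"
  shows "coeff_sq n m c powr (real k / real (k + 1)) \<le>
     4 powr (real m / real (k + 1)) * tavg L n (\<lambda>z. norm (homp n m c z) powr p)"
proof (cases "coeff_sq n m c = 0")
  case True
  then show ?thesis by (auto intro!: mult_nonneg_nonneg tavg_nonneg)
next
  case False
  define s where "s = coeff_sq n m c"
  define a where "a = tavg L n (\<lambda>z. norm (homp n m c z) powr p)"
  define b where "b = tavg L n (\<lambda>z. norm (homp n m c z) ^ 4)"
  have s: "s > 0" using False by (simp add: s_def coeff_sq_def sum_nonneg less_le)
  have L: "L > 0" "m < L" using assms by auto
  have par: "tavg L n (\<lambda>z. (norm (homp n m c z))\<^sup>2) = s"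
    using L parseval by (simp add: s_def)
  have nz: "\<exists>\<tau>\<in>index_box n (\<lambda>_. {..<L}). homp n m c (torus_point L \<tau>) \<noteq> 0"
    using s par tavg_pos_iff[of L "\<lambda>z. (norm (homp n m c z))\<^sup>2" n] L by auto
  have "a \<noteq> 0"
    using nz tavg_pos_iff[of L "\<lambda>z. norm (homp n m c z) powr p" n] L by (auto simp: a_def)
  then have a: "a > 0" by (simp add: a_def less_le tavg_nonneg)
  have "b \<noteq> 0"
    using nz tavg_pos_iff[of L "\<lambda>z. norm (homp n m c z) ^ 4" n] L by (auto simp: b_def)
  then have b: "b > 0" by (simp add: b_def less_le tavg_nonneg)
  \<comment> \<open>The Hoelder weight that places 2 between the exponents p and 4: p \<theta> + 4
    (1 - \<theta>) = 2.\<close>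
  define \<theta> where "\<theta> = real (k + 1) / real (k + 2)"
  have p\<theta>: "p * \<theta> = 2 * real k / real (k + 2)"
    using assms(2) by (simp add: \<theta>_def p del: of_nat_add)
  have \<theta>4: "1 - \<theta> = 1 / real (k + 2)"
    by (simp add: \<theta>_def field_simps)
  have "p * \<theta> + 4 * (1 - \<theta>) = 2"
    unfolding p\<theta> \<theta>4 by (simp add: add_divide_distrib[symmetric] divide_eq_eq)
  then have \<theta>: "0 < \<theta>" "\<theta> < 1" "p * \<theta> + 4 * (1 - \<theta>) = 2" "1 - \<theta> = 1 / real (k + 2)"
    using \<theta>4 by (simp_all, simp_all add: \<theta>_def)
  \<comment> \<open>Young's inequality after normalising by the moments a and b; averaging it gives
    Hoelder's inequality s \<le> a^\<theta> b^(1 - \<theta>).\<close>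
  have pw: "X\<^sup>2 \<le> (a powr \<theta> * b powr (1 - \<theta>)) * (\<theta> / a * X powr p + (1 - \<theta>) / b * X ^ 4)" if "X \<ge> 0" for X
  proof (cases "X = 0")
    case False
    then have X: "X > 0" using that by simp
    have "(X powr p / a) powr \<theta> * (X ^ 4 / b) powr (1 - \<theta>) \<le> \<theta> * (X powr p / a) + (1 - \<theta>) * (X ^ 4 / b)"
      using X a b \<theta> by (intro Youngs_inequality_0) auto
    moreover have "(X powr p / a) powr \<theta> * (X ^ 4 / b) powr (1 - \<theta>)
        = X powr (p * \<theta>) * X powr (4 * (1 - \<theta>)) / (a powr \<theta> * b powr (1 - \<theta>))"
      using X a b by (simp add: powr_divide powr_powr flip: powr_numeral)
    moreover have "X powr (p * \<theta>) * X powr (4 * (1 - \<theta>)) = X\<^sup>2"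
      using X \<theta> by (simp flip: powr_add)
    ultimately have "X\<^sup>2 / (a powr \<theta> * b powr (1 - \<theta>)) \<le> \<theta> * (X powr p / a) + (1 - \<theta>) * (X ^ 4 / b)"
      by simp
    then show ?thesis using a b by (simp add: field_simps)
  qed (use \<theta> in auto)
  have "s \<le> tavg L n (\<lambda>z. (a powr \<theta> * b powr (1 - \<theta>)) *
     (\<theta> / a * norm (homp n m c z) powr p + (1 - \<theta>) / b * norm (homp n m c z) ^ 4))"
    unfolding par[symmetric] by (intro tavg_mono pw) simp
  also have "\<dots> = (a powr \<theta> * b powr (1 - \<theta>)) * (\<theta> / a * a + (1 - \<theta>) / b * b)"
    by (simp only: tavg_cmult tavg_add a_def b_def)
  also have "\<dots> = a powr \<theta> * b powr (1 - \<theta>)"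
    using a b by simp
  also have "\<dots> \<le> a powr \<theta> * (4 ^ m * s\<^sup>2) powr (1 - \<theta>)"
    using \<theta> b tavg_norm4_le[OF assms(1), of n c]
    by (intro mult_left_mono powr_mono2) (auto simp: b_def s_def)
  \<comment> \<open>The fourth moment bound brings s back on the right with exponent 2 (1 -
    \<theta>) = 2 / (k + 2) < 1, so after taking logarithms it is absorbed on the left.\<close>
  finally have "ln s \<le> ln (a powr \<theta> * (4 ^ m * s\<^sup>2) powr (1 - \<theta>))"
    using s by simp
  also have "\<dots> = \<theta> * ln a + (1 - \<theta>) * (real m * ln 4 + 2 * ln s)"
    using s a by (simp add: ln_mult ln_powr ln_realpow)
  also have "\<dots> = (real (k + 1) * ln a + real m * ln 4 + 2 * ln s) / real (k + 2)"
  proof -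
    have "\<theta> * ln a = real (k + 1) * ln a / real (k + 2)"
      by (simp add: \<theta>_def del: of_nat_add)
    then show ?thesis unfolding \<theta>(4) by (simp add: add_divide_distrib)
  qed
  finally have "real k * ln s \<le> real (k + 1) * ln a + real m * ln 4"
    by (simp add: field_simps)
  then have "real k * ln s / real (k + 1) \<le> (real (k + 1) * ln a + real m * ln 4) / real (k + 1)"
    by (intro divide_right_mono) auto
  then have "real k / real (k + 1) * ln s \<le> ln a + real m / real (k + 1) * ln 4"
    by (simp add: add_divide_distrib del: of_nat_add)
  then have "exp (real k / real (k + 1) * ln s) \<le> exp (real m / real (k + 1) * ln 4 + ln a)"
    by simp
  then show ?thesis
    using s a unfolding s_def[symmetric] a_def[symmetric] by (simp add: powr_def exp_add mult.commute)
qed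

text \<open>The case k = 1, p = 1 of \<open>hypercontractive\<close>: in degree m, the L2 norm
  exceeds the L1 norm by a factor of at most 2^m.\<close>

lemma coeff_l2_le_tavg:
  assumes "m + m < L"
  shows "sqrt (coeff_sq n m c) \<le> 2 ^ m * tavg L n (\<lambda>z. norm (homp n m c z))"
proof -
  have "(4::real) powr (real m / 2) = (2 powr 2) powr (real m / 2)" by simp
  also have "\<dots> = 2 powr real m" by (subst powr_powr) simp
  finally have 1: "4 powr (real m / 2) = (2::real) ^ m" by (simp add: powr_realpow)
  have 2: "coeff_sq n m c powr (real 1 / real (1 + 1)) = sqrt (coeff_sq n m c)"
    by (simp add: powr_half_sqrt coeff_sq_def sum_nonneg)
  have 3: "norm (homp n m c z) powr 1 = norm (homp n m c z)" for z
    by simp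
  show ?thesis
    using hypercontractive[of m L 1 1 n c] assms 1 unfolding 2 3 by simp
qed

section \<open>Cauchy estimates and Taylor expansion of homogeneous polynomials\<close>

text \<open>Cauchy's estimate by averaging over m + 1 roots of unity, which separate the exponents
  0, ..., m.\<close>

lemma poly_coeff_bound:
  fixes q :: "nat \<Rightarrow> complex"
  assumes "\<And>t. norm t = \<rho> \<Longrightarrow> norm (\<Sum>i\<le>m. q i * t ^ i) \<le> M" "0 < \<rho>" "k \<le> m"
  shows "norm (q k) * \<rho> ^ k \<le> M"
proof -
  define L where "L = Suc m"
  have L: "L > 0" by (simp add: L_def)
  let ?x = "\<lambda>j. cis (2 * pi * real j / real L)"
  have "(\<Sum>j<L. (\<Sum>i\<le>m. q i * (of_real \<rho> * ?x j) ^ i) * cnj (?x j ^ k))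
      = (\<Sum>j<L. \<Sum>i\<le>m. q i * of_real \<rho> ^ i * (?x j ^ i * cnj (?x j ^ k)))"
    by (simp only: sum_distrib_right power_mult_distrib mult.assoc)
  also have "\<dots> = (\<Sum>i\<le>m. q i * of_real \<rho> ^ i * (\<Sum>j<L. ?x j ^ i * cnj (?x j ^ k)))"
    unfolding sum_distrib_left by (rule sum.swap)
  also have "\<dots> = (\<Sum>i\<le>m. q i * of_real \<rho> ^ i * (if i = k then of_nat L else 0))"
  proof (intro sum.cong refl)
    fix i assume "i \<in> {..m}"
    then have "int L dvd int i - int k \<longleftrightarrow> i = k"
      using assms(3) by (intro dvd_int_diff_iff) (auto simp: L_def)
    then show "q i * of_real \<rho> ^ i * (\<Sum>j<L. ?x j ^ i * cnj (?x j ^ k)) = q i * of_real \<rho> ^ i * (if i = k then of_nat L else 0)"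
      by (simp only: sum_root_unity[OF L])
  qed
  also have "\<dots> = q k * of_real \<rho> ^ k * of_nat L"
    using assms(3) by (simp add: if_distrib[of "\<lambda>x. _ * x"] cong: if_cong)
  finally have eq: "(\<Sum>j<L. (\<Sum>i\<le>m. q i * (of_real \<rho> * ?x j) ^ i) * cnj (?x j ^ k)) = q k * of_real \<rho> ^ k * of_nat L" .
  have "norm (q k) * \<rho> ^ k * real L = norm (\<Sum>j<L. (\<Sum>i\<le>m. q i * (of_real \<rho> * ?x j) ^ i) * cnj (?x j ^ k))"
    unfolding eq using assms(2) by (simp add: norm_mult norm_power)
  also have "\<dots> \<le> (\<Sum>j<L. M)"
  proof (rule sum_norm_le)
    fix j assume "j \<in> {..<L}"
    have "norm (\<Sum>i\<le>m. q i * (of_real \<rho> * ?x j) ^ i) \<le> M"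
      using assms(2) by (intro assms(1)) (simp add: norm_mult)
    then show "norm ((\<Sum>i\<le>m. q i * (of_real \<rho> * ?x j) ^ i) * cnj (?x j ^ k)) \<le> M"
      by (simp add: norm_mult norm_power)
  qed
  finally show ?thesis using L by (simp add: mult.commute)
qed

definition polydisc_bound :: "nat \<Rightarrow> nat \<Rightarrow> ((nat \<Rightarrow> nat) \<Rightarrow> complex) \<Rightarrow> real \<Rightarrow> bool" where
  "polydisc_bound n m c B \<longleftrightarrow> (\<forall>z. (\<forall>k. norm (z k) \<le> 1) \<longrightarrow> norm (homp n m c z) \<le> B)"

text \<open>The coefficients of $\partial^\gamma P / \gamma!$ for the polynomial $P$ with coefficients $c$.\<close>

definition taylor_coeff :: "nat \<Rightarrow> ((nat \<Rightarrow> nat) \<Rightarrow> complex) \<Rightarrow> (nat \<Rightarrow> nat) \<Rightarrow> (nat \<Rightarrow> nat) \<Rightarrow> complex" where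
  "taylor_coeff n c \<gamma> \<beta> = of_nat (\<Prod>k<n. \<beta> k + \<gamma> k choose \<gamma> k) * c (\<lambda>k. \<beta> k + \<gamma> k)"

lemma mpow_cmult: "\<alpha> \<in> midx n m \<Longrightarrow> mpow n (\<lambda>k. t * z k) \<alpha> = t ^ m * mpow n z \<alpha>"
  by (simp add: mpow_def power_mult_distrib prod.distrib power_sum[symmetric] midx_def)

lemma homp_cmult: "homp n m c (\<lambda>k. t * z k) = t ^ m * homp n m c z"
  by (simp add: homp_def mpow_cmult sum_distrib_left mult_ac)

text \<open>A pair \<gamma> \<le> \<alpha> amounts to the pair \<gamma>, \<beta> = \<alpha> -
  \<gamma>, sorted by the degree k of \<gamma>; this is the reindexing behind Taylor's
  formula.\<close>

lemma bij_betw_midx_split: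
  "bij_betw (\<lambda>(k, \<gamma>, \<beta>). (\<lambda>i. \<beta> i + \<gamma> i, \<gamma>)) (Sigma {..m} (\<lambda>k. midx n k \<times> midx n (m - k)))
     (Sigma (midx n m) (\<lambda>\<alpha>. index_box n (\<lambda>i. {..\<alpha> i})))"
proof (rule bij_betw_byWitness[where f' = "\<lambda>(\<alpha>, \<gamma>). (\<Sum>i<n. \<gamma> i, \<gamma>, \<lambda>i. \<alpha> i - \<gamma> i)"])
  have "\<alpha> i - \<gamma> i + \<gamma> i = \<alpha> i" if "\<alpha> \<in> midx n m" "\<gamma> \<in> index_box n (\<lambda>i. {..\<alpha> i})" for \<alpha> \<gamma> i
    using that by (cases "i < n") (auto simp: midx_def index_box_def multi_indices_def)
  then show "\<forall>a'\<in>Sigma (midx n m) (\<lambda>\<alpha>. index_box n (\<lambda>i. {..\<alpha> i})).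
       (\<lambda>(k, \<gamma>, \<beta>). (\<lambda>i. \<beta> i + \<gamma> i, \<gamma>)) ((\<lambda>(\<alpha>, \<gamma>). (\<Sum>i<n. \<gamma> i, \<gamma>, \<lambda>i. \<alpha> i - \<gamma> i)) a') = a'"
    by auto
  have "(\<Sum>i<n. \<gamma> i) \<le> m \<and> \<gamma> \<in> midx n (\<Sum>i<n. \<gamma> i) \<and> (\<lambda>i. \<alpha> i - \<gamma> i) \<in> midx n (m - (\<Sum>i<n. \<gamma> i))"
    if "\<alpha> \<in> midx n m" "\<gamma> \<in> index_box n (\<lambda>i. {..\<alpha> i})" for \<alpha> \<gamma>
    using that by (auto simp: midx_def index_box_def multi_indices_def intro!: sum_mono sum_subtractf_nat)
  then show "(\<lambda>(\<alpha>, \<gamma>). (\<Sum>i<n. \<gamma> i, \<gamma>, \<lambda>i. \<alpha> i - \<gamma> i)) ` Sigma (midx n m) (\<lambda>\<alpha>. index_box n (\<lambda>i. {..\<alpha> i}))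
    \<subseteq> Sigma {..m} (\<lambda>k. midx n k \<times> midx n (m - k))"
    by auto
qed (auto simp: midx_def index_box_def multi_indices_def sum.distrib fun_eq_iff)

text \<open>Taylor's formula at z: the part of degree k in the increment w has as coefficients the
  derivatives of order \<gamma> at z divided by \<gamma>!.\<close>

lemma homp_add:
  "homp n m c (\<lambda>i. w i + z i) = (\<Sum>k\<le>m. homp n k (\<lambda>\<gamma>. homp n (m - k) (taylor_coeff n c \<gamma>) z) w)"
proof -
  have "homp n m c (\<lambda>i. w i + z i) = (\<Sum>\<alpha>\<in>midx n m. \<Sum>\<gamma>\<in>index_box n (\<lambda>i. {..\<alpha> i}).
      c \<alpha> * (of_nat (\<Prod>i<n. \<alpha> i choose \<gamma> i) * mpow n w \<gamma> * mpow n z (\<lambda>i. \<alpha> i - \<gamma> i)))"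
    by (simp add: homp_def mpow_def prod_add_power_index_box sum_distrib_left)
  also have "\<dots> = (\<Sum>(\<alpha>,\<gamma>)\<in>Sigma (midx n m) (\<lambda>\<alpha>. index_box n (\<lambda>i. {..\<alpha> i})).
      c \<alpha> * (of_nat (\<Prod>i<n. \<alpha> i choose \<gamma> i) * mpow n w \<gamma> * mpow n z (\<lambda>i. \<alpha> i - \<gamma> i)))"
    by (subst sum.Sigma) (auto simp: finite_index_box)
  also have "\<dots> = (\<Sum>(k,\<gamma>,\<beta>)\<in>Sigma {..m} (\<lambda>k. midx n k \<times> midx n (m - k)).
      taylor_coeff n c \<gamma> \<beta> * mpow n z \<beta> * mpow n w \<gamma>)"
    by (subst sum.reindex_bij_betw[OF bij_betw_midx_split, symmetric])
       (simp add: split_def taylor_coeff_def mult_ac)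
  also have "\<dots> = (\<Sum>k\<le>m. \<Sum>(\<gamma>,\<beta>)\<in>midx n k \<times> midx n (m - k). taylor_coeff n c \<gamma> \<beta> * mpow n z \<beta> * mpow n w \<gamma>)"
    by (subst sum.Sigma) auto
  also have "\<dots> = (\<Sum>k\<le>m. homp n k (\<lambda>\<gamma>. homp n (m - k) (taylor_coeff n c \<gamma>) z) w)"
    by (simp add: homp_def sum.cartesian_product sum_distrib_right)
  finally show ?thesis .
qed

text \<open>Cauchy estimate in $t$ for $P(z + t w)$ on $|t| = 1/m$: enlarging the polydisc by $1 + 1/m$ costs
only a factor $e$.\<close>

lemma polydisc_bound_taylor:
  assumes "polydisc_bound n m c B" "k \<le> m" "m \<ge> 1" and z: "\<And>i. norm (z i) \<le> 1"
  shows "polydisc_bound n k (\<lambda>\<gamma>. homp n (m - k) (taylor_coeff n c \<gamma>) z) (exp 1 * real m ^ k * B)"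
  unfolding polydisc_bound_def
proof (intro allI impI)
  fix w :: "nat \<Rightarrow> complex" assume w: "\<forall>i. norm (w i) \<le> 1"
  let ?Q = "\<lambda>k. homp n k (\<lambda>\<gamma>. homp n (m - k) (taylor_coeff n c \<gamma>) z) w"
  have "norm (?Q k) * (1 / real m) ^ k \<le> exp 1 * B"
  proof (rule poly_coeff_bound[where m = m])
    fix t :: complex assume t: "norm t = 1 / real m"
    have "(\<Sum>i\<le>m. ?Q i * t ^ i) = homp n m c (\<lambda>i. t * w i + z i)"
      by (subst homp_add) (simp add: homp_cmult mult.commute)
    also have "\<dots> = homp n m c (\<lambda>i. of_real (1 + 1 / real m) * ((t * w i + z i) / of_real (1 + 1 / real m)))"
    proof -
      have "complex_of_real (1 + 1 / real m) \<noteq> 0"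
        by (metis add_pos_nonneg of_nat_0_le_iff of_real_eq_0_iff order_less_irrefl zero_le_divide_1_iff zero_less_one)
      then show ?thesis by simp
    qed
    also have "norm \<dots> = (1 + 1 / real m) ^ m * norm (homp n m c (\<lambda>i. (t * w i + z i) / of_real (1 + 1 / real m)))"
      unfolding homp_cmult norm_mult norm_power norm_of_real by simp
    also have "\<dots> \<le> exp 1 * B"
    proof (rule mult_mono)
      have "(1 + 1 / real m) ^ m \<le> exp (1 / real m) ^ m"
        by (intro power_mono exp_ge_add_one_self) simp
      also have "\<dots> = exp 1"
        using assms(3) by (simp flip: exp_of_nat_mult)
      finally show "(1 + 1 / real m) ^ m \<le> exp 1" .
      have "norm ((t * w i + z i) / of_real (1 + 1 / real m)) \<le> 1" for i
      proof -
        have "norm (t * w i + z i) \<le> norm t * norm (w i) + norm (z i)"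
          by (metis norm_mult norm_triangle_ineq)
        also have "\<dots> \<le> (1 / real m) * 1 + 1"
          unfolding t using w z by (intro add_mono mult_left_mono) auto
        finally show ?thesis
          unfolding norm_divide norm_of_real by (simp add: divide_le_eq abs_of_pos add_pos_nonneg)
      qed
      then show "norm (homp n m c (\<lambda>i. (t * w i + z i) / of_real (1 + 1 / real m))) \<le> B"
        using assms(1)[unfolded polydisc_bound_def, rule_format, of "\<lambda>i. (t * w i + z i) / of_real (1 + 1 / real m)"] by blast
    qed auto
    finally show "norm (\<Sum>i\<le>m. ?Q i * t ^ i) \<le> exp 1 * B" .
  qed (use assms in auto)
  then show "norm (?Q k) \<le> exp 1 * real m ^ k * B"
    using assms(3) by (simp add: field_simps power_divide)
qed

lemma bij_betw_midx_shift:
  assumes "\<gamma> \<in> midx n k" "k \<le> m"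
  shows "bij_betw (\<lambda>\<beta> i. \<beta> i + \<gamma> i) (midx n (m - k)) {\<alpha> \<in> midx n m. \<gamma> \<le> \<alpha>}"
  by (rule bij_betw_byWitness[where f' = "\<lambda>\<alpha> i. \<alpha> i - \<gamma> i"])
     (use assms in \<open>auto simp: midx_def multi_indices_def sum.distrib sum_subtractf_nat le_fun_def\<close>)

lemma norm_le_taylor_coeff: "norm (c (\<lambda>i. \<beta> i + \<gamma> i)) \<le> norm (taylor_coeff n c \<gamma> \<beta>)"
proof -
  have "1 \<le> (\<Prod>i<n. \<beta> i + \<gamma> i choose \<gamma> i)"
    by (intro prod_ge_1) (simp add: Suc_leI)
  then have "1 \<le> real (\<Prod>i<n. \<beta> i + \<gamma> i choose \<gamma> i)"
    by (metis of_nat_1 of_nat_mono)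
  then show ?thesis
    using mult_right_mono[of 1 "real (\<Prod>i<n. \<beta> i + \<gamma> i choose \<gamma> i)" "norm (c (\<lambda>i. \<beta> i + \<gamma> i))"]
    unfolding taylor_coeff_def norm_mult norm_of_nat by simp
qed

text \<open>The exponents above \<gamma> are those that survive the derivative of order \<gamma>,
  and by \<open>norm_le_taylor_coeff\<close> the moduli of their coefficients do not
  decrease.\<close>

lemma sum_sq_above_le:
  assumes "\<gamma> \<in> midx n k" "k \<le> m"
  shows "(\<Sum>\<alpha> | \<alpha> \<in> midx n m \<and> \<gamma> \<le> \<alpha>. (norm (c \<alpha>))\<^sup>2) \<le> coeff_sq n (m - k) (taylor_coeff n c \<gamma>)"
  unfolding coeff_sq_def sum.reindex_bij_betw[OF bij_betw_midx_shift[OF assms], symmetric]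
  by (intro sum_mono power_mono norm_le_taylor_coeff) auto

text \<open>Cauchy-Schwarz over the set above \<gamma>, which has as many elements as
  \<open>midx n (m - k)\<close>: the origin of the square root in
  \<open>sidon_bound\<close>.\<close>

lemma sum_above_le:
  assumes "\<gamma> \<in> midx n k" "k \<le> m"
  shows "(\<Sum>\<alpha> | \<alpha> \<in> midx n m \<and> \<gamma> \<le> \<alpha>. norm (c \<alpha>))
    \<le> sqrt (real (card (midx n (m - k)))) * sqrt (coeff_sq n (m - k) (taylor_coeff n c \<gamma>))"
proof -
  let ?A = "{\<alpha>. \<alpha> \<in> midx n m \<and> \<gamma> \<le> \<alpha>}"
  have card: "card ?A = card (midx n (m - k))"
    using bij_betw_same_card[OF bij_betw_midx_shift[OF assms]] by simp
  have "(\<Sum>\<alpha>\<in>?A. norm (c \<alpha>))\<^sup>2 \<le> (\<Sum>\<alpha>\<in>?A. (norm (c \<alpha>))\<^sup>2) * real (card ?A)"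
    by (rule sum_squared_le_sum_of_squares)
  also have "\<dots> \<le> coeff_sq n (m - k) (taylor_coeff n c \<gamma>) * real (card (midx n (m - k)))"
    unfolding card by (intro mult_right_mono sum_sq_above_le assms) auto
  finally show ?thesis
    by (simp add: real_le_rsqrt real_sqrt_mult[symmetric] mult.commute)
qed

text \<open>Lower one positive entry at a time. In \<open>sidon\<close> this shows that every
  monomial of degree m is met by some derivative of order k.\<close>

lemma ex_midx_below:
  assumes "\<alpha> \<in> midx n m" "k \<le> m"
  shows "\<exists>\<gamma>\<in>midx n k. \<gamma> \<le> \<alpha>"
  using assms(2)
proof (induction "m - k" arbitrary: k)
  case 0
  then have "k = m" by simp
  then show ?case using assms(1) by blast
next
  case (Suc d)
  have "d = m - Suc k" "Suc k \<le> m" using Suc.hyps(2) by auto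
  then obtain \<gamma> where \<gamma>: "\<gamma> \<in> midx n (Suc k)" "\<gamma> \<le> \<alpha>"
    using Suc.hyps(1)[of "Suc k"] by blast
  then have "(\<Sum>i<n. \<gamma> i) \<noteq> 0" by (simp add: midx_def)
  then obtain x where x: "x < n" "\<gamma> x > 0"
    by (metis gr0I lessThan_iff sum.neutral)
  have "(\<Sum>i<n. \<gamma> i) = \<gamma> x + (\<Sum>i\<in>{..<n}-{x}. \<gamma> i)"
    using x by (simp add: sum.remove)
  moreover have "(\<Sum>i<n. (\<gamma>(x := \<gamma> x - 1)) i) = (\<gamma> x - 1) + (\<Sum>i\<in>{..<n}-{x}. \<gamma> i)"
    using x by (simp add: sum.remove[of "{..<n}" x])
  ultimately have "\<gamma>(x := \<gamma> x - 1) \<in> midx n k"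
    using x \<gamma>(1) by (auto simp: midx_def multi_indices_def)
  moreover have "\<gamma>(x := \<gamma> x - 1) \<le> \<alpha>"
    using \<gamma>(2) by (auto simp: le_fun_def intro: le_trans[OF diff_le_self])
  ultimately show ?case by blast
qed

section \<open>The Bohnenblust--Hille inequality and Sidon constants\<close>

text \<open>The factor 2^(k-1) comes from comparing L2 and L1 norms in degree k - 1, the factor e k
  from the Cauchy estimate for one derivative.\<close>

definition bh_const :: "nat \<Rightarrow> real" where
  "bh_const k = 2 ^ (k - 1) * (exp 1 * real k)"

text \<open>The Bohnenblust--Hille exponent $2k/(k+1)$ turns $|b|^p$ into a geometric mean of $u^\gamma$ and the
$k$ factors $|b|^2 / u_x$, counted with multiplicity $\gamma_x$; both kinds of terms have sums
controlled by $\sum_x u_x$.\<close>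

lemma bohnenblust_hille_amgm:
  assumes "\<gamma> \<in> midx n k" "b \<noteq> 0" and p: "p = 2 * real k / real (k + 1)"
    and u: "\<And>x. x < n \<Longrightarrow> 0 \<le> u x" "\<And>x. x < n \<Longrightarrow> 0 < \<gamma> x \<Longrightarrow> 0 < u x"
  shows "norm (b :: complex) powr p \<le> ((\<Prod>x<n. u x ^ \<gamma> x) + (\<Sum>x<n. real (\<gamma> x) * (norm b)\<^sup>2 / u x)) / real (k + 1)"
proof -
  define T where "T = norm b powr p"
  define v where "v = (\<Prod>x<n. u x ^ \<gamma> x)"
  have b: "norm b > 0" using assms(2) by simp
  have T: "T > 0" using b by (simp add: T_def)
  have lnT: "real (k + 1) * ln T = 2 * real k * ln (norm b)"
    using b by (simp add: T_def ln_powr p del: of_nat_add)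
  have pos: "u x ^ \<gamma> x > 0" if "x < n" for x
    using u(2)[OF that] by (cases "\<gamma> x = 0") auto
  have v: "v > 0" unfolding v_def by (rule prod_pos) (simp only: pos lessThan_iff)
  have "ln v = (\<Sum>x<n. ln (u x ^ \<gamma> x))"
    unfolding v_def by (rule ln_prod) (simp, metis pos lessThan_iff less_irrefl)
  also have "\<dots> = (\<Sum>x<n. real (\<gamma> x) * ln (u x))"
  proof (rule sum.cong[OF refl])
    fix x assume "x \<in> {..<n}"
    then show "ln (u x ^ \<gamma> x) = real (\<gamma> x) * ln (u x)"
      using u(2)[of x] by (cases "\<gamma> x = 0") (auto simp: ln_realpow)
  qed
  finally have lnv: "ln v = (\<Sum>x<n. real (\<gamma> x) * ln (u x))" .
  have sumk: "(\<Sum>x<n. real (\<gamma> x)) = real k"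
    using assms(1) by (auto simp: midx_def)
  \<comment> \<open>AM-GM through ln x \<le> x - 1, applied to the k + 1 terms divided by T = |b|^p:
    by \<open>lnT\<close> the logarithms add up to 0.\<close>
  have "ln v - ln T \<le> v / T - 1"
    using ln_le_minus_one[of "v / T"] v T by (simp add: ln_div)
  moreover have "(\<Sum>x<n. real (\<gamma> x) * (2 * ln (norm b) - ln (u x) - ln T))
      \<le> (\<Sum>x<n. real (\<gamma> x) * (norm b)\<^sup>2 / u x / T - real (\<gamma> x))"
  proof (rule sum_mono)
    fix x assume "x \<in> {..<n}"
    then have x: "x < n" by simp
    show "real (\<gamma> x) * (2 * ln (norm b) - ln (u x) - ln T) \<le> real (\<gamma> x) * (norm b)\<^sup>2 / u x / T - real (\<gamma> x)"
    proof (cases "\<gamma> x = 0")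
      case False
      then have ux: "u x > 0" using u(2)[OF x] by simp
      have "ln ((norm b)\<^sup>2 / u x / T) \<le> (norm b)\<^sup>2 / u x / T - 1"
        using ux T b by (intro ln_le_minus_one) simp
      also have "ln ((norm b)\<^sup>2 / u x / T) = 2 * ln (norm b) - ln (u x) - ln T"
        using ux T b assms(2) by (simp add: ln_div ln_realpow ln_mult)
      finally have "real (\<gamma> x) * (2 * ln (norm b) - ln (u x) - ln T) \<le> real (\<gamma> x) * ((norm b)\<^sup>2 / u x / T - 1)"
        by (intro mult_left_mono) auto
      then show ?thesis by (simp add: algebra_simps)
    qed simp
  qed
  moreover have "(\<Sum>x<n. real (\<gamma> x) * (2 * ln (norm b) - ln (u x) - ln T)) = 2 * real k * ln (norm b) - ln v - real k * ln T"
    unfolding lnv sumk[symmetric] by (simp add: right_diff_distrib sum_subtractf sum_distrib_right sum_distrib_left mult_ac)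
  moreover have "(\<Sum>x<n. real (\<gamma> x) * (norm b)\<^sup>2 / u x / T - real (\<gamma> x)) = (\<Sum>x<n. real (\<gamma> x) * (norm b)\<^sup>2 / u x) / T - real k"
    unfolding sumk[symmetric] by (simp add: sum_subtractf sum_divide_distrib)
  ultimately have "real (k + 1) \<le> v / T + (\<Sum>x<n. real (\<gamma> x) * (norm b)\<^sup>2 / u x) / T"
    using lnT by (simp add: algebra_simps)
  then have "real (k + 1) * T \<le> v + (\<Sum>x<n. real (\<gamma> x) * (norm b)\<^sup>2 / u x)"
    using T by (simp add: field_simps)
  then show ?thesis
    unfolding T_def[symmetric] v_def[symmetric] by (simp add: field_simps)
qed

text \<open>Sum \<open>bohnenblust_hille_amgm\<close> over \<gamma>. As u x is the l2 norm of the
  coefficients that involve the variable x, the products contribute at most (sum u)^k \<le> 1 and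
  the variable x at most k (u x)^2 / u x = k u x; together this is (1 + k) / (k + 1).\<close>

lemma bohnenblust_hille_normalized:
  fixes b :: "(nat \<Rightarrow> nat) \<Rightarrow> complex"
  assumes p: "p = 2 * real k / real (k + 1)" and k: "k \<ge> 1"
    and u: "\<And>x. x < n \<Longrightarrow> u x = sqrt (\<Sum>\<gamma> | \<gamma> \<in> midx n k \<and> 0 < \<gamma> x. (norm (b \<gamma>))\<^sup>2)"
    and le: "(\<Sum>x<n. u x) \<le> 1"
  shows "(\<Sum>\<gamma>\<in>midx n k. norm (b \<gamma>) powr p) \<le> 1"
proof -
  have fin: "finite {\<gamma> \<in> midx n k. 0 < \<gamma> x}" for x by simp
  have u0: "0 \<le> u x" if "x < n" for x using u[OF that] by (simp add: sum_nonneg)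
  have "norm (b \<gamma>) powr p \<le> ((\<Prod>x<n. u x ^ \<gamma> x) + (\<Sum>x<n. real (\<gamma> x) * (norm (b \<gamma>))\<^sup>2 / u x)) / real (k + 1)"
    if \<gamma>: "\<gamma> \<in> midx n k" for \<gamma>
  proof (cases "b \<gamma> = 0")
    case True
    then show ?thesis using u0 by (auto intro!: divide_nonneg_nonneg prod_nonneg)
  next
    case False
    have "0 < u x" if "x < n" "0 < \<gamma> x" for x
    proof -
      have "0 < (norm (b \<gamma>))\<^sup>2" using False by simp
      also have "\<dots> \<le> (\<Sum>\<gamma> | \<gamma> \<in> midx n k \<and> 0 < \<gamma> x. (norm (b \<gamma>))\<^sup>2)"
        using \<gamma> that by (intro member_le_sum) auto
      finally show ?thesis using u[OF that(1)] by simp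
    qed
    then show ?thesis using bohnenblust_hille_amgm[OF \<gamma> False p, of u] u0 by blast
  qed
  then have "(\<Sum>\<gamma>\<in>midx n k. norm (b \<gamma>) powr p) \<le>
      (\<Sum>\<gamma>\<in>midx n k. ((\<Prod>x<n. u x ^ \<gamma> x) + (\<Sum>x<n. real (\<gamma> x) * (norm (b \<gamma>))\<^sup>2 / u x)) / real (k + 1))"
    by (rule sum_mono)
  also have "\<dots> = ((\<Sum>\<gamma>\<in>midx n k. \<Prod>x<n. u x ^ \<gamma> x) + (\<Sum>x<n. \<Sum>\<gamma>\<in>midx n k. real (\<gamma> x) * (norm (b \<gamma>))\<^sup>2 / u x)) / real (k + 1)"
  proof -
    have "(\<Sum>\<gamma>\<in>midx n k. (F \<gamma> + G \<gamma>) / c) = (sum F (midx n k) + sum G (midx n k)) / c" for F G and c :: real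
      by (simp add: sum.distrib sum_divide_distrib add_divide_distrib)
    then show ?thesis by (subst sum.swap)
  qed
  also have "\<dots> \<le> (1 + real k) / real (k + 1)"
  proof (intro divide_right_mono add_mono)
    have "(\<Sum>\<gamma>\<in>midx n k. \<Prod>x<n. u x ^ \<gamma> x) \<le> (\<Sum>x<n. u x) ^ k"
      by (rule sum_midx_power_le) (rule u0)
    also have "\<dots> \<le> 1"
      using le u0 by (intro power_le_one sum_nonneg) auto
    finally show "(\<Sum>\<gamma>\<in>midx n k. \<Prod>x<n. u x ^ \<gamma> x) \<le> 1" .
    have "(\<Sum>\<gamma>\<in>midx n k. real (\<gamma> x) * (norm (b \<gamma>))\<^sup>2 / u x) \<le> real k * u x" if "x < n" for x
    proof -
      have "(\<Sum>\<gamma>\<in>midx n k. real (\<gamma> x) * (norm (b \<gamma>))\<^sup>2 / u x)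
          = (\<Sum>\<gamma> | \<gamma> \<in> midx n k \<and> 0 < \<gamma> x. real (\<gamma> x) * (norm (b \<gamma>))\<^sup>2 / u x)"
        by (rule sum.mono_neutral_right) auto
      also have "\<dots> \<le> (\<Sum>\<gamma> | \<gamma> \<in> midx n k \<and> 0 < \<gamma> x. real k * (norm (b \<gamma>))\<^sup>2 / u x)"
        using u0[OF that] midx_le by (intro sum_mono divide_right_mono mult_right_mono) auto
      also have "\<dots> = real k * (u x)\<^sup>2 / u x"
        unfolding u[OF that] by (simp add: sum_nonneg sum_distrib_left sum_divide_distrib)
      \<comment> \<open>True for u x = 0 as well, since division by 0 yields 0.\<close>
      also have "\<dots> = real k * u x"
        by (simp add: power2_eq_square)
      finally show ?thesis .
    qed
    then have "(\<Sum>x<n. \<Sum>\<gamma>\<in>midx n k. real (\<gamma> x) * (norm (b \<gamma>))\<^sup>2 / u x) \<le> (\<Sum>x<n. real k * u x)"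
      by (intro sum_mono) auto
    also have "\<dots> \<le> real k"
      using mult_left_mono[OF le, of "real k"] by (simp add: sum_distrib_left)
    finally show "(\<Sum>x<n. \<Sum>\<gamma>\<in>midx n k. real (\<gamma> x) * (norm (b \<gamma>))\<^sup>2 / u x) \<le> real k" .
  qed simp
  finally show ?thesis by simp
qed

definition unit_idx :: "nat \<Rightarrow> nat \<Rightarrow> nat" where
  "unit_idx x = (\<lambda>i. if i = x then 1 else 0)"

lemma unit_idx_midx: "x < n \<Longrightarrow> unit_idx x \<in> midx n 1"
  by (auto simp: unit_idx_def midx_def multi_indices_def)

lemma unit_idx_le_iff: "unit_idx x \<le> \<gamma> \<longleftrightarrow> 0 < \<gamma> x"
  by (auto simp: unit_idx_def le_fun_def Suc_le_eq)

lemma midx_1_eq: "midx n 1 = unit_idx ` {..<n}"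
proof safe
  fix \<alpha> assume a: "\<alpha> \<in> midx n 1"
  then have "(\<Sum>i<n. \<alpha> i) \<noteq> 0" by (simp add: midx_def)
  then obtain x where x: "x < n" "\<alpha> x > 0"
    by (metis gr0I lessThan_iff sum.neutral)
  have ax: "\<alpha> x = 1" using midx_le[OF a, of x] x by simp
  have "(\<Sum>i<n. \<alpha> i) = \<alpha> x + (\<Sum>i\<in>{..<n}-{x}. \<alpha> i)"
    using x by (simp add: sum.remove)
  then have "\<forall>i\<in>{..<n}-{x}. \<alpha> i = 0"
    using a ax by (simp add: midx_def)
  then have "\<alpha> i = unit_idx x i" for i
    using a ax by (cases "i < n") (auto simp: unit_idx_def midx_def multi_indices_def)
  then show "\<alpha> \<in> unit_idx ` {..<n}" using x by auto
qed (use unit_idx_midx in auto)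

lemma inj_unit_idx: "inj unit_idx"
  by (rule injI) (auto simp: unit_idx_def fun_eq_iff split: if_splits)

lemma mpow_unit_idx: "x < n \<Longrightarrow> mpow n w (unit_idx x) = w x"
  by (simp add: mpow_def unit_idx_def if_distrib[of "\<lambda>i. _ ^ i"] cong: if_cong)

lemma homp_1: "homp n 1 f w = (\<Sum>x<n. f (unit_idx x) * w x)"
  unfolding homp_def midx_1_eq
  by (subst sum.reindex) (auto intro: inj_on_subset[OF inj_unit_idx] simp: mpow_unit_idx)

lemma mult_cnj_sgn: "v * cnj (sgn v) = of_real (norm v)"
  unfolding sgn_eq by (simp add: complex_norm_square[symmetric] power2_eq_square)

text \<open>These l2 norms are bounded by those of the partial derivatives, hence by 2^(k-1) times
  their L1 norms. At each point z the moduli of the partial derivatives add up to the norm on the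
  polydisc of the linear part of w -> P (z + w), which the Cauchy estimate controls.\<close>

lemma sum_l2_partial_le:
  assumes "polydisc_bound n k b B" "k \<ge> 1"
  shows "(\<Sum>x<n. sqrt (\<Sum>\<gamma> | \<gamma> \<in> midx n k \<and> 0 < \<gamma> x. (norm (b \<gamma>))\<^sup>2)) \<le> bh_const k * B"
proof -
  define L where "L = 2 * k"
  have L: "(k - 1) + (k - 1) < L" "L > 0" using assms(2) by (auto simp: L_def)
  let ?D = "\<lambda>x. homp n (k - 1) (taylor_coeff n b (unit_idx x))"
  have "(\<Sum>x<n. sqrt (\<Sum>\<gamma> | \<gamma> \<in> midx n k \<and> 0 < \<gamma> x. (norm (b \<gamma>))\<^sup>2))
      \<le> (\<Sum>x<n. 2 ^ (k - 1) * tavg L n (\<lambda>z. norm (?D x z)))"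
  proof (rule sum_mono)
    fix x assume "x \<in> {..<n}"
    then have x: "x < n" by simp
    have "sqrt (\<Sum>\<gamma> | \<gamma> \<in> midx n k \<and> 0 < \<gamma> x. (norm (b \<gamma>))\<^sup>2) \<le> sqrt (coeff_sq n (k - 1) (taylor_coeff n b (unit_idx x)))"
      using sum_sq_above_le[OF unit_idx_midx[OF x] assms(2), of b] unfolding unit_idx_le_iff by simp
    also have "\<dots> \<le> 2 ^ (k - 1) * tavg L n (\<lambda>z. norm (?D x z))"
      by (rule coeff_l2_le_tavg[OF L(1)])
    finally show "sqrt (\<Sum>\<gamma> | \<gamma> \<in> midx n k \<and> 0 < \<gamma> x. (norm (b \<gamma>))\<^sup>2) \<le> 2 ^ (k - 1) * tavg L n (\<lambda>z. norm (?D x z))" .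
  qed
  also have "\<dots> = 2 ^ (k - 1) * tavg L n (\<lambda>z. \<Sum>x<n. norm (?D x z))"
    by (simp add: tavg_sum sum_distrib_left)
  also have "tavg L n (\<lambda>z. \<Sum>x<n. norm (?D x z)) \<le> tavg L n (\<lambda>z. exp 1 * real k ^ 1 * B)"
  proof (rule tavg_mono)
    fix z :: "nat \<Rightarrow> complex" assume z: "\<And>i. norm (z i) = 1"
    \<comment> \<open>These phases make every term of the linear form nonnegative.\<close>
    define w where "w = (\<lambda>x. cnj (sgn (?D x z)))"
    have "norm (w x) \<le> 1" for x by (simp add: w_def norm_sgn)
    then have "norm (homp n 1 (\<lambda>\<gamma>. homp n (k - 1) (taylor_coeff n b \<gamma>) z) w) \<le> exp 1 * real k ^ 1 * B"
      using polydisc_bound_taylor[OF assms(1) assms(2) assms(2), of z] z unfolding polydisc_bound_def by simp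
    moreover have "homp n 1 (\<lambda>\<gamma>. homp n (k - 1) (taylor_coeff n b \<gamma>) z) w = of_real (\<Sum>x<n. norm (?D x z))"
      unfolding homp_1 w_def of_real_sum by (simp add: mult_cnj_sgn)
    ultimately have "\<bar>\<Sum>x<n. norm (?D x z)\<bar> \<le> exp 1 * real k ^ 1 * B"
      by (simp only: norm_of_real)
    then show "(\<Sum>x<n. norm (?D x z)) \<le> exp 1 * real k ^ 1 * B"
      by (rule abs_le_D1)
  qed
  also have "\<dots> = exp 1 * real k * B"
    using L by (simp add: tavg_const)
  finally show ?thesis by (simp add: bh_const_def mult_ac)
qed

lemma bohnenblust_hille:
  assumes "polydisc_bound n k b B" and k: "k \<ge> 1" and B: "B > 0" and p: "p = 2 * real k / real (k + 1)"
  shows "(\<Sum>\<gamma>\<in>midx n k. norm (b \<gamma>) powr p) \<le> (bh_const k * B) powr p"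
proof -
  define D where "D = bh_const k * B"
  have D: "D > 0" using B k by (simp add: D_def bh_const_def)
  have sq: "(norm (b \<gamma> / of_real D))\<^sup>2 = (norm (b \<gamma>))\<^sup>2 / D\<^sup>2" for \<gamma>
    by (simp add: norm_divide power_divide)
  have "(\<Sum>\<gamma>\<in>midx n k. norm (b \<gamma> / of_real D) powr p) \<le> 1"
  proof (rule bohnenblust_hille_normalized[OF p k refl])
    have "(\<Sum>x<n. sqrt (\<Sum>\<gamma> | \<gamma> \<in> midx n k \<and> 0 < \<gamma> x. (norm (b \<gamma> / of_real D))\<^sup>2))
       = (\<Sum>x<n. sqrt (\<Sum>\<gamma> | \<gamma> \<in> midx n k \<and> 0 < \<gamma> x. (norm (b \<gamma>))\<^sup>2)) / D"
      unfolding sq sum_divide_distrib[symmetric] real_sqrt_divide using D by simp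
    also have "\<dots> \<le> 1"
      using sum_l2_partial_le[OF assms(1) k] D by (simp add: D_def)
    finally show "(\<Sum>x<n. sqrt (\<Sum>\<gamma> | \<gamma> \<in> midx n k \<and> 0 < \<gamma> x. (norm (b \<gamma> / of_real D))\<^sup>2)) \<le> 1" .
  qed
  moreover have "(\<Sum>\<gamma>\<in>midx n k. norm (b \<gamma> / of_real D) powr p) = (\<Sum>\<gamma>\<in>midx n k. norm (b \<gamma>) powr p) / D powr p"
    unfolding norm_divide using D by (simp add: powr_divide sum_divide_distrib)
  ultimately show ?thesis
    using D unfolding D_def[symmetric] by (simp add: divide_le_eq)
qed

section \<open>Sidon constants\<close>

text \<open>Hoelder's inequality, linearised by Young's inequality at l, the common value of the f x
  in the case of equality.\<close>

lemma sum_le_powr_sum: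
  assumes A: "finite A" "real (card A) \<le> K" "K > 0" and f: "\<And>x. x \<in> A \<Longrightarrow> 0 \<le> f x"
    and p: "p \<ge> 1" and R: "(\<Sum>x\<in>A. f x powr p) \<le> R" "R > 0"
  shows "(\<Sum>x\<in>A. f x) \<le> K powr (1 - 1 / p) * R powr (1 / p)"
proof -
  define l where "l = (R / K) powr (1 / p)"
  have l: "l > 0" using A R by (simp add: l_def)
  have lp: "l powr p = R / K" using A R p by (simp add: l_def powr_powr)
  have pw: "f x \<le> 1 / p * f x powr p * l powr (1 - p) + (1 - 1 / p) * l" if "x \<in> A" for x
  proof (cases "f x = 0")
    case False
    then have fx: "f x > 0" using f[OF that] by simp
    have "(f x powr p * l powr (1 - p)) powr (1 / p) * l powr (1 - 1 / p)
      \<le> 1 / p * (f x powr p * l powr (1 - p)) + (1 - 1 / p) * l"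
      using fx l p by (intro Youngs_inequality_0) auto
    also have "(f x powr p * l powr (1 - p)) powr (1 / p) * l powr (1 - 1 / p)
      = f x * (l powr ((1 - p) * (1 / p)) * l powr (1 - 1 / p))"
      using fx l p by (simp add: powr_mult powr_powr)
    also have "l powr ((1 - p) * (1 / p)) * l powr (1 - 1 / p) = 1"
    proof -
      have "(1 - p) * (1 / p) + (1 - 1 / p) = 0" using p by (simp add: field_simps)
      then show ?thesis using l by (simp only: powr_add[symmetric]) simp
    qed
    finally show ?thesis by (simp add: mult.assoc)
  qed (use p l in auto)
  have "(\<Sum>x\<in>A. f x) \<le> (\<Sum>x\<in>A. 1 / p * f x powr p * l powr (1 - p) + (1 - 1 / p) * l)"
    by (rule sum_mono) (rule pw)
  also have "\<dots> = 1 / p * (\<Sum>x\<in>A. f x powr p) * l powr (1 - p) + (1 - 1 / p) * l * real (card A)"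
    by (simp add: sum.distrib sum_distrib_left sum_distrib_right)
  also have "\<dots> \<le> 1 / p * R * l powr (1 - p) + (1 - 1 / p) * l * K"
    using p l A R by (intro add_mono mult_left_mono mult_right_mono) auto
  also have "R * l powr (1 - p) = K * l"
  proof -
    have "l powr (1 - p) = l / (R / K)" using l by (simp add: powr_diff lp)
    then show ?thesis using A R by simp
  qed
  then have "1 / p * R * l powr (1 - p) + (1 - 1 / p) * l * K = K * l"
    using p by (simp add: field_simps)
  also have "K * l = K powr (1 - 1 / p) * R powr (1 / p)"
    using A R by (simp add: l_def powr_divide powr_diff)
  finally show ?thesis .
qed

text \<open>Differentiating only $k$ times, with $k$ fixed and $m$ large, keeps the full gain $n^{-1/2}$ over
Cauchy--Schwarz and leaves the exponential factor $2^{(m-k)/k}$, whose base is close to $1$.\<close>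

definition sidon_bound :: "nat \<Rightarrow> nat \<Rightarrow> nat \<Rightarrow> real" where
  "sidon_bound k m n = sqrt (real (card (midx n (m - k)))) *
     (real n powr ((real k - 1) / 2) * 2 powr (real (m - k) / real k) * (bh_const k * (exp 1 * real m ^ k)))"

text \<open>By \<open>ex_midx_below\<close> the sets above the \<gamma> of degree k cover all
  monomials, so the sum is at most a sum over \<gamma> of l2 norms A \<gamma> of derivatives. The
  sum of the A \<gamma>^p is controlled by a torus average, inside which Bohnenblust-Hille applies;
  returning from p to 1 over at most n^k indices costs n^((k-1)/2).\<close>

lemma sidon:
  assumes c: "polydisc_bound n m c B" and k: "1 \<le> k" "k \<le> m" and B: "B > 0" and n: "n \<ge> 1"
  shows "(\<Sum>\<alpha>\<in>midx n m. norm (c \<alpha>)) \<le> sidon_bound k m n * B"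
proof -
  define p where "p = 2 * real k / real (k + 1)"
  define M where "M = bh_const k * (exp 1 * real m ^ k * B)"
  define L where "L = Suc (m - k + (m - k))"
  define A where "A = (\<lambda>\<gamma>. sqrt (coeff_sq n (m - k) (taylor_coeff n c \<gamma>)))"
  define R where "R = 4 powr (real (m - k) / real (k + 1)) * M powr p"
  have L: "m - k + (m - k) < L" "L > 0" by (auto simp: L_def)
  have M: "M > 0" using B k by (simp add: M_def bh_const_def)
  have R: "R > 0" using M by (simp add: R_def)
  have p1: "p \<ge> 1" using k by (simp add: p_def)
  let ?P = "\<lambda>\<gamma> z. homp n (m - k) (taylor_coeff n c \<gamma>) z"
  have 1: "(\<Sum>\<gamma>\<in>midx n k. tavg L n (\<lambda>z. norm (?P \<gamma> z) powr p)) \<le> M powr p"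
  proof -
    have "(\<Sum>\<gamma>\<in>midx n k. tavg L n (\<lambda>z. norm (?P \<gamma> z) powr p)) = tavg L n (\<lambda>z. \<Sum>\<gamma>\<in>midx n k. norm (?P \<gamma> z) powr p)"
      by (rule tavg_sum[symmetric])
    also have "\<dots> \<le> tavg L n (\<lambda>z. M powr p)"
      unfolding M_def
      by (rule tavg_mono, rule bohnenblust_hille[OF polydisc_bound_taylor[OF c k(2)]]) (use k B in \<open>auto simp: p_def\<close>)
    also have "\<dots> = M powr p" using L by (simp add: tavg_const)
    finally show ?thesis .
  qed
  have "A \<gamma> powr p \<le> 4 powr (real (m - k) / real (k + 1)) * tavg L n (\<lambda>z. norm (?P \<gamma> z) powr p)" for \<gamma>
  proof -
    have "A \<gamma> powr p = coeff_sq n (m - k) (taylor_coeff n c \<gamma>) powr (real k / real (k + 1))"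
      by (simp add: A_def p_def coeff_sq_def sum_nonneg powr_powr powr_half_sqrt[symmetric])
    then show ?thesis
      using hypercontractive[OF L(1) k(1) p_def, of n "taylor_coeff n c \<gamma>"] by simp
  qed
  then have "(\<Sum>\<gamma>\<in>midx n k. A \<gamma> powr p) \<le> (\<Sum>\<gamma>\<in>midx n k. 4 powr (real (m - k) / real (k + 1)) * tavg L n (\<lambda>z. norm (?P \<gamma> z) powr p))"
    by (rule sum_mono)
  also have "\<dots> \<le> R"
    unfolding sum_distrib_left[symmetric] R_def using 1 by (intro mult_left_mono) auto
  finally have "(\<Sum>\<gamma>\<in>midx n k. A \<gamma>) \<le> (real n ^ k) powr (1 - 1 / p) * R powr (1 / p)"
    using card_midx_le_power[of n k] n p1 R
    by (intro sum_le_powr_sum) (auto simp: A_def coeff_sq_def sum_nonneg)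
  also have "(real n ^ k) powr (1 - 1 / p) = real n powr ((real k - 1) / 2)"
  proof -
    have "real k * (1 - 1 / p) = (real k - 1) / 2"
      using k by (simp add: p_def field_simps)
    moreover have "(real n ^ k) powr (1 - 1 / p) = real n powr (real k * (1 - 1 / p))"
      using n by (simp add: powr_powr flip: powr_realpow)
    ultimately show ?thesis by (simp only:)
  qed
  also have "R powr (1 / p) = 2 powr (real (m - k) / real k) * M"
  proof -
    have e: "real (m - k) / real (k + 1) * (1 / p) = (1 / 2) * (real (m - k) / real k)"
      using k by (simp add: p_def)
    have "(4 powr (real (m - k) / real (k + 1))) powr (1 / p) = (4 powr (1/2)) powr (real (m - k) / real k)"
      unfolding powr_powr e ..
    also have "(4::real) powr (1/2) = 2" by (simp add: powr_half_sqrt)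
    finally show ?thesis
      using M p1 by (simp add: R_def powr_mult powr_powr)
  qed
  finally have 2: "(\<Sum>\<gamma>\<in>midx n k. A \<gamma>) \<le> real n powr ((real k - 1) / 2) * (2 powr (real (m - k) / real k) * M)" .
  have "(\<Sum>\<alpha>\<in>midx n m. norm (c \<alpha>)) \<le> (\<Sum>\<alpha>\<in>midx n m. \<Sum>\<gamma>\<in>midx n k. if \<gamma> \<le> \<alpha> then norm (c \<alpha>) else 0)"
  proof (rule sum_mono)
    fix \<alpha> assume "\<alpha> \<in> midx n m"
    then obtain \<gamma> where g: "\<gamma> \<in> midx n k" "\<gamma> \<le> \<alpha>" using ex_midx_below k(2) by blast
    then show "norm (c \<alpha>) \<le> (\<Sum>\<gamma>\<in>midx n k. if \<gamma> \<le> \<alpha> then norm (c \<alpha>) else 0)"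
      using member_le_sum[of \<gamma> "midx n k" "\<lambda>\<gamma>. if \<gamma> \<le> \<alpha> then norm (c \<alpha>) else 0"] by simp
  qed
  also have "\<dots> = (\<Sum>\<gamma>\<in>midx n k. \<Sum>\<alpha> | \<alpha> \<in> midx n m \<and> \<gamma> \<le> \<alpha>. norm (c \<alpha>))"
    by (subst sum.swap) (simp add: sum.inter_filter)
  also have "\<dots> \<le> (\<Sum>\<gamma>\<in>midx n k. sqrt (real (card (midx n (m - k)))) * A \<gamma>)"
    unfolding A_def using k by (intro sum_mono sum_above_le)
  also have "\<dots> \<le> sqrt (real (card (midx n (m - k)))) * (real n powr ((real k - 1) / 2) * (2 powr (real (m - k) / real k) * M))"
    unfolding sum_distrib_left[symmetric] using 2 by (intro mult_left_mono) auto
  finally show ?thesis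
    by (simp add: sidon_bound_def M_def mult_ac)
qed

section \<open>Asymptotics of the Sidon constants\<close>

definition bohr_rate :: "nat \<Rightarrow> real" where
  "bohr_rate n = sqrt (ln (real n) / real n)"

text \<open>The square root behaves like n^(b/2), which b < 1 keeps below n^(1/2).\<close>

lemma tendsto_generating_rate:
  fixes b c :: real
  assumes "0 < b" "b < 1"
  shows "(\<lambda>n. sqrt ((1 / (1 - b * (ln (real n) / real n))) ^ n) * (ln (real n) powr c * real n powr (-1/2))) \<longlonglongrightarrow> 0"
  using assms by real_asymp

lemma tendsto_ln_powr_rate:
  fixes c :: real
  shows "(\<lambda>n. (ln (real n) powr c * real n powr (-1/2))) \<longlonglongrightarrow> 0"
  by real_asymp

lemma tendsto_four_powr_inverse: "(\<lambda>k. 4 powr (1 / real k)) \<longlonglongrightarrow> 1"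
  by real_asymp

lemma tendsto_power_times_geometric: "0 < s \<Longrightarrow> s < 1 \<Longrightarrow> (\<lambda>m. real m ^ k * s ^ m) \<longlonglongrightarrow> 0"
  by real_asymp

text \<open>The exponents (k-1)/2 and -k/2 of n leave n^(-1/2) whatever k is: this is the room that
  the generating function may use up.\<close>

lemma bohr_rate_power:
  assumes "n \<ge> 3"
  shows "real n powr ((real k - 1) / 2) * bohr_rate n ^ k = ln (real n) powr (real k / 2) * real n powr (-1/2)"
proof -
  have pos: "ln (real n) > 0" "real n > 0" using assms by auto
  have "bohr_rate n ^ k = (ln (real n) / real n) powr (real k / 2)"
    using pos by (simp add: bohr_rate_def powr_half_sqrt[symmetric] powr_powr flip: powr_realpow)
  also have "\<dots> = ln (real n) powr (real k / 2) / real n powr (real k / 2)"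
    using pos by (simp add: powr_divide)
  finally have "real n powr ((real k - 1) / 2) * bohr_rate n ^ k
     = ln (real n) powr (real k / 2) * (real n powr ((real k - 1) / 2) / real n powr (real k / 2))"
    by simp
  also have "real n powr ((real k - 1) / 2) / real n powr (real k / 2) = real n powr (-1/2)"
    by (simp add: powr_diff[symmetric] field_simps)
  finally show ?thesis .
qed

lemma summable_power_mult:
  fixes s :: real
  assumes "0 < s" "s < 1"
  shows "summable (\<lambda>m. real m ^ k * s ^ m)"
proof (rule summable_comparison_test_ev)
  have "(\<lambda>m. real m ^ k * sqrt s ^ m) \<longlonglongrightarrow> 0"
    using assms by (intro tendsto_power_times_geometric) auto
  then have "eventually (\<lambda>m. real m ^ k * sqrt s ^ m < 1) sequentially"
    by (rule order_tendstoD) simp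
  then show "eventually (\<lambda>m. norm (real m ^ k * s ^ m) \<le> sqrt s ^ m) sequentially"
  proof eventually_elim
    case (elim m)
    have "real m ^ k * s ^ m = (real m ^ k * sqrt s ^ m) * sqrt s ^ m"
      using assms by (simp add: mult.assoc flip: power_mult_distrib)
    also have "\<dots> \<le> 1 * sqrt s ^ m"
      using elim assms by (intro mult_right_mono) auto
    finally show ?case using assms by simp
  qed
  show "summable (\<lambda>m. sqrt s ^ m)"
    using assms by (intro summable_geometric) simp
qed

text \<open>Of the m factors \<open>bohr_rate n\<close>, k go into \<open>bohr_rate_power\<close>;
  the other m - k, rewritten as powers of sqrt \<rho> = sqrt b * \<open>bohr_rate n\<close>, pay for
  the cardinality through \<open>card_midx_generating\<close>. What remains per degree is
  \<theta>.\<close>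

lemma sidon_term_le:
  assumes n: "n \<ge> 3" and k: "1 \<le> k" "k \<le> m" and \<rho>: "\<rho> = b * (ln (real n) / real n)" "0 < b" "\<rho> < 1"
    and t: "t > 0" and \<theta>: "\<theta> = 2 powr (1 / real k) * t / sqrt b"
  shows "sidon_bound k m n * (t * bohr_rate n) ^ m \<le>
    bh_const k * exp 1 * t ^ k * (real m ^ k * \<theta> ^ (m - k)) *
    (sqrt ((1 / (1 - \<rho>)) ^ n) * (ln (real n) powr (real k / 2) * real n powr (-1/2)))"
proof -
  define j where "j = m - k"
  have m: "m = j + k" using k by (simp add: j_def)
  have q0: "ln (real n) / real n > 0" using n by simp
  have \<rho>0: "\<rho> > 0" using mult_pos_pos[OF \<rho>(2) q0] by (simp only: \<rho>(1))
  have r0: "bohr_rate n > 0" using q0 by (simp add: bohr_rate_def)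
  have s\<rho>: "sqrt \<rho> = sqrt b * bohr_rate n" unfolding \<rho> bohr_rate_def real_sqrt_mult ..
  have bh: "bh_const k > 0" using k by (simp add: bh_const_def)
  have p2: "2 powr (real j / real k) = (2 powr (1 / real k)) ^ j"
    by (simp add: powr_powr flip: powr_realpow)
  have "sqrt (real (card (midx n j))) * sqrt \<rho> ^ j = sqrt (real (card (midx n j)) * \<rho> ^ j)"
    by (simp add: real_sqrt_mult real_sqrt_power)
  also have "\<dots> \<le> sqrt ((1 / (1 - \<rho>)) ^ n)"
    using card_midx_generating[OF \<rho>0 \<rho>(3), of n j] by simp
  finally have card: "sqrt (real (card (midx n j))) * sqrt \<rho> ^ j \<le> sqrt ((1 / (1 - \<rho>)) ^ n)" .
  have "\<theta> * sqrt \<rho> = 2 powr (1 / real k) * (t * bohr_rate n)"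
    using \<rho>(2) by (simp add: \<theta> s\<rho>)
  then have pw: "2 powr (real j / real k) * (t * bohr_rate n) ^ j = \<theta> ^ j * sqrt \<rho> ^ j"
    unfolding p2 power_mult_distrib[symmetric] by simp
  have "sidon_bound k m n * (t * bohr_rate n) ^ m
     = bh_const k * exp 1 * t ^ k * real m ^ k * (sqrt (real (card (midx n j))) *
        (2 powr (real j / real k) * (t * bohr_rate n) ^ j)) *
        (real n powr ((real k - 1) / 2) * bohr_rate n ^ k)"
    unfolding sidon_bound_def j_def[symmetric] by (simp add: m power_add power_mult_distrib)
  also have "\<dots> = bh_const k * exp 1 * t ^ k * (real m ^ k * \<theta> ^ j) * ((sqrt (real (card (midx n j))) * sqrt \<rho> ^ j) *
        (ln (real n) powr (real k / 2) * real n powr (-1/2)))"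
    unfolding pw bohr_rate_power[OF n] by (simp only: mult_ac)
  also have "\<dots> \<le> bh_const k * exp 1 * t ^ k * (real m ^ k * \<theta> ^ j) * (sqrt ((1 / (1 - \<rho>)) ^ n) *
        (ln (real n) powr (real k / 2) * real n powr (-1/2)))"
    using card bh t \<rho>(2) by (intro mult_left_mono mult_right_mono) (auto simp: \<theta>)
  finally show ?thesis unfolding j_def .
qed

text \<open>\<kappa> m is the order of differentiation used in degree m: a fixed k for large m, and
  m itself in the finitely many degrees m \<le> k, where each term tends to 0 separately.\<close>

lemma sidon_sum_small:
  fixes t :: real
  assumes t: "0 < t" "t < 1"
  shows "\<exists>\<kappa>. (\<forall>m\<ge>1. 1 \<le> \<kappa> m \<and> \<kappa> m \<le> m) \<and>
    (\<forall>\<^sub>F n in sequentially. \<forall>D. (\<Sum>m=1..D. sidon_bound (\<kappa> m) m n * (t * bohr_rate n) ^ m) \<le> 1/2)"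
proof -
  \<comment> \<open>Any b strictly between t^2 and 1 will do; k is then taken so large that 4^(1/k)
    < b / t^2, that is, \<theta> < 1.\<close>
  define b where "b = (t\<^sup>2 + 1) / 2"
  have t2: "t\<^sup>2 < 1" using t by (simp add: power_less_one_iff)
  have b: "0 < b" "b < 1" "t\<^sup>2 < b" using t t2 by (auto simp: b_def add_pos_pos)
  have "b / t\<^sup>2 > 1" using b t by simp
  then have "eventually (\<lambda>k. 4 powr (1 / real k) < b / t\<^sup>2 \<and> k \<ge> 1) sequentially"
    using order_tendstoD(2)[OF tendsto_four_powr_inverse] eventually_ge_at_top[of "1::nat"] by (auto intro: eventually_conj)
  then obtain k :: nat where k: "4 powr (1 / real k) < b / t\<^sup>2" "k \<ge> 1"
    by (auto simp: eventually_sequentially)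
  define \<theta> where "\<theta> = 2 powr (1 / real k) * t / sqrt b"
  have \<theta>0: "\<theta> > 0" using b t by (simp add: \<theta>_def)
  have "\<theta>\<^sup>2 < 1"
  proof -
    have "(2 powr (1 / real k))\<^sup>2 = (2 * 2) powr (1 / real k)"
      unfolding power2_eq_square by (rule powr_mult[symmetric])
    also have "\<dots> < b / t\<^sup>2" using k by simp
    finally show ?thesis using b t by (simp add: \<theta>_def power_mult_distrib power_divide field_simps)
  qed
  then have \<theta>1: "\<theta> < 1"
    by (metis one_power2 power_less_imp_less_base zero_le_one)
  define S where "S = (\<Sum>m. real m ^ k * \<theta> ^ m)"
  define C where "C = bh_const k * exp 1 * t ^ k * (S / \<theta> ^ k)"
  define g where "g = (\<lambda>n. sqrt ((1 / (1 - b * (ln (real n) / real n))) ^ n) * (ln (real n) powr (real k / 2) * real n powr (-1/2)))"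
  define h where "h = (\<lambda>n. \<Sum>m=1..k. bh_const m * exp 1 * real m ^ m * t ^ m * (ln (real n) powr (real m / 2) * real n powr (-1/2)))"
  define \<kappa> where "\<kappa> = (\<lambda>m. min m k)"
  have "(\<lambda>n. h n + C * g n) \<longlonglongrightarrow> (\<Sum>m=1..k. bh_const m * exp 1 * real m ^ m * t ^ m * 0) + C * 0"
    unfolding h_def g_def by (intro tendsto_intros tendsto_generating_rate tendsto_ln_powr_rate b)
  then have "(\<lambda>n. h n + C * g n) \<longlonglongrightarrow> 0" by simp
  then have ev1: "\<forall>\<^sub>F n in sequentially. h n + C * g n < 1/2"
    by (rule order_tendstoD) simp
  have "(\<lambda>n. b * (ln (real n) / real n)) \<longlonglongrightarrow> 0" by real_asymp
  then have ev2: "\<forall>\<^sub>F n in sequentially. b * (ln (real n) / real n) < 1"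
    by (rule order_tendstoD) simp
  have "\<forall>\<^sub>F n in sequentially. \<forall>D. (\<Sum>m=1..D. sidon_bound (\<kappa> m) m n * (t * bohr_rate n) ^ m) \<le> 1/2"
    using ev1 ev2 eventually_ge_at_top[of "3::nat"]
  proof eventually_elim
    case (elim n)
    then have n: "n \<ge> 3" by simp
    have r0: "bohr_rate n \<ge> 0" using n by (simp add: bohr_rate_def)
    have g0: "g n \<ge> 0" using elim by (simp add: g_def)
    let ?s = "\<lambda>m. sidon_bound (\<kappa> m) m n * (t * bohr_rate n) ^ m"
    have bh: "bh_const k > 0" using k by (simp add: bh_const_def)
    have nonneg: "?s m \<ge> 0" for m
      using t r0 by (simp add: sidon_bound_def bh_const_def)
    show ?case
    proof
      fix D
      \<comment> \<open>The terms are nonnegative, so the two ranges may overlap at k and the first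
        may exceed D.\<close>
      have "(\<Sum>m=1..D. ?s m) \<le> (\<Sum>m\<in>{1..k} \<union> {k..D}. ?s m)"
        using nonneg by (intro sum_mono2) auto
      also have "\<dots> \<le> (\<Sum>m=1..k. ?s m) + (\<Sum>m=k..D. ?s m)"
        using sum.union_inter[of "{1..k}" "{k..D}" ?s] sum_nonneg[of "{1..k} \<inter> {k..D}" ?s] nonneg by simp
      also have "(\<Sum>m=1..k. ?s m) = h n"
        unfolding h_def
      proof (rule sum.cong[OF refl])
        fix m assume "m \<in> {1..k}"
        then have m: "1 \<le> m" "\<kappa> m = m" by (auto simp: \<kappa>_def)
        have "?s m = bh_const m * exp 1 * real m ^ m * t ^ m * (real n powr ((real m - 1) / 2) * bohr_rate n ^ m)"
          by (simp add: m sidon_bound_def midx_0 power_mult_distrib)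
        then show "?s m = bh_const m * exp 1 * real m ^ m * t ^ m * (ln (real n) powr (real m / 2) * real n powr (-1/2))"
          by (simp only: bohr_rate_power[OF n])
      qed
      also have "(\<Sum>m=k..D. ?s m) \<le> (\<Sum>m=k..D. bh_const k * exp 1 * t ^ k * (real m ^ k * \<theta> ^ m / \<theta> ^ k) * g n)"
      proof (rule sum_mono)
        fix m assume "m \<in> {k..D}"
        then have m: "k \<le> m" "\<kappa> m = k" by (auto simp: \<kappa>_def)
        have "\<theta> ^ (m - k) = \<theta> ^ m / \<theta> ^ k" using m \<theta>0 by (simp add: power_diff)
        then show "?s m \<le> bh_const k * exp 1 * t ^ k * (real m ^ k * \<theta> ^ m / \<theta> ^ k) * g n"
          using sidon_term_le[OF n k(2) m(1) refl b(1) elim(2) t(1) \<theta>_def] m(2) by (simp add: g_def)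
      qed
      also have "\<dots> = bh_const k * exp 1 * t ^ k * ((\<Sum>m=k..D. real m ^ k * \<theta> ^ m) / \<theta> ^ k) * g n"
        by (simp only: sum_distrib_left sum_distrib_right sum_divide_distrib)
      also have "\<dots> \<le> C * g n"
      proof -
        have "(\<Sum>m=k..D. real m ^ k * \<theta> ^ m) \<le> S"
          unfolding S_def using \<theta>0 \<theta>1 by (intro sum_le_suminf summable_power_mult) auto
        then show ?thesis
          unfolding C_def using \<theta>0 g0 bh t by (intro mult_right_mono mult_left_mono divide_right_mono) auto
      qed
      finally show "(\<Sum>m=1..D. ?s m) \<le> 1/2" using elim(1) by simp
    qed
  qed
  moreover have "\<forall>m\<ge>1. 1 \<le> \<kappa> m \<and> \<kappa> m \<le> m" using k by (auto simp: \<kappa>_def)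
  ultimately show ?thesis by blast
qed

section \<open>Monomial expansion of holomorphic functions\<close>

text \<open>A discrete Fourier coefficient, in place of the contour integral for the q-th Taylor
  coefficient.\<close>

definition root_avg :: "nat \<Rightarrow> nat \<Rightarrow> (complex \<Rightarrow> complex) \<Rightarrow> complex" where
  "root_avg L q g = (\<Sum>j<L. g (cis (2 * pi * real j / real L)) * cnj (cis (2 * pi * real j / real L) ^ q)) / of_nat L"

text \<open>Aliasing: averaging over L points collects all a i with i congruent to q modulo L, and
  apart from a q these have i \<ge> L.\<close>

lemma root_avg_series:
  fixes a :: "nat \<Rightarrow> complex"
  assumes a: "summable (\<lambda>i. norm (a i))" and g: "\<And>\<omega>. norm \<omega> = 1 \<Longrightarrow> (\<lambda>i. a i * \<omega> ^ i) sums g \<omega>"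
    and q: "q < L"
  shows "norm (root_avg L q g - a q) \<le> (\<Sum>i. norm (a (i + L)))"
proof -
  let ?x = "\<lambda>j. cis (2 * pi * real j / real L)"
  have L: "L > 0" using q by simp
  have "(\<lambda>i. \<Sum>j<L. a i * ?x j ^ i * cnj (?x j ^ q)) sums (\<Sum>j<L. g (?x j) * cnj (?x j ^ q))"
    by (intro sums_sum sums_mult2 g) simp
  then have "(\<lambda>i. (\<Sum>j<L. a i * ?x j ^ i * cnj (?x j ^ q)) / of_nat L) sums root_avg L q g"
    unfolding root_avg_def by (rule sums_divide)
  moreover have "(\<Sum>j<L. a i * ?x j ^ i * cnj (?x j ^ q)) / of_nat L = (if int L dvd int i - int q then a i else 0)" for i
  proof -
    have "(\<Sum>j<L. a i * ?x j ^ i * cnj (?x j ^ q)) = a i * (\<Sum>j<L. ?x j ^ i * cnj (?x j ^ q))"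
      by (simp only: mult.assoc sum_distrib_left)
    also have "\<dots> = a i * (if int L dvd int i - int q then of_nat L else 0)"
      by (simp only: sum_root_unity[OF L])
    finally show ?thesis using L by simp
  qed
  ultimately have s: "(\<lambda>i. if int L dvd int i - int q then a i else 0) sums root_avg L q g"
    by simp
  have "(\<lambda>i. if int L dvd int (i + L) - int q then a (i + L) else 0) sums
      (root_avg L q g - (\<Sum>i<L. if int L dvd int i - int q then a i else 0))"
    using sums_split_initial_segment[OF s, of L] by simp
  also have "(\<Sum>i<L. if int L dvd int i - int q then a i else 0) = (\<Sum>i<L. if i = q then a i else 0)"
    using q by (intro sum.cong refl) (simp add: dvd_int_diff_iff)
  also have "\<dots> = a q" using q by simp
  finally have s': "(\<lambda>i. if int L dvd int (i + L) - int q then a (i + L) else 0) sums (root_avg L q g - a q)" .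
  have a': "summable (\<lambda>i. norm (a (i + L)))"
    using a by (rule summable_ignore_initial_segment)
  have "norm (\<Sum>i. if int L dvd int (i + L) - int q then a (i + L) else 0) \<le> (\<Sum>i. norm (a (i + L)))"
    by (rule norm_suminf_le[OF _ a']) simp
  then show ?thesis using s' by (simp add: sums_iff)
qed

text \<open>Average the nonnegative function $(S - \mathrm{Re}\,(l g)) (1 + \mathrm{Re}\,(\kappa \overline\omega^m))$ over roots of unity.\<close>

lemma caratheodory:
  fixes a :: "nat \<Rightarrow> complex"
  assumes a: "summable (\<lambda>i. norm (a i))" and g: "\<And>\<omega>. norm \<omega> = 1 \<Longrightarrow> (\<lambda>i. a i * \<omega> ^ i) sums g \<omega>"
    and S: "\<And>\<omega>. norm \<omega> = 1 \<Longrightarrow> norm (g \<omega>) \<le> S" and m: "m \<ge> 1"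
  shows "norm (a m) \<le> 2 * (S - norm (a 0))"
proof -
  \<comment> \<open>Rotations that make a 0 and a m real and nonnegative. For a 0 = 0 the value 1
    keeps l unimodular, where \<open>sgn\<close> would give 0.\<close>
  define l where "l = (if a 0 = 0 then 1 else cnj (sgn (a 0)))"
  define \<kappa> where "\<kappa> = cnj (sgn (l * a m))"
  have l: "norm l = 1" by (simp add: l_def norm_sgn)
  have l0: "l * a 0 = of_real (norm (a 0))" using mult_cnj_sgn[of "a 0"] by (auto simp: l_def mult.commute)
  have \<kappa>: "norm \<kappa> \<le> 1" by (simp add: \<kappa>_def norm_sgn)
  have \<kappa>m: "l * \<kappa> * a m = of_real (norm (a m))"
    using mult_cnj_sgn[of "l * a m"] l by (simp add: \<kappa>_def norm_mult mult_ac)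
  define T where "T = (\<lambda>L. \<Sum>i. norm (a (i + L)))"
  have T: "T \<longlonglongrightarrow> 0" unfolding T_def by (rule suminf_exist_split2[OF a])
  have E0: "(\<lambda>L. root_avg L 0 g) \<longlonglongrightarrow> a 0" and E1: "(\<lambda>L. root_avg L m g) \<longlonglongrightarrow> a m"
  proof -
    have "(\<lambda>L. root_avg L q g - a q) \<longlonglongrightarrow> 0" for q
      by (rule Lim_null_comparison[OF _ T])
         (use root_avg_series[OF a g, of q] in \<open>auto simp: T_def intro: eventually_mono[OF eventually_gt_at_top[of q]]\<close>)
    then show "(\<lambda>L. root_avg L 0 g) \<longlonglongrightarrow> a 0" "(\<lambda>L. root_avg L m g) \<longlonglongrightarrow> a m"
      by (auto simp: LIM_zero_iff)
  qed
  have a0: "a \<longlonglongrightarrow> 0" using summable_LIMSEQ_zero[OF a] by (simp add: tendsto_norm_zero_iff)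
  \<comment> \<open>On L-th roots of unity the frequency L - m is the frequency -m, which g does not
    contain; it arises from the conjugate term in the product of two real parts.\<close>
  have E2: "(\<lambda>L. root_avg L (L - m) g) \<longlonglongrightarrow> 0"
  proof -
    have "(\<lambda>L. root_avg L (L - m) g - a (L - m)) \<longlonglongrightarrow> 0"
      by (rule Lim_null_comparison[OF _ T])
         (use root_avg_series[OF a g] m in \<open>auto simp: T_def intro: eventually_mono[OF eventually_gt_at_top[of m]]\<close>)
    moreover have "(\<lambda>L. a (L - m)) \<longlonglongrightarrow> 0"
      using a0 filterlim_minus_const_nat_at_top[of m] by (rule filterlim_compose)
    ultimately show ?thesis using tendsto_add by fastforce
  qed
  have nn: "\<forall>\<^sub>F L in sequentially. 0 \<le> S - Re (l * root_avg L 0 g) - (Re (l * \<kappa> * root_avg L m g) + Re (l * cnj \<kappa> * root_avg L (L - m) g)) / 2"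
    using eventually_gt_at_top[of m]
  proof eventually_elim
    case (elim L)
    then have L: "L > 0" by simp
    let ?x = "\<lambda>j. cis (2 * pi * real j / real L)"
    have xm: "cnj (?x j ^ (L - m)) = ?x j ^ m" for j
    proof -
      have inv: "v = w" if "u * w = 1" "v * u = 1" for u v w :: complex
        using that by (metis mult.assoc mult.left_neutral mult.right_neutral)
      have "?x j ^ (L - m) * ?x j ^ m = ?x j ^ L"
        using elim by (simp flip: power_add)
      also have "\<dots> = cis (real L * (2 * pi * real j / real L))" by (rule Complex.DeMoivre)
      also have "real L * (2 * pi * real j / real L) = 2 * pi * real j" using L by simp
      also have "cis \<dots> = 1" by (simp add: cis_multiple_2pi)
      finally have "?x j ^ (L - m) * ?x j ^ m = 1" .
      moreover have "cnj (?x j ^ (L - m)) * ?x j ^ (L - m) = 1"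
        using complex_norm_square[of "?x j ^ (L - m)"] by (simp add: norm_power mult.commute)
      ultimately show ?thesis by (rule inv)
    qed
    have s0: "(\<Sum>j<L. cnj (?x j ^ m)) = 0"
      using sum_root_unity[OF L, of 0 m] dvd_int_diff_iff[of 0 L m] elim m by simp
    have "0 \<le> (\<Sum>j<L. (S - Re (l * g (?x j))) * (1 + Re (\<kappa> * cnj (?x j ^ m))))"
    proof (intro sum_nonneg mult_nonneg_nonneg)
      fix j assume "j \<in> {..<L}"
      have "Re (l * g (?x j)) \<le> norm (l * g (?x j))" by (rule complex_Re_le_cmod)
      also have "\<dots> \<le> S" using S[of "?x j"] l by (simp add: norm_mult)
      finally show "0 \<le> S - Re (l * g (?x j))" by simp
      have "\<bar>Re (\<kappa> * cnj (?x j ^ m))\<bar> \<le> norm (\<kappa> * cnj (?x j ^ m))" by (rule abs_Re_le_cmod)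
      also have "\<dots> \<le> 1" using \<kappa> by (simp add: norm_mult norm_power)
      finally show "0 \<le> 1 + Re (\<kappa> * cnj (?x j ^ m))" by simp
    qed
    also have "\<dots> = (\<Sum>j<L. S - Re (l * g (?x j)) + S * Re (\<kappa> * cnj (?x j ^ m))
        - (Re (l * \<kappa> * (g (?x j) * cnj (?x j ^ m))) + Re (l * cnj \<kappa> * (g (?x j) * cnj (?x j ^ (L - m))))) / 2)"
    proof (rule sum.cong[OF refl])
      fix j
      have ReRe: "Re A * Re B = (Re (A * B) + Re (A * cnj B)) / 2" for A B by simp
      have 1: "l * g (?x j) * (\<kappa> * cnj (?x j ^ m)) = l * \<kappa> * (g (?x j) * cnj (?x j ^ m))" by (simp only: mult_ac)
      have 2: "l * g (?x j) * cnj (\<kappa> * cnj (?x j ^ m)) = l * cnj \<kappa> * (g (?x j) * cnj (?x j ^ (L - m)))"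
        unfolding xm by (simp only: complex_cnj_mult complex_cnj_cnj mult_ac)
      have "(S - Re (l * g (?x j))) * (1 + Re (\<kappa> * cnj (?x j ^ m))) =
          S - Re (l * g (?x j)) + S * Re (\<kappa> * cnj (?x j ^ m)) - Re (l * g (?x j)) * Re (\<kappa> * cnj (?x j ^ m))"
        by (simp only: ring_distribs)
      then show "(S - Re (l * g (?x j))) * (1 + Re (\<kappa> * cnj (?x j ^ m))) =
          S - Re (l * g (?x j)) + S * Re (\<kappa> * cnj (?x j ^ m))
        - (Re (l * \<kappa> * (g (?x j) * cnj (?x j ^ m))) + Re (l * cnj \<kappa> * (g (?x j) * cnj (?x j ^ (L - m))))) / 2"
        by (simp only: ReRe[of "l * g (?x j)"] 1 2)
    qed
    also have "\<dots> = real L * S - Re (l * (\<Sum>j<L. g (?x j))) + S * Re (\<kappa> * (\<Sum>j<L. cnj (?x j ^ m)))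
        - (Re (l * \<kappa> * (\<Sum>j<L. g (?x j) * cnj (?x j ^ m))) + Re (l * cnj \<kappa> * (\<Sum>j<L. g (?x j) * cnj (?x j ^ (L - m))))) / 2"
      by (simp only: sum.distrib sum_subtractf sum_distrib_left Re_sum sum_divide_distrib[symmetric] sum_constant card_lessThan)
    also have "\<dots> = real L * (S - Re (l * root_avg L 0 g) - (Re (l * \<kappa> * root_avg L m g) + Re (l * cnj \<kappa> * root_avg L (L - m) g)) / 2)"
    proof -
      have "(\<Sum>j<L. g (?x j) * cnj (?x j ^ q)) = of_real (real L) * root_avg L q g" for q
        using L by (simp add: root_avg_def)
      moreover from this[of 0] have "(\<Sum>j<L. g (?x j)) = of_real (real L) * root_avg L 0 g" by simp
      moreover have "Re (A * (of_real (real L) * B)) = real L * Re (A * B)" for A B by (simp add: algebra_simps)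
      ultimately show ?thesis unfolding s0 by (simp only:) (simp add: algebra_simps)
    qed
    finally show ?case using L by (simp add: zero_le_mult_iff)
  qed
  have "(\<lambda>L. S - Re (l * root_avg L 0 g) - (Re (l * \<kappa> * root_avg L m g) + Re (l * cnj \<kappa> * root_avg L (L - m) g)) / 2)
     \<longlonglongrightarrow> S - Re (l * a 0) - (Re (l * \<kappa> * a m) + Re (l * cnj \<kappa> * 0)) / 2"
    by (intro tendsto_intros E0 E1 E2) simp
  then have "0 \<le> S - Re (l * a 0) - (Re (l * \<kappa> * a m) + Re (l * cnj \<kappa> * 0)) / 2"
    using nn by (rule tendsto_lowerbound) simp
  then show ?thesis unfolding l0 \<kappa>m by simp
qed

section \<open>Taylor expansion on polydiscs\<close>

text \<open>Only holomorphy in each variable and a uniform bound are recorded: one-variable theory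
  works with just these, and the derivatives in the last variable inherit them.\<close>

definition sep_holomorphic :: "nat \<Rightarrow> (nat \<Rightarrow> real) \<Rightarrow> real \<Rightarrow> ((nat \<Rightarrow> complex) \<Rightarrow> complex) \<Rightarrow> bool" where
  "sep_holomorphic n R S f \<longleftrightarrow> (\<forall>z\<in>Cn n. (\<forall>k<n. norm (z k) < R k) \<longrightarrow>
     norm (f z) \<le> S \<and> (\<forall>k<n. (\<lambda>w. f (z(k := w))) holomorphic_on ball 0 (R k)))"

definition tcoeff :: "nat \<Rightarrow> ((nat \<Rightarrow> complex) \<Rightarrow> complex) \<Rightarrow> (nat \<Rightarrow> nat) \<Rightarrow> complex" where
  "tcoeff n f \<alpha> = pdiff_multi n \<alpha> f (\<lambda>k. 0) / mfact n \<alpha>"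

lemma pdiff_funpow: "(pdiff k ^^ j) g z = (deriv ^^ j) (\<lambda>w. g (z(k := w))) (z k)"
proof (induction j arbitrary: z)
  case (Suc j)
  have "(pdiff k ^^ Suc j) g z = deriv (\<lambda>w. (pdiff k ^^ j) g (z(k := w))) (z k)"
    by (simp add: pdiff_def[of k "(pdiff k ^^ j) g"])
  also have "\<dots> = deriv (\<lambda>w. (deriv ^^ j) (\<lambda>w. g (z(k := w))) w) (z k)"
    unfolding Suc fun_upd_upd fun_upd_same ..
  also have "\<dots> = (deriv ^^ Suc j) (\<lambda>w. g (z(k := w))) (z k)"
    by (simp only: funpow.simps comp_def)
  finally show ?case .
qed simp

text \<open>In \<open>pdiff_multi\<close> the \<open>foldr\<close> over [0..<n] differentiates in
  the last variable first, so the induction on n peels off the last variable.\<close>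

lemma tcoeff_Suc:
  assumes "\<beta> \<in> multi_indices n"
  shows "tcoeff (Suc n) f (\<beta>(n := j)) = tcoeff n ((pdiff n ^^ j) f) \<beta> / fact j"
proof -
  have "foldr (\<lambda>k g. (pdiff k ^^ (\<beta>(n := j)) k) g) [0..<n] h = foldr (\<lambda>k g. (pdiff k ^^ \<beta> k) g) [0..<n] h" for h
    by (intro foldr_cong) auto
  then have "pdiff_multi (Suc n) (\<beta>(n := j)) f = pdiff_multi n \<beta> ((pdiff n ^^ j) f)"
    by (simp add: pdiff_multi_def)
  moreover have "mfact (Suc n) (\<beta>(n := j)) = mfact n \<beta> * fact j"
  proof -
    have "(\<Prod>k<n. of_nat (fact ((\<beta>(n := j)) k))) = (\<Prod>k<n. of_nat (fact (\<beta> k)) :: complex)"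
      by (intro prod.cong) auto
    then show ?thesis by (simp only: mfact_def prod.lessThan_Suc fun_upd_same of_nat_fact)
  qed
  ultimately show ?thesis by (simp add: tcoeff_def)
qed

lemma mpow_cong:
  "(\<And>k. k < n \<Longrightarrow> z k = w k) \<Longrightarrow> (\<And>k. k < n \<Longrightarrow> \<alpha> k = \<beta> k) \<Longrightarrow> mpow n z \<alpha> = mpow n w \<beta>"
  unfolding mpow_def by (rule prod.cong) auto

lemma mpow_Suc: "mpow (Suc n) z (\<beta>(n := j)) = mpow n z \<beta> * z n ^ j"
  using mpow_cong[of n z z "\<beta>(n := j)" \<beta>] by (simp add: mpow_def)

lemma mpow_upd: "mpow n (z(n := w)) \<beta> = mpow n z \<beta>"
  by (rule mpow_cong) auto

lemma summable_geometric_multi: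
  fixes q :: "nat \<Rightarrow> real"
  assumes q: "\<And>k. k < n \<Longrightarrow> 0 \<le> q k \<and> q k < 1"
  shows "(\<lambda>\<alpha>. \<Prod>k<n. q k ^ \<alpha> k) summable_on multi_indices n"
proof (rule nonneg_bdd_above_summable_on)
  show "0 \<le> (\<Prod>k<n. q k ^ \<alpha> k)" for \<alpha> using q by (intro prod_nonneg) auto
  show "bdd_above (sum (\<lambda>\<alpha>. \<Prod>k<n. q k ^ \<alpha> k) ` {F. F \<subseteq> multi_indices n \<and> finite F})"
  proof (rule bdd_aboveI2)
    fix F assume "F \<in> {F. F \<subseteq> multi_indices n \<and> finite F}"
    then have F: "F \<subseteq> multi_indices n" "finite F" by auto
    define D where "D = Max ((\<lambda>\<alpha>. \<Sum>k<n. \<alpha> k) ` F)"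
    have "F \<subseteq> index_box n (\<lambda>_. {..D})"
    proof
      fix \<alpha> assume a: "\<alpha> \<in> F"
      have "\<alpha> k \<le> D" if "k < n" for k
      proof -
        have "\<alpha> k \<le> (\<Sum>k<n. \<alpha> k)" using that by (intro member_le_sum) auto
        also have "\<dots> \<le> D" unfolding D_def using a F by (intro Max_ge) auto
        finally show ?thesis .
      qed
      then show "\<alpha> \<in> index_box n (\<lambda>_. {..D})" using a F by (auto simp: index_box_def)
    qed
    then have "(\<Sum>\<alpha>\<in>F. \<Prod>k<n. q k ^ \<alpha> k) \<le> (\<Sum>\<alpha>\<in>index_box n (\<lambda>_. {..D}). \<Prod>k<n. q k ^ \<alpha> k)"
      using q by (intro sum_mono2 finite_index_box prod_nonneg) auto
    also have "\<dots> = (\<Prod>k<n. \<Sum>j\<le>D. q k ^ j)"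
      using sum_index_box_prod[of n "\<lambda>_. {..D}" "\<lambda>k j. q k ^ j"] by simp
    also have "\<dots> \<le> (\<Prod>k<n. 1 / (1 - q k))"
    proof (intro prod_mono conjI sum_nonneg)
      fix k assume "k \<in> {..<n}"
      then have "0 \<le> q k" "q k < 1" using q by auto
      then show "(\<Sum>j\<le>D. q k ^ j) \<le> 1 / (1 - q k)" by (simp add: sum_gp0 divide_right_mono)
    qed (use q in auto)
    finally show "(\<Sum>\<alpha>\<in>F. \<Prod>k<n. q k ^ \<alpha> k) \<le> (\<Prod>k<n. 1 / (1 - q k))" .
  qed
qed

text \<open>The derivative at $0$ in the last variable is a locally uniform limit of root-of-unity averages,
hence stays holomorphic in the remaining variables.\<close>

lemma sep_holomorphic_pdiff:
  assumes f: "sep_holomorphic (Suc n) R S f" and \<rho>: "0 < \<rho>" "\<rho> < R n"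
  shows "sep_holomorphic n R (fact j * S / \<rho> ^ j) ((pdiff n ^^ j) f)"
  unfolding sep_holomorphic_def
proof (intro ballI impI conjI allI)
  have hol: "(\<lambda>w. f (z(n := w))) holomorphic_on ball 0 (R n)" and bnd: "\<And>w. norm w < R n \<Longrightarrow> norm (f (z(n := w))) \<le> S"
    if z: "z \<in> Cn n" "\<forall>k<n. norm (z k) < R k" for z
  proof -
    have in': "z(n := w) \<in> Cn (Suc n)" for w using z by (auto simp: Cn_def)
    have "norm ((z(n := w)) k) < R k" if "k < Suc n" "norm w < R n" for k w
      using that z by (auto simp: less_Suc_eq)
    then show "\<And>w. norm w < R n \<Longrightarrow> norm (f (z(n := w))) \<le> S"
      using f in' unfolding sep_holomorphic_def by blast
    have "z \<in> Cn (Suc n)" "\<forall>k<Suc n. norm (z k) < R k"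
      using z \<rho> by (auto simp: Cn_def less_Suc_eq)
    then show "(\<lambda>w. f (z(n := w))) holomorphic_on ball 0 (R n)"
      using f unfolding sep_holomorphic_def by blast
  qed
  have cauchy: "norm ((deriv ^^ i) (\<lambda>w. f (z(n := w))) 0) \<le> fact i * S / r ^ i"
    if z: "z \<in> Cn n" "\<forall>k<n. norm (z k) < R k" and r: "0 < r" "r < R n" for z i r
  proof (rule Cauchy_inequality)
    have sub: "cball 0 r \<subseteq> ball (0::complex) (R n)" using r by auto
    then show "(\<lambda>w. f (z(n := w))) holomorphic_on ball 0 r"
      using hol[OF z] by (rule_tac holomorphic_on_subset) auto
    show "continuous_on (cball 0 r) (\<lambda>w. f (z(n := w)))"
      using hol[OF z] sub holomorphic_on_imp_continuous_on holomorphic_on_subset by blast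
    show "norm (f (z(n := x))) \<le> S" if "norm (0 - x) = r" for x
      using bnd[OF z] that r by simp
  qed (use r in auto)
  have eq: "(pdiff n ^^ j) f z = (deriv ^^ j) (\<lambda>w. f (z(n := w))) 0" if "z \<in> Cn n" for z
    unfolding pdiff_funpow using that by (simp add: Cn_def)
  fix z assume z: "z \<in> Cn n" "\<forall>k<n. norm (z k) < R k"
  show "norm ((pdiff n ^^ j) f z) \<le> fact j * S / \<rho> ^ j"
    unfolding eq[OF z(1)] using cauchy[OF z \<rho>] .
  fix k assume k: "k < n"
  \<comment> \<open>A radius strictly between \<rho> and R n gives the Taylor terms at radius \<rho>
    geometric decay with ratio \<theta> = \<rho> / r.\<close>
  define r where "r = (\<rho> + R n) / 2"
  have r: "\<rho> < r" "r < R n" "0 < r" using \<rho> by (auto simp: r_def)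
  define \<theta> where "\<theta> = \<rho> / r"
  have \<theta>: "0 < \<theta>" "\<theta> < 1" using \<rho> r by (auto simp: \<theta>_def)
  have zv: "z(k := v) \<in> Cn n" "\<forall>i<n. norm ((z(k := v)) i) < R i" if "v \<in> ball 0 (R k)" for v
    using that z k by (auto simp: Cn_def)
  have S0: "S \<ge> 0" using bnd[OF z, of 0] \<rho> by (auto intro: order_trans[OF norm_ge_zero])
  \<comment> \<open>Suc j + i points suffice to resolve frequency j, and the aliasing error is of
    order \<theta>^(j + 1 + i), uniformly in v.\<close>
  define A where "A = (\<lambda>i v. fact j / of_real \<rho> ^ j * root_avg (Suc j + i) j (\<lambda>\<omega>. f (z(k := v, n := of_real \<rho> * \<omega>))))"
  have A_hol: "A i holomorphic_on ball 0 (R k)" for i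
  proof -
    have "(\<lambda>v. f (z(k := v, n := of_real \<rho> * cis x))) holomorphic_on ball 0 (R k)" for x
    proof -
      have "z(n := of_real \<rho> * cis x) \<in> Cn (Suc n)" using z by (auto simp: Cn_def)
      moreover have "\<forall>i<Suc n. norm ((z(n := of_real \<rho> * cis x)) i) < R i"
        using z \<rho> by (auto simp: norm_mult less_Suc_eq)
      ultimately have "(\<lambda>v. f (z(n := of_real \<rho> * cis x, k := v))) holomorphic_on ball 0 (R k)"
        using f k unfolding sep_holomorphic_def by auto
      then show ?thesis using k by (simp add: fun_upd_twist)
    qed
    then show ?thesis
      unfolding A_def root_avg_def by (intro holomorphic_intros) auto
  qed
  have A_lim: "norm (A i v - (pdiff n ^^ j) f (z(k := v))) \<le> fact j / \<rho> ^ j * (S * \<theta> ^ Suc j / (1 - \<theta>)) * \<theta> ^ i"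
    if v: "v \<in> ball 0 (R k)" for i v
  proof -
    let ?z = "z(k := v)"
    note zv = zv[OF v]
    define a where "a = (\<lambda>i. (deriv ^^ i) (\<lambda>w. f (?z(n := w))) 0 / fact i * of_real \<rho> ^ i)"
    have a: "norm (a i) \<le> S * \<theta> ^ i" for i
    proof -
      have "norm (a i) = norm ((deriv ^^ i) (\<lambda>w. f (?z(n := w))) 0) / fact i * \<rho> ^ i"
        using \<rho> by (simp add: a_def norm_mult norm_divide norm_power)
      also have "\<dots> \<le> (fact i * S / r ^ i) / fact i * \<rho> ^ i"
        using cauchy[of ?z, OF zv r(3,2), of i] \<rho> by (intro mult_right_mono divide_right_mono) auto
      also have "\<dots> = S * \<theta> ^ i" by (simp add: \<theta>_def power_divide)
      finally show ?thesis .
    qed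
    have geo: "summable (\<lambda>i. S * \<theta> ^ i)" using \<theta> by (intro summable_mult summable_geometric) auto
    have suma: "summable (\<lambda>i. norm (a i))"
      by (rule summable_comparison_test'[OF geo, of 0]) (simp add: a)
    have "(\<lambda>i. a i * \<omega> ^ i) sums f (?z(n := of_real \<rho> * \<omega>))" if "norm \<omega> = 1" for \<omega>
      using holomorphic_power_series[OF hol[of ?z, OF zv], of "of_real \<rho> * \<omega>"] that \<rho>
      by (simp add: a_def norm_mult power_mult_distrib mult_ac)
    then have "norm (root_avg (Suc j + i) j (\<lambda>\<omega>. f (?z(n := of_real \<rho> * \<omega>))) - a j) \<le> (\<Sum>l. norm (a (l + (Suc j + i))))"
      by (intro root_avg_series[OF suma]) auto
    also have "\<dots> \<le> (\<Sum>l. S * \<theta> ^ (Suc j + i) * \<theta> ^ l)"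
    proof (rule suminf_le)
      show "norm (a (l + (Suc j + i))) \<le> S * \<theta> ^ (Suc j + i) * \<theta> ^ l" for l
        using a[of "l + (Suc j + i)"] by (simp add: power_add mult_ac)
      show "summable (\<lambda>l. norm (a (l + (Suc j + i))))" using suma by (rule summable_ignore_initial_segment)
      show "summable (\<lambda>l. S * \<theta> ^ (Suc j + i) * \<theta> ^ l)" using \<theta> by (intro summable_mult summable_geometric) auto
    qed
    also have "\<dots> = S * \<theta> ^ (Suc j + i) / (1 - \<theta>)"
      using \<theta> by (subst suminf_mult) (auto simp: suminf_geometric intro: summable_geometric)
    finally have le: "norm (root_avg (Suc j + i) j (\<lambda>\<omega>. f (?z(n := of_real \<rho> * \<omega>))) - a j) \<le> S * \<theta> ^ (Suc j + i) / (1 - \<theta>)" .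
    have "(pdiff n ^^ j) f ?z = fact j / of_real \<rho> ^ j * a j"
      unfolding eq[OF zv(1)] using \<rho> by (simp add: a_def)
    then have "norm (A i v - (pdiff n ^^ j) f ?z) = fact j / \<rho> ^ j * norm (root_avg (Suc j + i) j (\<lambda>\<omega>. f (?z(n := of_real \<rho> * \<omega>))) - a j)"
      unfolding A_def \<open>(pdiff n ^^ j) f ?z = _\<close> right_diff_distrib[symmetric] norm_mult
      using \<rho> by (simp add: norm_divide norm_power)
    also have "\<dots> \<le> fact j / \<rho> ^ j * (S * \<theta> ^ (Suc j + i) / (1 - \<theta>))"
      using le \<rho> by (intro mult_left_mono) auto
    finally show ?thesis by (simp add: power_add mult_ac)
  qed
  have unif: "uniform_limit (ball 0 (R k)) A (\<lambda>v. (pdiff n ^^ j) f (z(k := v))) sequentially"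
  proof (rule uniform_limitI)
    fix e :: real assume "e > 0"
    have "(\<lambda>i. fact j / \<rho> ^ j * (S * \<theta> ^ Suc j / (1 - \<theta>)) * \<theta> ^ i) \<longlonglongrightarrow> fact j / \<rho> ^ j * (S * \<theta> ^ Suc j / (1 - \<theta>)) * 0"
      using \<theta> by (intro tendsto_mult_left LIMSEQ_power_zero) auto
    then have "\<forall>\<^sub>F i in sequentially. fact j / \<rho> ^ j * (S * \<theta> ^ Suc j / (1 - \<theta>)) * \<theta> ^ i < e"
      using \<open>e > 0\<close> by (intro order_tendstoD(2)) auto
    then show "\<forall>\<^sub>F i in sequentially. \<forall>v\<in>ball 0 (R k). dist (A i v) ((pdiff n ^^ j) f (z(k := v))) < e"
    proof eventually_elim
      case (elim i)
      show ?case unfolding dist_norm using le_less_trans[OF A_lim elim] by blast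
    qed
  qed
  show "(\<lambda>v. (pdiff n ^^ j) f (z(k := v))) holomorphic_on ball 0 (R k)"
  proof (rule holomorphic_uniform_sequence[OF open_ball A_hol])
    fix x assume "x \<in> ball (0::complex) (R k)"
    then obtain d where "d > 0" "cball x d \<subseteq> ball 0 (R k)" using open_ball open_contains_cball by blast
    then show "\<exists>d>0. cball x d \<subseteq> ball 0 (R k) \<and> uniform_limit (cball x d) A (\<lambda>v. (pdiff n ^^ j) f (z(k := v))) sequentially"
      using uniform_limit_on_subset[OF unif] by blast
  qed
qed

lemma summable_tcoeff:
  assumes c: "\<forall>\<alpha>\<in>multi_indices n. norm (c \<alpha>) * (\<Prod>k<n. \<rho> k ^ \<alpha> k) \<le> S" and \<rho>: "\<And>k. k < n \<Longrightarrow> 0 < \<rho> k"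
    and z: "\<And>k. k < n \<Longrightarrow> norm (z k) < \<rho> k"
  shows "(\<lambda>\<alpha>. norm (c \<alpha> * mpow n z \<alpha>)) summable_on multi_indices n"
proof (rule Infinite_Sum.abs_summable_on_comparison_test')
  have "(\<lambda>\<alpha>. \<Prod>k<n. (norm (z k) / \<rho> k) ^ \<alpha> k) summable_on multi_indices n"
    using z \<rho> by (intro summable_geometric_multi) (auto simp: less_imp_le)
  then show "(\<lambda>\<alpha>. S * (\<Prod>k<n. (norm (z k) / \<rho> k) ^ \<alpha> k)) summable_on multi_indices n"
    by (rule summable_on_cmult_right)
  fix \<alpha> assume a: "\<alpha> \<in> multi_indices n"
  have "norm (c \<alpha> * mpow n z \<alpha>) = (norm (c \<alpha>) * (\<Prod>k<n. \<rho> k ^ \<alpha> k)) * (\<Prod>k<n. (norm (z k) / \<rho> k) ^ \<alpha> k)"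
  proof -
    have "(\<Prod>k<n. \<rho> k ^ \<alpha> k) * (\<Prod>k<n. (norm (z k) / \<rho> k) ^ \<alpha> k) = (\<Prod>k<n. norm (z k) ^ \<alpha> k)"
      unfolding prod.distrib[symmetric]
    proof (rule prod.cong[OF refl])
      fix k assume "k \<in> {..<n}"
      then show "\<rho> k ^ \<alpha> k * (norm (z k) / \<rho> k) ^ \<alpha> k = norm (z k) ^ \<alpha> k"
        using \<rho>[of k] by (simp add: power_divide)
    qed
    then show ?thesis by (simp add: norm_mult mpow_def prod_norm[symmetric] norm_power mult.assoc)
  qed
  also have "\<dots> \<le> S * (\<Prod>k<n. (norm (z k) / \<rho> k) ^ \<alpha> k)"
    using c a \<rho> by (intro mult_right_mono prod_nonneg) (auto simp: less_imp_le)
  finally show "norm (c \<alpha> * mpow n z \<alpha>) \<le> S * (\<Prod>k<n. (norm (z k) / \<rho> k) ^ \<alpha> k)" .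
qed

text \<open>Expand in the last variable first: its j-th derivative at 0 is again separately
  holomorphic, with bound j! S / \<rho>_n^j. The Cauchy estimates are part of the statement since
  the induction step needs them for summability.\<close>

lemma taylor_multi:
  assumes "sep_holomorphic n R S f" "\<And>k. k < n \<Longrightarrow> 0 < \<rho> k \<and> \<rho> k < R k"
  shows "(\<forall>\<alpha>\<in>multi_indices n. norm (tcoeff n f \<alpha>) * (\<Prod>k<n. \<rho> k ^ \<alpha> k) \<le> S) \<and>
    (\<forall>z\<in>Cn n. (\<forall>k<n. norm (z k) < \<rho> k) \<longrightarrow> ((\<lambda>\<alpha>. tcoeff n f \<alpha> * mpow n z \<alpha>) has_sum f z) (multi_indices n))"
  using assms
proof (induction n arbitrary: f S)
  case 0
  have "norm (f (\<lambda>k. 0)) \<le> S"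
    using 0 by (auto simp: sep_holomorphic_def Cn_def)
  moreover have "z = (\<lambda>k. 0)" if "z \<in> Cn 0" for z
    using that by (auto simp: Cn_def)
  ultimately show ?case
    by (auto simp: multi_indices_0 tcoeff_def pdiff_multi_def mfact_def mpow_def has_sum_finite_iff)
next
  case (Suc n)
  have \<rho>n: "0 < \<rho> n" "\<rho> n < R n" using Suc.prems(2) by auto
  define G where "G = (\<lambda>j. (pdiff n ^^ j) f)"
  have G: "sep_holomorphic n R (fact j * S / \<rho> n ^ j) (G j)" for j
    unfolding G_def by (rule sep_holomorphic_pdiff[OF Suc.prems(1) \<rho>n])
  have IH: "(\<forall>\<alpha>\<in>multi_indices n. norm (tcoeff n (G j) \<alpha>) * (\<Prod>k<n. \<rho> k ^ \<alpha> k) \<le> fact j * S / \<rho> n ^ j)"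
    "\<And>z. z \<in> Cn n \<Longrightarrow> \<forall>k<n. norm (z k) < \<rho> k \<Longrightarrow> ((\<lambda>\<alpha>. tcoeff n (G j) \<alpha> * mpow n z \<alpha>) has_sum G j z) (multi_indices n)" for j
    using Suc.IH[OF G, of j] Suc.prems(2) by auto
  have c: "norm (tcoeff (Suc n) f \<alpha>) * (\<Prod>k<Suc n. \<rho> k ^ \<alpha> k) \<le> S" if "\<alpha> \<in> multi_indices (Suc n)" for \<alpha>
  proof -
    have "\<alpha> \<in> (\<lambda>(j, \<beta>). \<beta>(n := j)) ` (UNIV \<times> multi_indices n)"
      using that bij_betw_imp_surj_on[OF bij_betw_multi_indices_Suc[of n]] by blast
    then obtain j \<beta> where \<beta>: "\<beta> \<in> multi_indices n" "\<alpha> = \<beta>(n := j)" by auto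
    have "(\<Prod>k<n. \<rho> k ^ \<alpha> k) = (\<Prod>k<n. \<rho> k ^ \<beta> k)"
      by (rule prod.cong) (auto simp: \<beta>)
    then have "norm (tcoeff (Suc n) f \<alpha>) * (\<Prod>k<Suc n. \<rho> k ^ \<alpha> k)
       = (norm (tcoeff n (G j) \<beta>) * (\<Prod>k<n. \<rho> k ^ \<beta> k)) * \<rho> n ^ j / fact j"
      by (simp add: \<beta> tcoeff_Suc[OF \<beta>(1)] norm_divide G_def)
    also have "\<dots> \<le> (fact j * S / \<rho> n ^ j) * \<rho> n ^ j / fact j"
      using IH(1)[of j] \<beta>(1) \<rho>n by (intro divide_right_mono mult_right_mono) auto
    also have "\<dots> = S" using \<rho>n by simp
    finally show ?thesis .
  qed
  moreover have "((\<lambda>\<alpha>. tcoeff (Suc n) f \<alpha> * mpow (Suc n) z \<alpha>) has_sum f z) (multi_indices (Suc n))"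
    if z: "z \<in> Cn (Suc n)" "\<forall>k<Suc n. norm (z k) < \<rho> k" for z
  proof -
    \<comment> \<open>The remaining variables must form a point of \<open>Cn n\<close>, where
      coordinate n is 0.\<close>
    define z' where "z' = z(n := 0)"
    have z': "z' \<in> Cn n" "\<forall>k<n. norm (z' k) < \<rho> k" "z' n = 0" using z by (auto simp: z'_def Cn_def)
    have z'R: "\<forall>k<n. norm (z' k) < R k" using z'(2) less_trans Suc.prems(2)[OF less_SucI] by blast
    have z'S: "z' \<in> Cn (Suc n)" "\<forall>k<Suc n. norm (z' k) < R k"
      using z' z'R \<rho>n by (auto simp: Cn_def less_Suc_eq)
    have zeq: "z = z'(n := z n)" by (simp add: z'_def)
    have hol: "(\<lambda>w. f (z'(n := w))) holomorphic_on ball 0 (R n)"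
      using Suc.prems(1) z'S unfolding sep_holomorphic_def by blast
    have zn: "norm (z n) < \<rho> n" using z by simp
    \<comment> \<open>Absolute summability over all multi-indices, from the Cauchy estimates: it is
      what merges the iterated sum into a single one.\<close>
    have summ: "(\<lambda>\<alpha>. tcoeff (Suc n) f \<alpha> * mpow (Suc n) z \<alpha>) summable_on multi_indices (Suc n)"
      unfolding summable_on_iff_abs_summable_on_complex
      by (rule summable_tcoeff[of _ _ \<rho> S]) (use c Suc.prems(2) z in auto)
    have Gz: "G j z' = (deriv ^^ j) (\<lambda>w. f (z'(n := w))) 0" for j
      unfolding G_def pdiff_funpow z'(3) ..
    have "(\<lambda>j. G j z' / fact j * z n ^ j) sums f z"
      using holomorphic_power_series[OF hol, of "z n"] zn \<rho>n(2) unfolding Gz by (simp flip: zeq)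
    moreover have "summable (\<lambda>j. norm (G j z' / fact j * z n ^ j))"
    proof (rule summable_comparison_test'[of "\<lambda>j. S * (norm (z n) / \<rho> n) ^ j" 0])
      show "summable (\<lambda>j. S * (norm (z n) / \<rho> n) ^ j)"
        using zn \<rho>n by (intro summable_mult summable_geometric) auto
      fix j
      have "norm (G j z') \<le> fact j * S / \<rho> n ^ j"
        using G[of j] z'(1) z'R unfolding sep_holomorphic_def by blast
      then have "norm (G j z') / fact j * norm (z n) ^ j \<le> (fact j * S / \<rho> n ^ j) / fact j * norm (z n) ^ j"
        by (intro mult_right_mono divide_right_mono) auto
      then show "norm (norm (G j z' / fact j * z n ^ j)) \<le> S * (norm (z n) / \<rho> n) ^ j"
        by (simp add: norm_mult norm_divide norm_power power_divide)
    qed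
    ultimately have hs: "((\<lambda>j. G j z' / fact j * z n ^ j) has_sum f z) UNIV"
      by (intro norm_summable_imp_has_sum)
    have tm: "tcoeff (Suc n) f (\<beta>(n := j)) * mpow (Suc n) z (\<beta>(n := j)) = tcoeff n (G j) \<beta> * mpow n z' \<beta> * (z n ^ j / fact j)"
      if "\<beta> \<in> multi_indices n" for \<beta> j
      by (simp add: tcoeff_Suc[OF that] mpow_Suc G_def z'_def mpow_upd)
    have "((\<lambda>(j, \<beta>). tcoeff (Suc n) f (\<beta>(n := j)) * mpow (Suc n) z (\<beta>(n := j))) has_sum f z) (UNIV \<times> multi_indices n)"
    proof (rule has_sum_SigmaI[OF _ hs])
      show "((\<lambda>\<beta>. case (j, \<beta>) of (j, \<beta>) \<Rightarrow> tcoeff (Suc n) f (\<beta>(n := j)) * mpow (Suc n) z (\<beta>(n := j)))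
         has_sum G j z' / fact j * z n ^ j) (multi_indices n)" for j
      proof -
        have "((\<lambda>\<beta>. tcoeff n (G j) \<beta> * mpow n z' \<beta> * (z n ^ j / fact j)) has_sum G j z' * (z n ^ j / fact j)) (multi_indices n)"
          by (rule has_sum_cmult_left) (rule IH(2)[OF z'(1,2)])
        then show ?thesis
          by (subst has_sum_cong[where g = "\<lambda>\<beta>. tcoeff n (G j) \<beta> * mpow n z' \<beta> * (z n ^ j / fact j)"]) (auto simp: tm)
      qed
      show "(\<lambda>(j, \<beta>). tcoeff (Suc n) f (\<beta>(n := j)) * mpow (Suc n) z (\<beta>(n := j))) summable_on UNIV \<times> multi_indices n"
        using summ summable_on_reindex_bij_betw[OF bij_betw_multi_indices_Suc[of n], of "\<lambda>\<alpha>. tcoeff (Suc n) f \<alpha> * mpow (Suc n) z \<alpha>"]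
        by (simp add: split_def)
    qed
    then show ?thesis
      using has_sum_reindex_bij_betw[OF bij_betw_multi_indices_Suc[of n], of "\<lambda>\<alpha>. tcoeff (Suc n) f \<alpha> * mpow (Suc n) z \<alpha>"]
      by (simp add: split_def)
  qed
  ultimately show ?case by blast
qed

section \<open>Bohr sums on polydiscs\<close>

lemma bij_betw_degree:
  "bij_betw snd (Sigma UNIV (midx n)) (multi_indices n)"
  by (rule bij_betw_byWitness[where f' = "\<lambda>\<alpha>. (\<Sum>k<n. \<alpha> k, \<alpha>)"]) (auto simp: midx_def)

text \<open>On the slice \<omega> -> f (\<omega> w u) the homogeneous parts of f become Taylor
  coefficients in one variable, to which \<open>caratheodory\<close> applies. Absorbing u into the
  coefficients turns the polydisc with radii |u_k| into the unit one.\<close>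

lemma homogeneous_part_bound:
  assumes f: "sep_holomorphic n R S f" and R: "\<And>k. k < n \<Longrightarrow> norm (u k) < R k" and m: "m \<ge> 1"
  shows "polydisc_bound n m (\<lambda>\<alpha>. tcoeff n f \<alpha> * mpow n u \<alpha>) (2 * (S - norm (tcoeff n f (\<lambda>k. 0))))"
  unfolding polydisc_bound_def
proof (intro allI impI)
  fix w :: "nat \<Rightarrow> complex" assume w: "\<forall>k. norm (w k) \<le> 1"
  \<comment> \<open>Radii strictly between |u_k| and R k, hence positive even if u_k = 0.\<close>
  define \<rho> where "\<rho> = (\<lambda>k. (norm (u k) + R k) / 2)"
  have \<rho>: "0 < \<rho> k \<and> \<rho> k < R k" and u\<rho>: "norm (u k) < \<rho> k" if "k < n" for k
    using R[OF that] norm_ge_zero[of "u k"] le_less_trans[OF norm_ge_zero R[OF that]] by (auto simp: \<rho>_def intro: add_nonneg_pos)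
  note T = taylor_multi[OF f \<rho>, THEN conjunct2, rule_format]
  define z where "z = (\<lambda>k. if k < n then w k * u k else 0)"
  have wu: "norm (w k * u k) \<le> norm (u k)" for k
    using w mult_right_mono[of "norm (w k)" 1 "norm (u k)"] by (simp add: norm_mult)
  have z: "z \<in> Cn n" "\<And>k. k < n \<Longrightarrow> norm (z k) < \<rho> k"
    using le_less_trans[OF wu u\<rho>] by (auto simp: z_def Cn_def)
  define a where "a = (\<lambda>m. \<Sum>\<alpha>\<in>midx n m. tcoeff n f \<alpha> * mpow n z \<alpha>)"
  define g where "g = (\<lambda>\<omega>. f (\<lambda>k. \<omega> * z k))"
  have \<omega>z: "(\<lambda>k. \<omega> * z k) \<in> Cn n" "\<And>k. k < n \<Longrightarrow> norm (\<omega> * z k) < \<rho> k" if "norm \<omega> = 1" for \<omega>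
    using z that by (auto simp: Cn_def norm_mult)
  have hs: "((\<lambda>m. a m * \<omega> ^ m) has_sum g \<omega>) UNIV" if om: "norm \<omega> = 1" for \<omega>
  proof -
    have "((\<lambda>\<alpha>. tcoeff n f \<alpha> * mpow n (\<lambda>k. \<omega> * z k) \<alpha>) has_sum g \<omega>) (multi_indices n)"
      unfolding g_def by (rule T) (use \<omega>z[OF om] in auto)
    then have "((\<lambda>p. tcoeff n f (snd p) * mpow n (\<lambda>k. \<omega> * z k) (snd p)) has_sum g \<omega>) (Sigma UNIV (midx n))"
      by (subst has_sum_reindex_bij_betw[OF bij_betw_degree[of n], of "\<lambda>\<alpha>. tcoeff n f \<alpha> * mpow n (\<lambda>k. \<omega> * z k) \<alpha>"])
    then show ?thesis
    proof (rule has_sum_SigmaD)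
      fix m
      have "((\<lambda>\<alpha>. tcoeff n f \<alpha> * mpow n (\<lambda>k. \<omega> * z k) \<alpha>) has_sum (\<Sum>\<alpha>\<in>midx n m. tcoeff n f \<alpha> * mpow n (\<lambda>k. \<omega> * z k) \<alpha>)) (midx n m)"
        by (rule has_sum_finite) simp
      also have "(\<Sum>\<alpha>\<in>midx n m. tcoeff n f \<alpha> * mpow n (\<lambda>k. \<omega> * z k) \<alpha>) = a m * \<omega> ^ m"
        unfolding a_def sum_distrib_right by (intro sum.cong refl) (simp add: mpow_cmult mult_ac)
      finally show "((\<lambda>\<alpha>. tcoeff n f (snd (m, \<alpha>)) * mpow n (\<lambda>k. \<omega> * z k) (snd (m, \<alpha>))) has_sum a m * \<omega> ^ m) (midx n m)"
        by simp
    qed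
  qed
  have "norm (a m) \<le> 2 * (S - norm (a 0))"
  proof (rule caratheodory[OF _ _ _ m])
    have "a summable_on UNIV" using hs[of 1] by (auto simp: summable_on_def)
    then show "summable (\<lambda>i. norm (a i))"
      unfolding summable_on_iff_abs_summable_on_complex by (rule summable_on_imp_summable)
    show "(\<lambda>i. a i * \<omega> ^ i) sums g \<omega>" if "norm \<omega> = 1" for \<omega>
      using hs[OF that] by (rule has_sum_imp_sums)
    show "norm (g \<omega>) \<le> S" if "norm \<omega> = 1" for \<omega>
    proof -
      have "\<forall>k<n. norm (\<omega> * z k) < R k" using less_trans[OF \<omega>z(2)[OF that]] \<rho> by blast
      then show ?thesis
        using f[unfolded sep_holomorphic_def, rule_format, OF \<omega>z(1)[OF that]] unfolding g_def by blast
    qed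
  qed
  moreover have "a 0 = tcoeff n f (\<lambda>k. 0)"
    by (simp add: a_def midx_0 mpow_def)
  moreover have "homp n m (\<lambda>\<alpha>. tcoeff n f \<alpha> * mpow n u \<alpha>) w = a m"
  proof -
    have "mpow n z \<alpha> = mpow n u \<alpha> * mpow n w \<alpha>" for \<alpha>
      by (simp add: mpow_def z_def power_mult_distrib prod.distrib mult.commute)
    then show ?thesis by (simp add: homp_def a_def mult.assoc)
  qed
  ultimately show "norm (homp n m (\<lambda>\<alpha>. tcoeff n f \<alpha> * mpow n u \<alpha>) w) \<le> 2 * (S - norm (tcoeff n f (\<lambda>k. 0)))"
    by simp
qed

text \<open>The degrees m \<ge> 1 contribute at most 1/2 * 2 (S - c0), exactly what the constant
  term c0 leaves of S. Finite sets F suffice, as a sum in \<open>ennreal\<close> is the supremum of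
  its finite partial sums.\<close>

lemma bohr_sum_le:
  fixes u :: "nat \<Rightarrow> complex"
  assumes f: "sep_holomorphic n R S f" and R: "\<And>k. k < n \<Longrightarrow> norm (u k) < R k" and n: "n \<ge> 1" and r: "r \<ge> 0"
    and \<kappa>: "\<forall>m\<ge>1. 1 \<le> \<kappa> m \<and> \<kappa> m \<le> m"
    and small: "\<And>D. (\<Sum>m=1..D. sidon_bound (\<kappa> m) m n * r ^ m) \<le> 1/2"
    and F: "finite F" "F \<subseteq> multi_indices n"
  shows "(\<Sum>\<alpha>\<in>F. norm (tcoeff n f \<alpha> * mpow n (\<lambda>k. of_real r * u k) \<alpha>)) \<le> S"
proof -
  define c0 where "c0 = norm (tcoeff n f (\<lambda>k. 0))"
  define D where "D = Max (insert 0 ((\<lambda>\<alpha>. \<Sum>k<n. \<alpha> k) ` F))"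
  let ?t = "\<lambda>\<alpha>. norm (tcoeff n f \<alpha> * mpow n (\<lambda>k. of_real r * u k) \<alpha>)"
  have sub: "F \<subseteq> (\<Union>m\<in>{..D}. midx n m)"
  proof
    fix \<alpha> assume "\<alpha> \<in> F"
    then have "(\<Sum>k<n. \<alpha> k) \<le> D" "\<alpha> \<in> multi_indices n" using F by (auto simp: D_def)
    then show "\<alpha> \<in> (\<Union>m\<in>{..D}. midx n m)" by (auto simp: midx_def)
  qed
  have pb: "polydisc_bound n m (\<lambda>\<alpha>. tcoeff n f \<alpha> * mpow n u \<alpha>) (2 * (S - c0))" if "m \<ge> 1" for m
    unfolding c0_def by (rule homogeneous_part_bound[OF f R that])
  have "0 \<le> 2 * (S - c0)"
    by (rule order_trans[OF norm_ge_zero pb[of 1, unfolded polydisc_bound_def, rule_format, of "\<lambda>_. 0"]]) auto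
  then have S0: "c0 \<le> S" by simp
  have deg: "(\<Sum>\<alpha>\<in>midx n m. ?t \<alpha>) \<le> sidon_bound (\<kappa> m) m n * r ^ m * (2 * (S - c0))" if m: "m \<ge> 1" for m
  proof -
    have sb: "sidon_bound (\<kappa> m) m n \<ge> 0" by (simp add: sidon_bound_def bh_const_def)
    \<comment> \<open>\<open>sidon\<close> asks for a positive bound, but S - c0 may vanish; e is
      sent to 0 afterwards.\<close>
    have "(\<Sum>\<alpha>\<in>midx n m. norm (tcoeff n f \<alpha> * mpow n u \<alpha>)) \<le> sidon_bound (\<kappa> m) m n * (2 * (S - c0) + e)" if "e > 0" for e
    proof (rule sidon)
      show "polydisc_bound n m (\<lambda>\<alpha>. tcoeff n f \<alpha> * mpow n u \<alpha>) (2 * (S - c0) + e)"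
        unfolding polydisc_bound_def
      proof (intro allI impI)
        fix w :: "nat \<Rightarrow> complex" assume "\<forall>k. norm (w k) \<le> 1"
        then have "norm (homp n m (\<lambda>\<alpha>. tcoeff n f \<alpha> * mpow n u \<alpha>) w) \<le> 2 * (S - c0)"
          using pb[OF m] unfolding polydisc_bound_def by blast
        then show "norm (homp n m (\<lambda>\<alpha>. tcoeff n f \<alpha> * mpow n u \<alpha>) w) \<le> 2 * (S - c0) + e"
          using that by simp
      qed
    qed (use \<kappa> m that S0 n in auto)
    then have "(\<Sum>\<alpha>\<in>midx n m. norm (tcoeff n f \<alpha> * mpow n u \<alpha>)) \<le> sidon_bound (\<kappa> m) m n * (2 * (S - c0)) + e" if "e > 0" for e
    proof (cases "sidon_bound (\<kappa> m) m n = 0")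
      case True
      then show ?thesis using \<open>\<And>e. e > 0 \<Longrightarrow> _\<close>[of 1] that by simp
    next
      case False
      then show ?thesis using \<open>\<And>e. e > 0 \<Longrightarrow> _\<close>[of "e / sidon_bound (\<kappa> m) m n"] that sb
        by (simp add: distrib_left)
    qed
    then have "(\<Sum>\<alpha>\<in>midx n m. norm (tcoeff n f \<alpha> * mpow n u \<alpha>)) \<le> sidon_bound (\<kappa> m) m n * (2 * (S - c0))"
      by (rule field_le_epsilon)
    then have "r ^ m * (\<Sum>\<alpha>\<in>midx n m. norm (tcoeff n f \<alpha> * mpow n u \<alpha>)) \<le> r ^ m * (sidon_bound (\<kappa> m) m n * (2 * (S - c0)))"
      using r by (intro mult_left_mono) auto
    moreover have "(\<Sum>\<alpha>\<in>midx n m. ?t \<alpha>) = r ^ m * (\<Sum>\<alpha>\<in>midx n m. norm (tcoeff n f \<alpha> * mpow n u \<alpha>))"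
      unfolding sum_distrib_left using r
      by (intro sum.cong refl) (simp add: mpow_cmult norm_mult norm_power)
    ultimately show ?thesis by (simp add: mult_ac)
  qed
  have "(\<Sum>\<alpha>\<in>F. ?t \<alpha>) \<le> (\<Sum>\<alpha>\<in>(\<Union>m\<in>{..D}. midx n m). ?t \<alpha>)"
    using sub by (intro sum_mono2) auto
  also have "\<dots> = (\<Sum>m\<le>D. \<Sum>\<alpha>\<in>midx n m. ?t \<alpha>)"
    by (rule sum.UNION_disjoint) (simp_all, auto simp: midx_def)
  also have "\<dots> = (\<Sum>\<alpha>\<in>midx n 0. ?t \<alpha>) + (\<Sum>m=1..D. \<Sum>\<alpha>\<in>midx n m. ?t \<alpha>)"
  proof -
    have "{..D} = insert 0 {1..D}" by auto
    then show ?thesis by simp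
  qed
  also have "(\<Sum>\<alpha>\<in>midx n 0. ?t \<alpha>) = c0"
    by (simp add: midx_0 mpow_def c0_def)
  also have "(\<Sum>m=1..D. \<Sum>\<alpha>\<in>midx n m. ?t \<alpha>) \<le> (\<Sum>m=1..D. sidon_bound (\<kappa> m) m n * r ^ m * (2 * (S - c0)))"
    by (intro sum_mono deg) simp
  also have "\<dots> \<le> 1/2 * (2 * (S - c0))"
    unfolding sum_distrib_right[symmetric] using small[of D] S0 by (intro mult_right_mono) auto
  finally show ?thesis by (simp add: diff_divide_distrib)
qed

section \<open>The lower bound\<close>

locale seq_lattice =
  fixes X :: "(nat \<Rightarrow> complex) set" and N :: "(nat \<Rightarrow> complex) \<Rightarrow> real"
  assumes lattice: "banach_sequence_lattice X N"
begin

lemma zero_mem: "(\<lambda>k. 0) \<in> X"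
  and add_mem: "x \<in> X \<Longrightarrow> y \<in> X \<Longrightarrow> (\<lambda>k. x k + y k) \<in> X"
  and scale_mem: "x \<in> X \<Longrightarrow> (\<lambda>k. c * x k) \<in> X"
  and N_nonneg: "x \<in> X \<Longrightarrow> 0 \<le> N x"
  and N_eq_0: "x \<in> X \<Longrightarrow> N x = 0 \<longleftrightarrow> x = (\<lambda>k. 0)"
  and N_triangle: "x \<in> X \<Longrightarrow> y \<in> X \<Longrightarrow> N (\<lambda>k. x k + y k) \<le> N x + N y"
  and N_scale: "x \<in> X \<Longrightarrow> N (\<lambda>k. c * x k) = norm c * N x"
  and N_mono: "x \<in> X \<Longrightarrow> (\<And>k. norm (y k) \<le> norm (x k)) \<Longrightarrow> N y \<le> N x"
  and unit_mem: "unit_seq k \<in> X"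
  using lattice unfolding banach_sequence_lattice_def by simp_all

lemma truncation_mem: "(\<lambda>k. if k < n then a k else 0) \<in> X"
proof (induction n)
  case (Suc n)
  have "(\<lambda>k. (if k < n then a k else 0) + a n * unit_seq n k) \<in> X"
    by (intro add_mem Suc scale_mem unit_mem)
  also have "(\<lambda>k. (if k < n then a k else 0) + a n * unit_seq n k) = (\<lambda>k. if k < Suc n then a k else 0)"
    by (auto simp: unit_seq_def fun_eq_iff less_Suc_eq)
  finally show ?case .
qed (simp add: zero_mem)

lemma Xn_norm_mono:
  assumes "\<And>k. k < n \<Longrightarrow> norm (z k) \<le> norm (w k)"
  shows "Xn_norm N n z \<le> Xn_norm N n w"
  unfolding Xn_norm_def using assms by (intro N_mono truncation_mem) auto

lemma Xn_norm_scale: "Xn_norm N n (\<lambda>k. c * z k) = norm c * Xn_norm N n z"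
proof -
  have "(\<lambda>k. if k < n then complex_of_real (norm (c * z k)) else 0)
      = (\<lambda>k. of_real (norm c) * (if k < n then complex_of_real (norm (z k)) else 0))"
    by (auto simp: norm_mult fun_eq_iff)
  then show ?thesis
    unfolding Xn_norm_def using N_scale[OF truncation_mem, of "of_real (norm c)" n "\<lambda>k. of_real (norm (z k))"] by simp
qed

text \<open>For enlarging a point of the open ball to a polydisc that contains it strictly and still
  lies in the ball.\<close>

lemma Xn_norm_add_const:
  assumes "\<delta> \<ge> 0"
  shows "Xn_norm N n (\<lambda>k. of_real (norm (z k) + \<delta>)) \<le> Xn_norm N n z + \<delta> * Xn_norm N n (\<lambda>k. 1)"
proof -
  have nd: "norm (complex_of_real (norm (z k) + \<delta>)) = norm (z k) + \<delta>" for k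
    using assms unfolding norm_of_real by simp
  have "(\<lambda>k. if k < n then complex_of_real (norm (complex_of_real (norm (z k) + \<delta>))) else 0)
      = (\<lambda>k. (if k < n then complex_of_real (norm (z k)) else 0) + (if k < n then complex_of_real (norm (of_real \<delta> * 1 :: complex)) else 0))"
    using assms unfolding nd by (auto simp: fun_eq_iff)
  then have "Xn_norm N n (\<lambda>k. of_real (norm (z k) + \<delta>)) \<le> Xn_norm N n z + Xn_norm N n (\<lambda>k. of_real \<delta> * 1)"
    unfolding Xn_norm_def using N_triangle[OF truncation_mem truncation_mem] by simp
  then show ?thesis unfolding Xn_norm_scale using assms by simp
qed

lemma Xn_norm_nonneg: "0 \<le> Xn_norm N n z"
  unfolding Xn_norm_def by (intro N_nonneg truncation_mem)

lemma N_unit_pos: "0 < N (unit_seq k)"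
proof -
  have "unit_seq k \<noteq> (\<lambda>k. 0)" by (auto simp: unit_seq_def fun_eq_iff)
  then show ?thesis using N_nonneg[OF unit_mem] N_eq_0[OF unit_mem] by (metis less_eq_real_def)
qed

lemma coord_le_Xn_norm:
  assumes "k < n"
  shows "norm (z k) * N (unit_seq k) \<le> Xn_norm N n z"
proof -
  have "norm (z k) * N (unit_seq k) = N (\<lambda>i. z k * unit_seq k i)"
    by (simp add: N_scale unit_mem)
  also have "\<dots> \<le> Xn_norm N n z"
    unfolding Xn_norm_def using assms by (intro N_mono truncation_mem) (auto simp: unit_seq_def)
  finally show ?thesis .
qed

lemma coord_bound:
  assumes "Xn_norm N n z \<le> 1" "k < n"
  shows "norm (z k) \<le> 1 / N (unit_seq k)"
  using coord_le_Xn_norm[OF assms(2), of z] assms(1) N_unit_pos[of k] by (simp add: le_divide_eq)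

end

lemma sup_norm_n_single:
  assumes "k < n"
  shows "sup_norm_n n (\<lambda>i. if i = k then t else 0) = norm t"
  unfolding sup_norm_n_def by (rule Max_eqI) (use assms in \<open>auto intro!: image_eqI[of _ _ k]\<close>)

lemma holomorphic_n_imp_separate:
  assumes f: "holomorphic_n n f U" and k: "k < n" and U: "\<And>w. w \<in> S \<Longrightarrow> z(k := w) \<in> U"
  shows "(\<lambda>w. f (z(k := w))) holomorphic_on S"
  unfolding holomorphic_on_def
proof
  fix x assume x: "x \<in> S"
  obtain c where c: "\<forall>e>0. \<exists>d>0. \<forall>h\<in>Cn n. sup_norm_n n h < d \<longrightarrow>
      norm (f (\<lambda>i. (z(k := x)) i + h i) - f (z(k := x)) - (\<Sum>i<n. c i * h i)) \<le> e * sup_norm_n n h"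
    using f U[OF x] unfolding holomorphic_n_def by blast
  have "((\<lambda>w. f (z(k := w))) has_derivative (*) (c k)) (at x)"
    unfolding has_derivative_at_alt
  proof (intro conjI allI impI bounded_linear_mult_right)
    fix e :: real assume "0 < e"
    then obtain d where d: "d > 0" "\<forall>h\<in>Cn n. sup_norm_n n h < d \<longrightarrow>
      norm (f (\<lambda>i. (z(k := x)) i + h i) - f (z(k := x)) - (\<Sum>i<n. c i * h i)) \<le> e * sup_norm_n n h"
      using c by blast
    show "\<exists>d>0. \<forall>y. norm (y - x) < d \<longrightarrow> norm (f (z(k := y)) - f (z(k := x)) - c k * (y - x)) \<le> e * norm (y - x)"
    proof (intro exI[of _ d] conjI allI impI d)
      fix y assume y: "norm (y - x) < d"
      let ?h = "\<lambda>i. if i = k then y - x else 0"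
      have "?h \<in> Cn n" using k by (auto simp: Cn_def)
      moreover have "(\<lambda>i. (z(k := x)) i + ?h i) = z(k := y)" by auto
      moreover have "(\<Sum>i<n. c i * ?h i) = c k * (y - x)"
        using k by (simp add: if_distrib[of "\<lambda>v. _ * v"] cong: if_cong)
      ultimately show "norm (f (z(k := y)) - f (z(k := x)) - c k * (y - x)) \<le> e * norm (y - x)"
        using d(2) y sup_norm_n_single[OF k, of "y - x"] by metis
    qed
  qed
  then have "((\<lambda>w. f (z(k := w))) has_field_derivative c k) (at x)"
    by (simp add: has_field_derivative_def)
  then show "(\<lambda>w. f (z(k := w))) field_differentiable at x within S"
    using field_differentiable_at_within field_differentiable_def by blast
qed

definition bohr_set :: "((nat \<Rightarrow> complex) \<Rightarrow> real) \<Rightarrow> nat \<Rightarrow> real set" where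
  "bohr_set N n = {r. 0 < r \<and> r < 1 \<and>
     (\<forall>f. holomorphic_n n f (Xn_ball N n 1) \<and> bounded (f ` Xn_ball N n 1) \<longrightarrow>
        (\<forall>z \<in> Xn_ball N n r.
           (\<Sum>\<^sub>\<infinity>\<alpha>\<in>multi_indices n.
              ennreal (norm (pdiff_multi n \<alpha> f (\<lambda>k. 0) / mfact n \<alpha> * mpow n z \<alpha>)))
           \<le> ennreal (SUP w \<in> Xn_ball N n 1. norm (f w))))}"

lemma bohr_radius_eq: "bohr_radius N n = Sup (bohr_set N n)"
  unfolding bohr_radius_def bohr_set_def ..

lemma bdd_above_bohr_set: "bdd_above (bohr_set N n)"
  by (rule bdd_aboveI[of _ 1]) (auto simp: bohr_set_def)

context seq_lattice
begin

text \<open>By the lattice property the ball contains the open polydisc with radii R k as soon as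
  the corner (R k) has norm below 1.\<close>

lemma sep_holomorphic_of_holomorphic_n:
  assumes f: "holomorphic_n n f (Xn_ball N n 1)" "bounded (f ` Xn_ball N n 1)"
    and R: "Xn_norm N n (\<lambda>k. of_real (R k)) < 1"
  shows "sep_holomorphic n R (SUP w \<in> Xn_ball N n 1. norm (f w)) f"
proof -
  have in_ball: "z \<in> Xn_ball N n 1" if "z \<in> Cn n" "\<forall>k<n. norm (z k) < R k" for z
  proof -
    have "Xn_norm N n z \<le> Xn_norm N n (\<lambda>k. of_real (R k))"
    proof (rule Xn_norm_mono)
      fix k assume "k < n"
      then have "norm (z k) < R k" using that by blast
      then show "norm (z k) \<le> norm (complex_of_real (R k))" by simp
    qed
    then show ?thesis using R that(1) by (simp add: Xn_ball_def)
  qed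
  have "bdd_above ((\<lambda>w. norm (f w)) ` Xn_ball N n 1)"
  proof -
    obtain b where "\<forall>w\<in>Xn_ball N n 1. norm (f w) \<le> b" using f(2) by (auto simp: bounded_iff)
    then show ?thesis by (intro bdd_aboveI2) auto
  qed
  then have "norm (f z) \<le> (SUP w \<in> Xn_ball N n 1. norm (f w))" if "z \<in> Xn_ball N n 1" for z
    using that by (rule cSUP_upper[rotated])
  moreover have "(\<lambda>w. f (z(k := w))) holomorphic_on ball 0 (R k)"
    if "z \<in> Cn n" "\<forall>k<n. norm (z k) < R k" "k < n" for z k
    by (rule holomorphic_n_imp_separate[OF f(1) that(3)], rule in_ball) (use that in \<open>auto simp: Cn_def\<close>)
  ultimately show ?thesis
    unfolding sep_holomorphic_def using in_ball by blast
qed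

lemma mem_bohr_set:
  assumes n: "n \<ge> 1" and r: "0 < r" "r < 1"
    and \<kappa>: "\<forall>m\<ge>1. 1 \<le> \<kappa> m \<and> \<kappa> m \<le> m"
    and small: "\<And>D. (\<Sum>m=1..D. sidon_bound (\<kappa> m) m n * r ^ m) \<le> 1/2"
  shows "r \<in> bohr_set N n"
proof -
  have "(\<Sum>\<^sub>\<infinity>\<alpha>\<in>multi_indices n. ennreal (norm (pdiff_multi n \<alpha> f (\<lambda>k. 0) / mfact n \<alpha> * mpow n z \<alpha>)))
      \<le> ennreal (SUP w \<in> Xn_ball N n 1. norm (f w))"
    if f: "holomorphic_n n f (Xn_ball N n 1)" "bounded (f ` Xn_ball N n 1)" and z: "z \<in> Xn_ball N n r" for f z
  proof -
    define u where "u = (\<lambda>k. of_real (1 / r) * z k)"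
    have zu: "z = (\<lambda>k. of_real r * u k)" using r by (auto simp: u_def)
    have "norm (complex_of_real (1 / r)) = 1 / r" unfolding norm_of_real using r by simp
    then have "Xn_norm N n u < 1"
      unfolding u_def Xn_norm_scale using z r by (simp add: Xn_ball_def)
    \<comment> \<open>Adding 1 makes the denominator of \<delta> positive; \<delta> then uses up at
      most half of the slack 1 - \<open>Xn_norm N n u\<close>.\<close>
    define c where "c = 1 + Xn_norm N n (\<lambda>k. 1)"
    have c: "c > 0" using Xn_norm_nonneg[of n "\<lambda>k. 1"] by (simp add: c_def)
    define \<delta> where "\<delta> = (1 - Xn_norm N n u) / (2 * c)"
    have \<delta>: "\<delta> > 0" using \<open>Xn_norm N n u < 1\<close> c by (simp add: \<delta>_def)
    have "\<delta> * Xn_norm N n (\<lambda>k. 1) \<le> \<delta> * c" using \<delta> by (simp add: c_def)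
    also have "\<dots> = (1 - Xn_norm N n u) / 2" using c by (simp add: \<delta>_def)
    also have "\<dots> < 1 - Xn_norm N n u" using \<open>Xn_norm N n u < 1\<close> by simp
    finally have "Xn_norm N n (\<lambda>k. of_real (norm (u k) + \<delta>)) < 1"
      using Xn_norm_add_const[of \<delta> n u] \<delta> by simp
    then have sh: "sep_holomorphic n (\<lambda>k. norm (u k) + \<delta>) (SUP w \<in> Xn_ball N n 1. norm (f w)) f"
      by (rule sep_holomorphic_of_holomorphic_n[OF f])
    have fin: "(\<Sum>\<alpha>\<in>F. norm (tcoeff n f \<alpha> * mpow n z \<alpha>)) \<le> (SUP w \<in> Xn_ball N n 1. norm (f w))"
      if "finite F" "F \<subseteq> multi_indices n" for F
      unfolding zu by (rule bohr_sum_le[OF sh _ n _ \<kappa> small that]) (use \<delta> r in auto)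
    show ?thesis
      unfolding tcoeff_def[symmetric]
      by (subst nonneg_infsum_complete) (auto intro!: SUP_least ennreal_leI fin simp: sum_ennreal)
  qed
  then show ?thesis using r unfolding bohr_set_def by blast
qed

text \<open>Membership is recorded besides the inequality: it makes \<open>bohr_set N n\<close>
  nonempty, which estimating its supremum from above requires.\<close>

lemma bohr_radius_lower:
  assumes t: "0 < t" "t < 1"
  shows "\<forall>\<^sub>F n in sequentially. t * bohr_rate n \<in> bohr_set N n \<and> t * bohr_rate n \<le> bohr_radius N n"
proof -
  obtain \<kappa> where \<kappa>: "\<forall>m\<ge>1. 1 \<le> \<kappa> m \<and> \<kappa> m \<le> m"
    and ev: "\<forall>\<^sub>F n in sequentially. \<forall>D. (\<Sum>m=1..D. sidon_bound (\<kappa> m) m n * (t * bohr_rate n) ^ m) \<le> 1/2"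
    using sidon_sum_small[OF t] by blast
  have "bohr_rate \<longlonglongrightarrow> 0" unfolding bohr_rate_def by real_asymp
  then have ev1: "\<forall>\<^sub>F n in sequentially. bohr_rate n < 1" by (rule order_tendstoD) simp
  show ?thesis
    using ev ev1 eventually_ge_at_top[of "3::nat"]
  proof eventually_elim
    case (elim n)
    then have "ln (real n) / real n > 0" by simp
    then have r: "bohr_rate n > 0" by (simp add: bohr_rate_def)
    have "t * bohr_rate n < 1 * 1" using t elim(2) r by (intro mult_strict_mono) auto
    then have "t * bohr_rate n \<in> bohr_set N n"
      using elim t r by (intro mem_bohr_set[OF _ _ _ \<kappa>]) auto
    then show ?case unfolding bohr_radius_eq using cSup_upper[OF _ bdd_above_bohr_set] by blast
  qed
qed

end

section \<open>Random polynomials\<close>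

text \<open>Subgaussian bound for a random sign, up to the constant in the exponent. For |x| \<le> 1
  the exponentials are compared with 1 + |x| + x^2 and 1 - |x| + x^2; beyond that |x| \<le>
  x^2.\<close>

lemma cosh_le_exp_square: "(exp x + exp (- x)) / 2 \<le> exp (x\<^sup>2)" for x :: real
proof -
  have *: "(exp y + exp (- y)) / 2 \<le> exp (y\<^sup>2)" if y: "0 \<le> y" for y :: real
  proof (cases "y \<le> 1")
    case True
    have "exp (- y) * 1 \<le> exp (- y) * ((1 - y + y\<^sup>2) * (1 + y + y\<^sup>2 / 2))"
    proof (rule mult_left_mono)
      have "(1 - y + y\<^sup>2) * (1 + y + y\<^sup>2 / 2) = 1 + (y\<^sup>2 / 2 + y ^ 3 / 2 + y ^ 4 / 2)"
        by (simp add: field_simps power2_eq_square power3_eq_cube power4_eq_xxxx)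
      then show "1 \<le> (1 - y + y\<^sup>2) * (1 + y + y\<^sup>2 / 2)" using y by simp
    qed simp
    also have "\<dots> \<le> exp (- y) * ((1 - y + y\<^sup>2) * exp y)"
      using exp_lower_Taylor_quadratic[OF y] True y by (intro mult_left_mono) auto
    also have "\<dots> = 1 - y + y\<^sup>2" by (simp add: exp_minus)
    finally have "exp (- y) \<le> 1 - y + y\<^sup>2" by simp
    then have "(exp y + exp (- y)) / 2 \<le> 1 + y\<^sup>2" using exp_bound[OF y True] by simp
    also have "\<dots> \<le> exp (y\<^sup>2)" by (rule exp_ge_add_one_self)
    finally show ?thesis .
  next
    case False
    then have "1 * y \<le> y * y" by (intro mult_right_mono) auto
    then have "y \<le> y\<^sup>2" "- y \<le> y\<^sup>2" using y by (auto simp: power2_eq_square)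
    then have "exp y + exp (- y) \<le> exp (y\<^sup>2) + exp (y\<^sup>2)"
      by (intro add_mono iffD2[OF exp_le_cancel_iff])
    then show ?thesis by simp
  qed
  show ?thesis using *[of x] *[of "- x"] by (cases "0 \<le> x") (auto simp: add.commute)
qed

text \<open>Signs are chosen one at a time, each choice not increasing the conditional mean.\<close>

lemma ex_signs:
  fixes x :: "'i \<Rightarrow> 'a \<Rightarrow> real"
  assumes "finite A" "\<And>i. i \<in> I \<Longrightarrow> 0 \<le> W i"
  shows "\<exists>\<epsilon>. (\<forall>a. \<epsilon> a = 1 \<or> \<epsilon> a = -1) \<and>
    (\<Sum>i\<in>I. W i * exp (\<Sum>a\<in>A. \<epsilon> a * x i a)) \<le> (\<Sum>i\<in>I. W i * exp (\<Sum>a\<in>A. (x i a)\<^sup>2))"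
  using assms
proof (induction A arbitrary: W rule: finite_induct)
  case empty
  then show ?case by (intro exI[of _ "\<lambda>_. 1"]) simp
next
  case (insert b A)
  let ?c = "\<lambda>i. (exp (x i b) + exp (- x i b)) / 2"
  have "\<exists>\<epsilon>. (\<forall>a. \<epsilon> a = 1 \<or> \<epsilon> a = -1) \<and>
    (\<Sum>i\<in>I. (W i * ?c i) * exp (\<Sum>a\<in>A. \<epsilon> a * x i a)) \<le> (\<Sum>i\<in>I. (W i * ?c i) * exp (\<Sum>a\<in>A. (x i a)\<^sup>2))"
    using insert.prems by (intro insert.IH mult_nonneg_nonneg) (auto intro: add_nonneg_nonneg)
  then obtain \<epsilon> where \<epsilon>: "\<forall>a. \<epsilon> a = 1 \<or> \<epsilon> a = -1"
    "(\<Sum>i\<in>I. (W i * ?c i) * exp (\<Sum>a\<in>A. \<epsilon> a * x i a)) \<le> (\<Sum>i\<in>I. (W i * ?c i) * exp (\<Sum>a\<in>A. (x i a)\<^sup>2))"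
    by blast
  let ?E = "\<lambda>s. (\<Sum>i\<in>I. W i * exp (\<Sum>a\<in>insert b A. (\<epsilon>(b := s)) a * x i a))"
  have E: "?E s = (\<Sum>i\<in>I. W i * (exp (s * x i b) * exp (\<Sum>a\<in>A. \<epsilon> a * x i a)))" for s
  proof -
    have "(\<Sum>a\<in>A. (\<epsilon>(b := s)) a * x i a) = (\<Sum>a\<in>A. \<epsilon> a * x i a)" for i
      using insert.hyps by (intro sum.cong) auto
    then show ?thesis using insert.hyps by (simp add: exp_add del: fun_upd_apply) simp
  qed
  have "(?E 1 + ?E (-1)) / 2 = (\<Sum>i\<in>I. (W i * ?c i) * exp (\<Sum>a\<in>A. \<epsilon> a * x i a))"
    unfolding E by (simp add: sum.distrib[symmetric] sum_divide_distrib algebra_simps add_divide_distrib)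
  also have "\<dots> \<le> (\<Sum>i\<in>I. (W i * ?c i) * exp (\<Sum>a\<in>A. (x i a)\<^sup>2))" by (rule \<epsilon>(2))
  also have "\<dots> \<le> (\<Sum>i\<in>I. (W i * exp ((x i b)\<^sup>2)) * exp (\<Sum>a\<in>A. (x i a)\<^sup>2))"
    using insert.prems cosh_le_exp_square by (intro sum_mono mult_right_mono mult_left_mono) auto
  also have "\<dots> = (\<Sum>i\<in>I. W i * exp (\<Sum>a\<in>insert b A. (x i a)\<^sup>2))"
    using insert.hyps by (simp add: exp_add mult.assoc)
  finally have avg: "(?E 1 + ?E (-1)) / 2 \<le> (\<Sum>i\<in>I. W i * exp (\<Sum>a\<in>insert b A. (x i a)\<^sup>2))" .
  have half: "u \<le> w \<or> v \<le> w" if "(u + v) / 2 \<le> w" for u v w :: real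
    using that by (cases "u \<le> w") auto
  have "?E 1 \<le> (\<Sum>i\<in>I. W i * exp (\<Sum>a\<in>insert b A. (x i a)\<^sup>2)) \<or> ?E (-1) \<le> (\<Sum>i\<in>I. W i * exp (\<Sum>a\<in>insert b A. (x i a)\<^sup>2))"
    by (rule half[OF avg])
  then obtain s where "s = 1 \<or> s = -1" "?E s \<le> (\<Sum>i\<in>I. W i * exp (\<Sum>a\<in>insert b A. (x i a)\<^sup>2))" by blast
  then show ?case using \<epsilon>(1) by (intro exI[of _ "\<epsilon>(b := s)"]) auto
qed

section \<open>The net and the random polynomial\<close>

definition multinom :: "nat \<Rightarrow> nat \<Rightarrow> (nat \<Rightarrow> nat) \<Rightarrow> real" where
  "multinom n m \<alpha> = fact m / (\<Prod>k<n. fact (\<alpha> k))"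

lemma multinom_bounds: "0 < multinom n m \<alpha>" "multinom n m \<alpha> \<le> fact m"
proof -
  have "(1::real) \<le> (\<Prod>k<n. fact (\<alpha> k))" by (intro prod_ge_1) (simp add: fact_ge_1)
  then show "multinom n m \<alpha> \<le> fact m" "0 < multinom n m \<alpha>"
    by (auto simp: multinom_def divide_le_eq)
qed

lemma sum_multinom: "(\<Sum>\<alpha>\<in>midx n m. multinom n m \<alpha> * (\<Prod>k<n. u k ^ \<alpha> k)) = (\<Sum>k<n. u k) ^ m"
  unfolding multinom_def by (rule multinomial_theorem)

lemma norm_mpow: "norm (mpow n z \<alpha>) = (\<Prod>k<n. norm (z k) ^ \<alpha> k)"
  by (simp add: mpow_def prod_norm[symmetric] norm_power)

lemma norm_mpow_diff:
  assumes "\<alpha> \<in> midx n m" "\<And>k. k < n \<Longrightarrow> norm (z k) \<le> 1" "\<And>k. k < n \<Longrightarrow> norm (w k) \<le> 1"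
    "\<And>k. k < n \<Longrightarrow> norm (z k - w k) \<le> d"
  shows "norm (mpow n z \<alpha> - mpow n w \<alpha>) \<le> real m * d"
proof -
  have "norm (mpow n z \<alpha> - mpow n w \<alpha>) \<le> (\<Sum>k<n. norm (z k ^ \<alpha> k - w k ^ \<alpha> k))"
    unfolding mpow_def using assms by (intro norm_prod_diff) (auto simp: norm_power power_le_one)
  also have "\<dots> \<le> (\<Sum>k<n. real (\<alpha> k) * d)"
  proof (rule sum_mono)
    fix k assume k: "k \<in> {..<n}"
    then have "norm (z k ^ \<alpha> k - w k ^ \<alpha> k) \<le> real (\<alpha> k) * norm (z k - w k)"
      using assms by (intro norm_power_diff) auto
    also have "\<dots> \<le> real (\<alpha> k) * d" using assms k by (intro mult_left_mono) auto
    finally show "norm (z k ^ \<alpha> k - w k ^ \<alpha> k) \<le> real (\<alpha> k) * d" .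
  qed
  also have "\<dots> = real m * d"
    using assms(1) by (auto simp: midx_def sum_distrib_right[symmetric] simp flip: of_nat_sum)
  finally show ?thesis .
qed

text \<open>Rounding goes towards 0, so that moduli do not grow and the net point chosen for a point
  of the Euclidean ball stays in that ball.\<close>

lemma real_grid:
  assumes "\<bar>t\<bar> \<le> 1" "q \<ge> 1"
  shows "\<exists>a\<in>{- int q..int q}. \<bar>real_of_int a / real q\<bar> \<le> \<bar>t\<bar> \<and> \<bar>t - real_of_int a / real q\<bar> \<le> 1 / real q"
proof -
  have *: "\<exists>a\<in>{0..int q}. real_of_int a / real q \<le> t \<and> t - real_of_int a / real q \<le> 1 / real q"
    if t: "0 \<le> t" "t \<le> 1" for t
  proof (rule bexI[of _ "\<lfloor>t * real q\<rfloor>"])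
    have "t * real q \<le> 1 * real q" using t by (intro mult_right_mono) auto
    then show "\<lfloor>t * real q\<rfloor> \<in> {0..int q}" using t by (simp add: floor_le_iff)
    have "real_of_int \<lfloor>t * real q\<rfloor> \<le> t * real q" "t * real q \<le> real_of_int \<lfloor>t * real q\<rfloor> + 1" by linarith+
    then show "real_of_int \<lfloor>t * real q\<rfloor> / real q \<le> t \<and> t - real_of_int \<lfloor>t * real q\<rfloor> / real q \<le> 1 / real q"
      using assms(2) by (simp add: le_divide_eq divide_le_eq left_diff_distrib add.commute)
  qed
  show ?thesis
  proof (cases "0 \<le> t")
    case True
    then obtain a where "a \<in> {0..int q}" "real_of_int a / real q \<le> t" "t - real_of_int a / real q \<le> 1 / real q"
      using *[OF True] assms(1) by auto
    then show ?thesis using True by (intro bexI[of _ a]) auto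
  next
    case False
    then obtain a where "a \<in> {0..int q}" "real_of_int a / real q \<le> - t" "- t - real_of_int a / real q \<le> 1 / real q"
      using *[of "- t"] assms by auto
    then show ?thesis using False by (intro bexI[of _ "- a"]) auto
  qed
qed

definition grid :: "nat \<Rightarrow> complex set" where
  "grid q = (\<lambda>(a, b). Complex (real_of_int a / real q) (real_of_int b / real q)) ` ({- int q..int q} \<times> {- int q..int q})"

lemma finite_grid: "finite (grid q)"
  by (simp add: grid_def)

lemma card_grid: "card (grid q) \<le> (2 * q + 1)\<^sup>2"
proof -
  have "card (grid q) \<le> card ({- int q..int q} \<times> {- int q..int q})"
    unfolding grid_def by (rule card_image_le) simp
  also have "\<dots> = (2 * q + 1)\<^sup>2"
    by (simp add: card_cartesian_product power2_eq_square nat_add_distrib nat_mult_distrib)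
  finally show ?thesis .
qed

lemma complex_grid:
  assumes "norm z \<le> 1" "q \<ge> 1"
  shows "\<exists>w\<in>grid q. norm w \<le> norm z \<and> norm (z - w) \<le> 2 / real q"
proof -
  have "\<bar>Re z\<bar> \<le> 1" "\<bar>Im z\<bar> \<le> 1" using assms(1) abs_Re_le_cmod abs_Im_le_cmod order_trans by blast+
  then obtain a b where a: "a \<in> {- int q..int q}" "\<bar>real_of_int a / real q\<bar> \<le> \<bar>Re z\<bar>" "\<bar>Re z - real_of_int a / real q\<bar> \<le> 1 / real q"
    and b: "b \<in> {- int q..int q}" "\<bar>real_of_int b / real q\<bar> \<le> \<bar>Im z\<bar>" "\<bar>Im z - real_of_int b / real q\<bar> \<le> 1 / real q"
    using real_grid[OF _ assms(2)] by metis
  let ?w = "Complex (real_of_int a / real q) (real_of_int b / real q)"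
  have "?w \<in> grid q" unfolding grid_def using a(1) b(1) by auto
  moreover have "norm ?w \<le> norm z"
    unfolding cmod_def complex.sel using a(2) b(2) by (intro real_sqrt_le_mono add_mono iffD1[OF abs_le_square_iff])
  moreover have "norm (z - ?w) \<le> \<bar>Re (z - ?w)\<bar> + \<bar>Im (z - ?w)\<bar>" by (rule cmod_le)
  ultimately show ?thesis using a(3) b(3) by (intro bexI[of _ ?w]) auto
qed

text \<open>The grid of mesh $1/(m n^m)$ is so fine that the trivial Lipschitz bound suffices; the logarithm
of its cardinality is still $n$ up to powers of $\log n$ when $m$ is about $\log n$.\<close>

definition ksz_log :: "nat \<Rightarrow> nat \<Rightarrow> real" where
  "ksz_log n m = 2 + 2 * real n * (2 + ln (real m) + real m * ln (real n))"

text \<open>With L = \<open>ksz_log n m\<close>, the real and the imaginary part contribute 2 sqrt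
  (m! L) each on the net; the summand 2 covers the passage from the net to the ball.\<close>

definition ksz_bound :: "nat \<Rightarrow> nat \<Rightarrow> real" where
  "ksz_bound n m = sqrt (fact m) * (4 * sqrt (ksz_log n m) + 2)"

text \<open>The Kahane-Salem-Zygmund argument with the signs of \<open>ex_signs\<close>. Since
  multinom^2 \<le> m! multinom, the squares of the terms add up to at most m! (sum |w_k|^2)^m \<le>
  m! by the multinomial theorem: this is why the coefficients m!/\<alpha>! suit the Euclidean
  norm.\<close>

lemma ex_signed_polynomial:
  assumes n: "n \<ge> 1" and m: "m \<ge> 1"
  shows "\<exists>\<epsilon> :: (nat \<Rightarrow> nat) \<Rightarrow> real. (\<forall>\<alpha>. \<epsilon> \<alpha> = 1 \<or> \<epsilon> \<alpha> = -1) \<and>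
    (\<forall>z. (\<Sum>k<n. (norm (z k))\<^sup>2) \<le> 1 \<longrightarrow> norm (homp n m (\<lambda>\<alpha>. of_real (\<epsilon> \<alpha> * multinom n m \<alpha>)) z) \<le> ksz_bound n m)"
proof -
  define q where "q = m * n ^ m"
  have q: "q \<ge> 1" using n m by (simp add: q_def)
  define G where "G = {w \<in> PiE {..<n} (\<lambda>_. grid q). (\<Sum>k<n. (norm (w k))\<^sup>2) \<le> 1}"
  have finP: "finite (PiE {..<n} (\<lambda>_. grid q))" by (intro finite_PiE finite_grid) auto
  have finG: "finite G" unfolding G_def using finP by simp
  have "card G \<le> card (PiE {..<n} (\<lambda>_. grid q))" unfolding G_def using finP by (intro card_mono) auto
  also have "\<dots> = card (grid q) ^ n" by (simp add: card_PiE)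
  also have "\<dots> \<le> ((2 * q + 1)\<^sup>2) ^ n" by (intro power_mono card_grid) auto
  finally have cardG: "card G \<le> (2 * q + 1) ^ (2 * n)" by (simp add: power_mult)
  define L where "L = ksz_log n m"
  have lnm: "ln (real m) \<ge> 0" "ln (real n) \<ge> 0" using m n by auto
  have L: "L \<ge> 1" using lnm by (auto simp: L_def ksz_log_def intro!: add_nonneg_nonneg mult_nonneg_nonneg)
  have ln_le2: "ln 4 \<le> (2::real)" "ln 3 \<le> (2::real)"
    using ln_le_minus_one[of 2] ln_mult[of 2 2] ln_le_minus_one[of 3] by auto
  have "4 * real (card G) \<le> 4 * (3 * real q) ^ (2 * n)"
  proof -
    have "real (card G) \<le> real ((2 * q + 1) ^ (2 * n))" using cardG by (rule of_nat_mono)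
    also have "\<dots> \<le> (3 * real q) ^ (2 * n)" unfolding of_nat_power using q by (intro power_mono) auto
    finally show ?thesis by simp
  qed
  also have "\<dots> = exp (ln 4 + 2 * real n * (ln 3 + ln (real m) + real m * ln (real n)))"
  proof -
    have "ln (4 * (3 * real q) ^ (2 * n)) = ln 4 + 2 * real n * (ln 3 + ln (real m) + real m * ln (real n))"
      using q n m by (simp add: ln_mult ln_realpow q_def distrib_left)
    moreover have "4 * (3 * real q) ^ (2 * n) > 0" using q by simp
    ultimately show ?thesis by (metis exp_ln)
  qed
  also have "\<dots> \<le> exp L"
    unfolding L_def ksz_log_def using ln_le2 n by (intro iffD2[OF exp_le_cancel_iff] add_mono mult_left_mono) auto
  finally have cardL: "4 * real (card G) \<le> exp L" .
  \<comment> \<open>The scale at which the variance bound l^2 m! equals L, and exp L already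
    dominates the number 4 * card G of test conditions.\<close>
  define l where "l = sqrt L / sqrt (fact m)"
  have l: "l > 0" "l\<^sup>2 * fact m = L" using L by (auto simp: l_def power_divide)
  \<comment> \<open>The powers of the imaginary unit for s < 4 turn bounds on one real part into
    bounds on plus and minus the real and imaginary parts.\<close>
  define x where "x = (\<lambda>(w, s::nat) \<alpha>. l * Re (\<i> ^ s * (of_real (multinom n m \<alpha>) * mpow n w \<alpha>)))"
  have var: "(\<Sum>\<alpha>\<in>midx n m. (x (w, s) \<alpha>)\<^sup>2) \<le> L" if "w \<in> G" for w s
  proof -
    have "(\<Sum>\<alpha>\<in>midx n m. (x (w, s) \<alpha>)\<^sup>2) \<le> (\<Sum>\<alpha>\<in>midx n m. l\<^sup>2 * (fact m * (multinom n m \<alpha> * (\<Prod>k<n. ((norm (w k))\<^sup>2) ^ \<alpha> k))))"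
    proof (rule sum_mono)
      fix \<alpha>
      have "\<bar>Re (\<i> ^ s * (of_real (multinom n m \<alpha>) * mpow n w \<alpha>))\<bar> \<le> multinom n m \<alpha> * norm (mpow n w \<alpha>)"
        using abs_Re_le_cmod[of "\<i> ^ s * (of_real (multinom n m \<alpha>) * mpow n w \<alpha>)"] multinom_bounds(1)[of n m \<alpha>]
        by (simp add: norm_mult norm_power)
      then have "\<bar>Re (\<i> ^ s * (of_real (multinom n m \<alpha>) * mpow n w \<alpha>))\<bar>\<^sup>2 \<le> (multinom n m \<alpha> * norm (mpow n w \<alpha>))\<^sup>2"
        by (intro power_mono) auto
      also have "\<dots> = multinom n m \<alpha> * (multinom n m \<alpha> * (norm (mpow n w \<alpha>))\<^sup>2)"
        by (simp add: power2_eq_square)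
      also have "\<dots> \<le> fact m * (multinom n m \<alpha> * (norm (mpow n w \<alpha>))\<^sup>2)"
        using multinom_bounds[of n m \<alpha>] by (intro mult_right_mono mult_nonneg_nonneg) auto
      also have "(norm (mpow n w \<alpha>))\<^sup>2 = (\<Prod>k<n. ((norm (w k))\<^sup>2) ^ \<alpha> k)"
        by (simp add: norm_mpow prod_power_distrib power_mult[symmetric] mult.commute)
      finally show "(x (w, s) \<alpha>)\<^sup>2 \<le> l\<^sup>2 * (fact m * (multinom n m \<alpha> * (\<Prod>k<n. ((norm (w k))\<^sup>2) ^ \<alpha> k)))"
        by (simp add: x_def power_mult_distrib mult_left_mono)
    qed
    also have "\<dots> = L * (\<Sum>k<n. (norm (w k))\<^sup>2) ^ m"
      unfolding sum_distrib_left[symmetric] sum_multinom using l(2) by (simp add: mult.assoc[symmetric])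
    also have "\<dots> \<le> L * 1"
      using L that by (intro mult_left_mono power_le_one sum_nonneg) (auto simp: G_def)
    finally show ?thesis by simp
  qed
  obtain \<epsilon> :: "(nat \<Rightarrow> nat) \<Rightarrow> real" where \<epsilon>: "\<forall>\<alpha>. \<epsilon> \<alpha> = 1 \<or> \<epsilon> \<alpha> = -1" and
    sum\<epsilon>: "(\<Sum>i\<in>G \<times> {..<4}. 1 * exp (\<Sum>\<alpha>\<in>midx n m. \<epsilon> \<alpha> * x i \<alpha>)) \<le> (\<Sum>i\<in>G \<times> {..<4}. 1 * exp (\<Sum>\<alpha>\<in>midx n m. (x i \<alpha>)\<^sup>2))"
    using ex_signs[OF finite_midx[of n m], of "G \<times> {..<4}" "\<lambda>_. 1" x] by auto
  let ?P = "homp n m (\<lambda>\<alpha>. of_real (\<epsilon> \<alpha> * multinom n m \<alpha>))"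
  have dir: "Re (\<i> ^ s * ?P w) \<le> 2 * sqrt (fact m) * sqrt L" if w: "w \<in> G" and s: "s < 4" for w s
  proof -
    \<comment> \<open>A single exponential is at most the whole sum, hence at most 4 * card G * exp
      L \<le> exp (2 L).\<close>
    have "exp (\<Sum>\<alpha>\<in>midx n m. \<epsilon> \<alpha> * x (w, s) \<alpha>) \<le> (\<Sum>i\<in>G \<times> {..<4}. exp (\<Sum>\<alpha>\<in>midx n m. \<epsilon> \<alpha> * x i \<alpha>))"
      using w s finG by (intro member_le_sum[where f = "\<lambda>i. exp (\<Sum>\<alpha>\<in>midx n m. \<epsilon> \<alpha> * x i \<alpha>)"]) auto
    also have "\<dots> \<le> (\<Sum>i\<in>G \<times> {..<4::nat}. exp L)"
    proof (rule order_trans)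
      show "(\<Sum>i\<in>G \<times> {..<4}. exp (\<Sum>\<alpha>\<in>midx n m. \<epsilon> \<alpha> * x i \<alpha>)) \<le> (\<Sum>i\<in>G \<times> {..<4}. exp (\<Sum>\<alpha>\<in>midx n m. (x i \<alpha>)\<^sup>2))"
        using sum\<epsilon> by simp
      show "(\<Sum>i\<in>G \<times> {..<4}. exp (\<Sum>\<alpha>\<in>midx n m. (x i \<alpha>)\<^sup>2)) \<le> (\<Sum>i\<in>G \<times> {..<4::nat}. exp L)"
      proof (rule sum_mono)
        fix i assume "i \<in> G \<times> {..<4::nat}"
        then show "exp (\<Sum>\<alpha>\<in>midx n m. (x i \<alpha>)\<^sup>2) \<le> exp L"
          using var by (cases i) auto
      qed
    qed
    also have "\<dots> = 4 * real (card G) * exp L" by (simp add: card_cartesian_product)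
    also have "\<dots> \<le> exp L * exp L" using cardL by (intro mult_right_mono) auto
    finally have "exp (\<Sum>\<alpha>\<in>midx n m. \<epsilon> \<alpha> * x (w, s) \<alpha>) \<le> exp (L + L)" by (simp only: exp_add)
    then have "(\<Sum>\<alpha>\<in>midx n m. \<epsilon> \<alpha> * x (w, s) \<alpha>) \<le> 2 * L" by simp
    moreover have "(\<Sum>\<alpha>\<in>midx n m. \<epsilon> \<alpha> * x (w, s) \<alpha>) = l * Re (\<i> ^ s * ?P w)"
      unfolding homp_def sum_distrib_left Re_sum x_def prod.case
    proof (rule sum.cong[OF refl])
      fix \<alpha>
      have ReR: "Re (of_real r * v) = r * Re v" for r v by simp
      have eq: "\<i> ^ s * (of_real (\<epsilon> \<alpha> * multinom n m \<alpha>) * mpow n w \<alpha>) = of_real (\<epsilon> \<alpha>) * (\<i> ^ s * (of_real (multinom n m \<alpha>) * mpow n w \<alpha>))"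
        by (simp add: mult_ac)
      show "\<epsilon> \<alpha> * (l * Re (\<i> ^ s * (of_real (multinom n m \<alpha>) * mpow n w \<alpha>))) = l * Re (\<i> ^ s * (of_real (\<epsilon> \<alpha> * multinom n m \<alpha>) * mpow n w \<alpha>))"
        unfolding eq ReR by (rule mult.left_commute)
    qed
    ultimately have "l * Re (\<i> ^ s * ?P w) \<le> 2 * L" by simp
    moreover have "2 * L = l * (2 * sqrt (fact m) * sqrt L)"
      using L by (simp add: l_def field_simps)
    ultimately show ?thesis using l(1) by (simp only: mult_le_cancel_left_pos)
  qed
  have onG: "norm (?P w) \<le> sqrt (fact m) * (4 * sqrt L)" if "w \<in> G" for w
  proof -
    have "Re (?P w) \<le> 2 * sqrt (fact m) * sqrt L" "- Re (?P w) \<le> 2 * sqrt (fact m) * sqrt L"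
      "Im (?P w) \<le> 2 * sqrt (fact m) * sqrt L" "- Im (?P w) \<le> 2 * sqrt (fact m) * sqrt L"
      using dir[OF that, of 0] dir[OF that, of 2] dir[OF that, of 3] dir[OF that, of 1]
      by (simp_all add: numeral_3_eq_3 power_Suc)
    then have "\<bar>Re (?P w)\<bar> + \<bar>Im (?P w)\<bar> \<le> sqrt (fact m) * (4 * sqrt L)" by (simp add: abs_le_iff)
    then show ?thesis using cmod_le order_trans by blast
  qed
  have "norm (?P z) \<le> ksz_bound n m" if z: "(\<Sum>k<n. (norm (z k))\<^sup>2) \<le> 1" for z
  proof -
    have z1: "norm (z k) \<le> 1" if "k < n" for k
    proof -
      have "(norm (z k))\<^sup>2 \<le> (\<Sum>k<n. (norm (z k))\<^sup>2)" using that by (intro member_le_sum) auto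
      then have "(norm (z k))\<^sup>2 \<le> 1" using z by simp
      then show ?thesis by (simp add: abs_square_le_1)
    qed
    have "\<forall>k\<in>{..<n}. \<exists>w\<in>grid q. norm w \<le> norm (z k) \<and> norm (z k - w) \<le> 2 / real q"
      using complex_grid[OF z1 q] by blast
    then obtain w' where w': "\<forall>k\<in>{..<n}. w' k \<in> grid q \<and> norm (w' k) \<le> norm (z k) \<and> norm (z k - w' k) \<le> 2 / real q"
      using bchoice by (metis (no_types, lifting))
    define w where "w = restrict w' {..<n}"
    have w: "w k \<in> grid q" "norm (w k) \<le> norm (z k)" "norm (z k - w k) \<le> 2 / real q" if "k < n" for k
      using w' that by (auto simp: w_def)
    have "(\<Sum>k<n. (norm (w k))\<^sup>2) \<le> (\<Sum>k<n. (norm (z k))\<^sup>2)" using w by (intro sum_mono power_mono) auto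
    then have wG: "w \<in> G" using z w by (auto simp: G_def w_def)
    have "norm (?P z - ?P w) \<le> (\<Sum>\<alpha>\<in>midx n m. multinom n m \<alpha> * (real m * (2 / real q)))"
      unfolding homp_def sum_subtractf[symmetric]
    proof (rule sum_norm_le)
      fix \<alpha> assume a: "\<alpha> \<in> midx n m"
      have "norm (mpow n z \<alpha> - mpow n w \<alpha>) \<le> real m * (2 / real q)"
        using norm_mpow_diff[OF a z1 order_trans[OF w(2) z1] w(3)] by simp
      moreover have "\<bar>\<epsilon> \<alpha>\<bar> = 1" using \<epsilon> by (metis abs_1 abs_minus_cancel)
      ultimately show "norm (of_real (\<epsilon> \<alpha> * multinom n m \<alpha>) * mpow n z \<alpha> - of_real (\<epsilon> \<alpha> * multinom n m \<alpha>) * mpow n w \<alpha>)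
          \<le> multinom n m \<alpha> * (real m * (2 / real q))"
        using multinom_bounds(1)[of n m \<alpha>]
        unfolding right_diff_distrib[symmetric] norm_mult norm_of_real abs_mult
        by (simp add: mult_left_mono del: times_divide_eq_right)
    qed
    also have "\<dots> = real n ^ m * (real m * (2 / real q))"
      unfolding sum_distrib_right[symmetric] using sum_multinom[of n m "\<lambda>_. 1"] by simp
    also have "\<dots> = 2" using n m by (simp add: q_def)
    finally have "norm (?P z) \<le> norm (?P w) + 2"
      using norm_triangle_ineq2[of "?P z" "?P w"] by linarith
    also have "\<dots> \<le> sqrt (fact m) * (4 * sqrt L) + sqrt (fact m) * 2"
      using onG[OF wG] fact_ge_1[where 'a = real, of m] real_sqrt_ge_1_iff[of "fact m"] by (intro add_mono) auto
    finally show ?thesis by (simp add: ksz_bound_def L_def distrib_left)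
  qed
  then show ?thesis using \<epsilon> by blast
qed

section \<open>Polynomials as test functions\<close>

lemma norm_homp_le:
  assumes "\<And>k. k < n \<Longrightarrow> norm (h k) \<le> s"
  shows "norm (homp n m c h) \<le> (\<Sum>\<alpha>\<in>midx n m. norm (c \<alpha>)) * s ^ m"
  unfolding homp_def sum_distrib_right
proof (rule sum_norm_le)
  fix \<alpha> assume "\<alpha> \<in> midx n m"
  have "norm (mpow n h \<alpha>) \<le> (\<Prod>k<n. s ^ \<alpha> k)"
    unfolding norm_mpow using assms by (intro prod_mono) (auto intro: power_mono)
  also have "\<dots> = s ^ m" using \<open>\<alpha> \<in> midx n m\<close> by (simp add: power_sum[symmetric] midx_def)
  finally show "norm (c \<alpha> * mpow n h \<alpha>) \<le> norm (c \<alpha>) * s ^ m"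
    unfolding norm_mult by (rule mult_left_mono) simp
qed

lemma norm_le_sup_norm_n: "k < n \<Longrightarrow> norm (h k) \<le> sup_norm_n n h"
  unfolding sup_norm_n_def by (rule Max_ge) auto

lemma sup_norm_n_nonneg: "0 \<le> sup_norm_n n h"
  unfolding sup_norm_n_def by (rule Max_ge) auto

text \<open>In \<open>homp_add\<close> the parts of degree 0 and 1 are the value and the
  differential; the rest is quadratic in increments of sup norm at most 1.\<close>

lemma holomorphic_n_homp:
  assumes "m \<ge> 1"
  shows "holomorphic_n n (homp n m c) U"
  unfolding holomorphic_n_def
proof (intro ballI)
  fix z :: "nat \<Rightarrow> complex"
  let ?b = "\<lambda>k \<gamma>. homp n (m - k) (taylor_coeff n c \<gamma>) z"
  define C where "C = (\<Sum>k=2..m. \<Sum>\<gamma>\<in>midx n k. norm (?b k \<gamma>))"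
  have C: "C \<ge> 0" unfolding C_def by (intro sum_nonneg) auto
  have split: "homp n m c (\<lambda>k. z k + h k) - homp n m c z - (\<Sum>k<n. ?b 1 (unit_idx k) * h k) = (\<Sum>k=2..m. homp n k (?b k) h)" for h
  proof -
    have "homp n m c (\<lambda>k. z k + h k) = (\<Sum>k\<le>m. homp n k (?b k) h)"
      using homp_add[of n m c h z] by (simp add: add.commute)
    also have "{..m} = insert 0 (insert 1 {2..m})" using assms by auto
    also have "(\<Sum>k\<in>insert 0 (insert 1 {2..m}). homp n k (?b k) h) = homp n 0 (?b 0) h + (homp n 1 (?b 1) h + (\<Sum>k=2..m. homp n k (?b k) h))"
      by simp
    also have "homp n 0 (?b 0) h = homp n m c z"
      by (simp add: homp_def[of n 0] midx_0 mpow_def[of n h]) (simp add: taylor_coeff_def homp_def)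
    finally show ?thesis unfolding homp_1 by simp
  qed
  have rem: "norm (\<Sum>k=2..m. homp n k (?b k) h) \<le> C * (sup_norm_n n h)\<^sup>2" if "sup_norm_n n h \<le> 1" for h
    unfolding C_def sum_distrib_right[of _ "{2..m}"]
  proof (rule sum_norm_le)
    fix k assume k: "k \<in> {2..m}"
    have "norm (homp n k (?b k) h) \<le> (\<Sum>\<gamma>\<in>midx n k. norm (?b k \<gamma>)) * sup_norm_n n h ^ k"
      by (rule norm_homp_le) (rule norm_le_sup_norm_n)
    also have "\<dots> \<le> (\<Sum>\<gamma>\<in>midx n k. norm (?b k \<gamma>)) * (sup_norm_n n h)\<^sup>2"
      using k that sup_norm_n_nonneg[of n h] by (intro mult_left_mono power_decreasing sum_nonneg) auto
    finally show "norm (homp n k (?b k) h) \<le> (\<Sum>\<gamma>\<in>midx n k. norm (?b k \<gamma>)) * (sup_norm_n n h)\<^sup>2" .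
  qed
  show "\<exists>c'. \<forall>e>0. \<exists>d>0. \<forall>h\<in>Cn n. sup_norm_n n h < d \<longrightarrow>
      norm (homp n m c (\<lambda>k. z k + h k) - homp n m c z - (\<Sum>k<n. c' k * h k)) \<le> e * sup_norm_n n h"
  proof (intro exI[of _ "\<lambda>k. ?b 1 (unit_idx k)"] allI impI)
    fix e :: real assume e: "0 < e"
    define d where "d = min 1 (e / (C + 1))"
    have d: "d > 0" "d \<le> 1" "C * d \<le> e"
    proof -
      show "d > 0" "d \<le> 1" using e C by (auto simp: d_def)
      have "C * d \<le> C * (e / (C + 1))" using C by (intro mult_left_mono) (auto simp: d_def)
      also have "\<dots> \<le> e" using C e by (simp add: divide_le_eq algebra_simps)
      finally show "C * d \<le> e" .
    qed
    show "\<exists>d>0. \<forall>h\<in>Cn n. sup_norm_n n h < d \<longrightarrow>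
      norm (homp n m c (\<lambda>k. z k + h k) - homp n m c z - (\<Sum>k<n. ?b 1 (unit_idx k) * h k)) \<le> e * sup_norm_n n h"
    proof (intro exI[of _ d] conjI ballI impI d)
      fix h assume h: "sup_norm_n n h < d"
      have "norm (\<Sum>k=2..m. homp n k (?b k) h) \<le> C * (sup_norm_n n h)\<^sup>2" using h d by (intro rem) simp
      also have "\<dots> = C * sup_norm_n n h * sup_norm_n n h" by (simp add: power2_eq_square)
      also have "\<dots> \<le> e * sup_norm_n n h"
      proof (intro mult_right_mono sup_norm_n_nonneg)
        have "C * sup_norm_n n h \<le> C * d" using C h by (intro mult_left_mono) auto
        then show "C * sup_norm_n n h \<le> e" using d by simp
      qed
      finally show "norm (homp n m c (\<lambda>k. z k + h k) - homp n m c z - (\<Sum>k<n. ?b 1 (unit_idx k) * h k)) \<le> e * sup_norm_n n h"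
        unfolding split .
    qed
  qed
qed

section \<open>Taylor coefficients of polynomials\<close>

text \<open>Sums of products of one-variable entire functions are closed under partial derivatives,
  so iterated derivatives of monomials can be tracked factor by factor, without distinguishing
  exhausted exponents.\<close>

lemma pdiff_prod_form:
  assumes "finite A" "k < n" and hol: "\<And>a. \<phi> a k holomorphic_on UNIV"
  shows "pdiff k (\<lambda>z. \<Sum>a\<in>A. c a * (\<Prod>i<n. \<phi> a i (z i))) =
    (\<lambda>z. \<Sum>a\<in>A. c a * (\<Prod>i<n. (if i = k then deriv (\<phi> a k) else \<phi> a i) (z i)))"
proof
  fix z
  have split: "(\<Prod>i<n. \<psi> i) = \<psi> k * (\<Prod>i\<in>{..<n} - {k}. \<psi> i)" for \<psi> :: "nat \<Rightarrow> complex"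
    using assms(2) by (simp add: prod.remove)
  let ?r = "\<lambda>a. \<Prod>i\<in>{..<n} - {k}. \<phi> a i (z i)"
  have "((\<lambda>w. \<Sum>a\<in>A. c a * (\<phi> a k w * ?r a)) has_field_derivative (\<Sum>a\<in>A. c a * (deriv (\<phi> a k) (z k) * ?r a))) (at (z k))"
  proof (intro DERIV_sum DERIV_cmult DERIV_cmult_right)
    fix a
    show "(\<phi> a k has_field_derivative deriv (\<phi> a k) (z k)) (at (z k))"
      using hol[of a] by (simp add: holomorphic_derivI)
  qed
  moreover have "(\<lambda>w. \<Sum>a\<in>A. c a * (\<Prod>i<n. \<phi> a i ((z(k := w)) i))) = (\<lambda>w. \<Sum>a\<in>A. c a * (\<phi> a k w * ?r a))"
    unfolding split by (intro ext sum.cong refl) simp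
  ultimately have "pdiff k (\<lambda>z. \<Sum>a\<in>A. c a * (\<Prod>i<n. \<phi> a i (z i))) z = (\<Sum>a\<in>A. c a * (deriv (\<phi> a k) (z k) * ?r a))"
    unfolding pdiff_def using DERIV_imp_deriv by simp
  also have "\<dots> = (\<Sum>a\<in>A. c a * (\<Prod>i<n. (if i = k then deriv (\<phi> a k) else \<phi> a i) (z i)))"
    unfolding split by (intro sum.cong refl) simp
  finally show "pdiff k (\<lambda>z. \<Sum>a\<in>A. c a * (\<Prod>i<n. \<phi> a i (z i))) z = (\<Sum>a\<in>A. c a * (\<Prod>i<n. (if i = k then deriv (\<phi> a k) else \<phi> a i) (z i)))" .
qed

lemma pdiff_funpow_prod_form:
  assumes "finite A" "k < n" and hol: "\<And>a. \<phi> a k holomorphic_on UNIV"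
  shows "(pdiff k ^^ j) (\<lambda>z. \<Sum>a\<in>A. c a * (\<Prod>i<n. \<phi> a i (z i))) =
    (\<lambda>z. \<Sum>a\<in>A. c a * (\<Prod>i<n. (if i = k then (deriv ^^ j) (\<phi> a k) else \<phi> a i) (z i)))"
proof (induction j)
  case 0
  have "(if i = k then (deriv ^^ 0) (\<phi> a k) else \<phi> a i) = \<phi> a i" for a i by simp
  then show ?case by (simp only:) simp
next
  case (Suc j)
  let ?\<psi> = "\<lambda>a i. if i = k then (deriv ^^ j) (\<phi> a k) else \<phi> a i"
  have "(pdiff k ^^ Suc j) (\<lambda>z. \<Sum>a\<in>A. c a * (\<Prod>i<n. \<phi> a i (z i))) = pdiff k (\<lambda>z. \<Sum>a\<in>A. c a * (\<Prod>i<n. ?\<psi> a i (z i)))"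
    by (simp only: funpow.simps comp_def Suc)
  also have "\<dots> = (\<lambda>z. \<Sum>a\<in>A. c a * (\<Prod>i<n. (if i = k then deriv (?\<psi> a k) else ?\<psi> a i) (z i)))"
    by (rule pdiff_prod_form[OF assms(1,2)]) (use hol in \<open>auto intro: holomorphic_higher_deriv\<close>)
  also have "\<dots> = (\<lambda>z. \<Sum>a\<in>A. c a * (\<Prod>i<n. (if i = k then (deriv ^^ Suc j) (\<phi> a k) else \<phi> a i) (z i)))"
    by (intro ext sum.cong prod.cong arg_cong2[where f = "(*)"] refl) simp
  finally show ?case .
qed

lemma foldr_pdiff_prod_form:
  assumes "finite A" and hol: "\<And>a i. \<phi> a i holomorphic_on UNIV" and ks: "distinct ks" "set ks \<subseteq> {..<n}"
  shows "foldr (\<lambda>k g. (pdiff k ^^ \<alpha> k) g) ks (\<lambda>z. \<Sum>a\<in>A. c a * (\<Prod>i<n. \<phi> a i (z i))) =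
    (\<lambda>z. \<Sum>a\<in>A. c a * (\<Prod>i<n. (if i \<in> set ks then (deriv ^^ \<alpha> i) (\<phi> a i) else \<phi> a i) (z i)))"
  using ks
proof (induction ks)
  case Nil
  then show ?case by simp
next
  case (Cons k ks)
  let ?\<psi> = "\<lambda>a i. if i \<in> set ks then (deriv ^^ \<alpha> i) (\<phi> a i) else \<phi> a i"
  have "foldr (\<lambda>k g. (pdiff k ^^ \<alpha> k) g) (k # ks) (\<lambda>z. \<Sum>a\<in>A. c a * (\<Prod>i<n. \<phi> a i (z i)))
     = (pdiff k ^^ \<alpha> k) (\<lambda>z. \<Sum>a\<in>A. c a * (\<Prod>i<n. ?\<psi> a i (z i)))"
    using Cons by simp
  also have "\<dots> = (\<lambda>z. \<Sum>a\<in>A. c a * (\<Prod>i<n. (if i = k then (deriv ^^ \<alpha> k) (?\<psi> a k) else ?\<psi> a i) (z i)))"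
    by (rule pdiff_funpow_prod_form[OF assms(1)]) (use Cons.prems hol in auto)
  also have "\<dots> = (\<lambda>z. \<Sum>a\<in>A. c a * (\<Prod>i<n. (if i \<in> set (k # ks) then (deriv ^^ \<alpha> i) (\<phi> a i) else \<phi> a i) (z i)))"
    using Cons.prems by (intro ext sum.cong prod.cong arg_cong2[where f = "(*)"] refl) auto
  finally show ?case .
qed

lemma higher_deriv_power_0: "(deriv ^^ j) (\<lambda>w. w ^ i) (0::complex) = (if i = j then fact j else 0)"
proof -
  have "(deriv ^^ j) (\<lambda>w. w ^ i) (0::complex) = pochhammer (of_nat (Suc i - j)) j * 0 ^ (i - j)"
    using higher_deriv_power[of j 0 i 0] by simp
  also have "\<dots> = (if i = j then fact j else 0)"
  proof (cases i j rule: linorder_cases)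
    case less
    \<comment> \<open>Truncated subtraction: the argument of \<open>pochhammer\<close> becomes 0,
      and with j > 0 factors its value is 0.\<close>
    then have "Suc i - j = 0" "j \<noteq> 0" by auto
    then show ?thesis using less by (simp add: pochhammer_0_left)
  qed (auto simp: pochhammer_fact)
  finally show ?thesis .
qed

lemma tcoeff_homp:
  assumes "\<alpha> \<in> midx n m"
  shows "tcoeff n (homp n m c) \<alpha> = c \<alpha>"
proof -
  have "homp n m c = (\<lambda>z. \<Sum>\<beta>\<in>midx n m. c \<beta> * (\<Prod>i<n. (\<lambda>w. w ^ \<beta> i) (z i)))"
    by (simp add: homp_def mpow_def fun_eq_iff)
  then have "pdiff_multi n \<alpha> (homp n m c) (\<lambda>k. 0) =
      (\<Sum>\<beta>\<in>midx n m. c \<beta> * (\<Prod>i<n. (if i \<in> set [0..<n] then (deriv ^^ \<alpha> i) (\<lambda>w. w ^ \<beta> i) else (\<lambda>w. w ^ \<beta> i)) 0))"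
    unfolding pdiff_multi_def
    using foldr_pdiff_prod_form[of "midx n m" "\<lambda>\<beta> i w. w ^ \<beta> i" "[0..<n]" n \<alpha> c]
    by (simp add: holomorphic_on_power atLeast0LessThan)
  also have "\<dots> = (\<Sum>\<beta>\<in>midx n m. c \<beta> * (\<Prod>i<n. if \<beta> i = \<alpha> i then fact (\<alpha> i) else 0))"
    by (intro sum.cong prod.cong arg_cong2[where f = "(*)"] refl) (auto simp: higher_deriv_power_0)
  also have "\<dots> = (\<Sum>\<beta>\<in>midx n m. if \<beta> = \<alpha> then c \<alpha> * mfact n \<alpha> else 0)"
  proof (rule sum.cong[OF refl])
    fix \<beta> assume \<beta>: "\<beta> \<in> midx n m"
    show "c \<beta> * (\<Prod>i<n. if \<beta> i = \<alpha> i then fact (\<alpha> i) else 0) = (if \<beta> = \<alpha> then c \<alpha> * mfact n \<alpha> else 0)"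
    proof (cases "\<beta> = \<alpha>")
      case False
      then obtain i where i: "\<beta> i \<noteq> \<alpha> i" by auto
      then have "i < n" using \<beta> assms by (auto simp: midx_def multi_indices_def) (metis not_le)
      then have "(\<Prod>i<n. if \<beta> i = \<alpha> i then fact (\<alpha> i) else (0::complex)) = 0"
        using i by (intro prod_zero) auto
      then show ?thesis using False by simp
    qed (simp add: mfact_def)
  qed
  also have "\<dots> = c \<alpha> * mfact n \<alpha>" using assms by simp
  finally have "pdiff_multi n \<alpha> (homp n m c) (\<lambda>k. 0) = c \<alpha> * mfact n \<alpha>" .
  moreover have "mfact n \<alpha> \<noteq> 0" by (simp add: mfact_def)
  ultimately show ?thesis by (simp add: tcoeff_def)
qed

section \<open>The upper bound\<close>

lemma lp_norm_1: "lp_norm 1 n z = (\<Sum>k<n. norm (z k))"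
  by (simp add: lp_norm_def sum_nonneg)

lemma lp_norm_2: "lp_norm 2 n z = sqrt (\<Sum>k<n. (norm (z k))\<^sup>2)"
  by (simp add: lp_norm_def powr_half_sqrt sum_nonneg)

context seq_lattice
begin

text \<open>\<open>id_Xn_lp_norm\<close> is a supremum of reals, so boundedness must be shown before
  it bounds anything; it follows from the coordinate bounds 1 / N
  (\<open>unit_seq k\<close>).\<close>

lemma lp_norm_le_id:
  assumes "p = 1 \<or> p = 2" "z \<in> Cn n" "Xn_norm N n z \<le> 1"
  shows "lp_norm p n z \<le> id_Xn_lp_norm N n p"
  unfolding id_Xn_lp_norm_def
proof (rule cSUP_upper)
  show "z \<in> {z \<in> Cn n. Xn_norm N n z \<le> 1}" using assms by simp
  let ?b = "\<lambda>k. 1 / N (unit_seq k)"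
  show "bdd_above (lp_norm p n ` {z \<in> Cn n. Xn_norm N n z \<le> 1})"
  proof (rule bdd_aboveI2)
    fix w assume "w \<in> {z \<in> Cn n. Xn_norm N n z \<le> 1}"
    then have w: "norm (w k) \<le> ?b k" if "k < n" for k using coord_bound[of n w k] that by simp
    show "lp_norm p n w \<le> max (\<Sum>k<n. ?b k) (sqrt (\<Sum>k<n. (?b k)\<^sup>2))"
      using assms(1)
    proof
      assume "p = 1"
      show ?thesis unfolding \<open>p = 1\<close> lp_norm_1 using w by (intro max.coboundedI1 sum_mono) auto
    next
      assume "p = 2"
      show ?thesis unfolding \<open>p = 2\<close> lp_norm_2 using w
        by (intro max.coboundedI2 real_sqrt_le_mono sum_mono power_mono) auto
    qed
  qed
qed

lemma id_norm_pos:
  assumes "p = 1 \<or> p = 2" "n \<ge> 1"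
  shows "0 < id_Xn_lp_norm N n p"
proof -
  define z where "z = (\<lambda>k. of_real (1 / N (unit_seq 0)) * unit_seq 0 k)"
  have z: "z \<in> Cn n" using assms(2) by (auto simp: z_def unit_seq_def Cn_def)
  have u: "Xn_norm N n (unit_seq 0) = N (unit_seq 0)"
  proof -
    have "(\<lambda>k. if k < n then complex_of_real (norm (unit_seq 0 k)) else 0) = unit_seq 0"
      using assms(2) by (auto simp: unit_seq_def fun_eq_iff)
    then show ?thesis by (simp add: Xn_norm_def)
  qed
  have "Xn_norm N n z = norm (complex_of_real (1 / N (unit_seq 0))) * N (unit_seq 0)"
    unfolding z_def Xn_norm_scale u ..
  also have "\<dots> = 1" unfolding norm_of_real using N_unit_pos[of 0] by simp
  finally have z1: "Xn_norm N n z \<le> 1" by simp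
  have z0: "norm (z 0) > 0" using N_unit_pos[of 0] by (simp add: z_def unit_seq_def)
  have "0 < lp_norm p n z"
    using assms(1)
  proof
    assume "p = 1"
    moreover have "norm (z 0) \<le> (\<Sum>k<n. norm (z k))" using assms(2) by (intro member_le_sum) auto
    ultimately show ?thesis using z0 by (simp only: lp_norm_1)
  next
    assume "p = 2"
    moreover have "(norm (z 0))\<^sup>2 \<le> (\<Sum>k<n. (norm (z k))\<^sup>2)"
      using assms(2) by (intro member_le_sum[where f = "\<lambda>k. (norm (z k))\<^sup>2"]) auto
    moreover have "(norm (z 0))\<^sup>2 > 0" using z0 by simp
    ultimately have "(\<Sum>k<n. (norm (z k))\<^sup>2) > 0" by linarith
    with \<open>p = 2\<close> show ?thesis by (simp only: lp_norm_2 real_sqrt_gt_0_iff)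
  qed
  then show ?thesis using lp_norm_le_id[OF assms(1) z z1] by simp
qed

text \<open>For the polynomial P of \<open>ex_signed_polynomial\<close>, homogeneity gives |P| \<le>
  i2^m V on the unit ball, while the moduli of its monomials at z add up to the m-th power of the l1
  norm. Letting z fill the ball of radius r yields r i1 \<le> i2 V^(1/m).\<close>

lemma bohr_set_le:
  assumes n: "n \<ge> 1" and m: "m \<ge> 1" and r: "r \<in> bohr_set N n"
    and ratio: "id_Xn_lp_norm N n 2 / id_Xn_lp_norm N n 1 \<le> 1 / sqrt (real n)"
  shows "r \<le> root m (ksz_bound n m) / sqrt (real n)"
proof -
  define i1 where "i1 = id_Xn_lp_norm N n 1"
  define i2 where "i2 = id_Xn_lp_norm N n 2"
  define V where "V = ksz_bound n m"
  have i: "i1 > 0" "i2 > 0" using id_norm_pos n by (auto simp: i1_def i2_def)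
  obtain \<epsilon> :: "(nat \<Rightarrow> nat) \<Rightarrow> real" where \<epsilon>: "\<forall>\<alpha>. \<epsilon> \<alpha> = 1 \<or> \<epsilon> \<alpha> = -1"
    and P: "\<forall>z. (\<Sum>k<n. (norm (z k))\<^sup>2) \<le> 1 \<longrightarrow> norm (homp n m (\<lambda>\<alpha>. of_real (\<epsilon> \<alpha> * multinom n m \<alpha>)) z) \<le> V"
    using ex_signed_polynomial[OF n m] unfolding V_def by blast
  let ?P = "homp n m (\<lambda>\<alpha>. of_real (\<epsilon> \<alpha> * multinom n m \<alpha>))"
  have V: "V \<ge> 0" using P[rule_format, of "\<lambda>_. 0"] by (auto intro: order_trans[OF norm_ge_zero])
  have Pz: "norm (?P z) \<le> i2 ^ m * V" if z: "z \<in> Cn n" "Xn_norm N n z \<le> 1" for z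
  proof -
    have "sqrt (\<Sum>k<n. (norm (z k))\<^sup>2) \<le> i2"
      using lp_norm_le_id[of 2, OF _ z] by (simp add: i2_def lp_norm_2)
    then have sq: "(\<Sum>k<n. (norm (z k))\<^sup>2) \<le> i2\<^sup>2"
      by (rule sqrt_le_D)
    have ni: "norm (complex_of_real (1 / i2)) = 1 / i2" unfolding norm_of_real using i by simp
    have "(\<Sum>k<n. (norm (of_real (1 / i2) * z k))\<^sup>2) = (\<Sum>k<n. (norm (z k))\<^sup>2) / i2\<^sup>2"
      unfolding norm_mult ni by (simp add: power_divide sum_divide_distrib)
    also have "\<dots> \<le> 1" using sq i by simp
    finally have "norm (?P (\<lambda>k. of_real (1 / i2) * z k)) \<le> V" by (rule P[rule_format])
    moreover have "norm (?P (\<lambda>k. of_real (1 / i2) * z k)) = norm (?P z) / i2 ^ m"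
      unfolding homp_cmult norm_mult norm_power ni by (simp add: power_divide)
    ultimately show ?thesis using i by (simp add: divide_le_eq mult.commute)
  qed
  have ballD: "z \<in> Cn n \<and> Xn_norm N n z \<le> 1" if "z \<in> Xn_ball N n 1" for z
    using that by (simp add: Xn_ball_def)
  have "bounded (?P ` Xn_ball N n 1)"
    unfolding bounded_iff using Pz ballD by (intro exI[of _ "i2 ^ m * V"]) auto
  moreover have "holomorphic_n n ?P (Xn_ball N n 1)" using m by (rule holomorphic_n_homp)
  ultimately have bohr: "(\<Sum>\<^sub>\<infinity>\<alpha>\<in>multi_indices n. ennreal (norm (tcoeff n ?P \<alpha> * mpow n z \<alpha>)))
       \<le> ennreal (SUP w \<in> Xn_ball N n 1. norm (?P w))" if "z \<in> Xn_ball N n r" for z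
    using r that unfolding bohr_set_def tcoeff_def by blast
  have "(\<lambda>k. 0) \<in> Xn_ball N n 1"
    using Xn_norm_scale[of n 0 "\<lambda>_. 0"] by (simp add: Xn_ball_def Cn_def)
  then have sup: "(SUP w \<in> Xn_ball N n 1. norm (?P w)) \<le> i2 ^ m * V"
    using Pz ballD by (intro cSUP_least) auto
  have l1: "(\<Sum>k<n. norm (z k)) ^ m \<le> i2 ^ m * V" if z: "z \<in> Xn_ball N n r" for z
  proof -
    have "(\<Sum>k<n. norm (z k)) ^ m = (\<Sum>\<alpha>\<in>midx n m. norm (tcoeff n ?P \<alpha> * mpow n z \<alpha>))"
      unfolding sum_multinom[symmetric]
    proof (rule sum.cong[OF refl])
      fix \<alpha> assume a: "\<alpha> \<in> midx n m"
      have "\<bar>\<epsilon> \<alpha>\<bar> = 1" using \<epsilon>[rule_format, of \<alpha>] by auto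
      then show "multinom n m \<alpha> * (\<Prod>k<n. norm (z k) ^ \<alpha> k) = norm (tcoeff n ?P \<alpha> * mpow n z \<alpha>)"
        using multinom_bounds(1)[of n m \<alpha>]
        unfolding tcoeff_homp[OF a] norm_mult norm_mpow norm_of_real abs_mult by simp
    qed
    also have "ennreal \<dots> = (\<Sum>\<alpha>\<in>midx n m. ennreal (norm (tcoeff n ?P \<alpha> * mpow n z \<alpha>)))"
      by (rule sum_ennreal[symmetric]) simp
    also have "\<dots> \<le> (\<Sum>\<^sub>\<infinity>\<alpha>\<in>multi_indices n. ennreal (norm (tcoeff n ?P \<alpha> * mpow n z \<alpha>)))"
    proof -
      have "midx n m \<subseteq> multi_indices n" by (auto simp: midx_def)
      then show ?thesis by (subst nonneg_infsum_complete) (auto intro!: SUP_upper)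
    qed
    also have "\<dots> \<le> ennreal (i2 ^ m * V)"
      using bohr[OF z] sup by (meson ennreal_leI order_trans)
    finally show ?thesis using i V by (simp add: ennreal_le_iff)
  qed
  \<comment> \<open>i1 is a supremum over the closed unit ball, whereas the Bohr condition concerns
    the open ball of radius r; scaling by s < r fits one into the other.\<close>
  have "s \<le> root m V / sqrt (real n)" if s: "s < r" for s
  proof (cases "0 < s")
    case False
    have "0 \<le> root m V / sqrt (real n)" using V by (simp add: real_root_ge_zero)
    then show ?thesis using False by simp
  next
    case True
    have "s * lp_norm 1 n z \<le> i2 * root m V" if z: "z \<in> {z \<in> Cn n. Xn_norm N n z \<le> 1}" for z
    proof -
      have ns: "norm (complex_of_real s) = s" unfolding norm_of_real using True by simp
      have "s * Xn_norm N n z \<le> s * 1" using z True by (intro mult_left_mono) auto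
      then have "s * Xn_norm N n z < r" using s by linarith
      then have "(\<lambda>k. of_real s * z k) \<in> Xn_ball N n r"
        using z True by (simp add: Xn_ball_def Xn_norm_scale Cn_def)
      then have "(\<Sum>k<n. norm (of_real s * z k)) ^ m \<le> i2 ^ m * V" by (rule l1)
      also have "(\<Sum>k<n. norm (of_real s * z k)) = s * lp_norm 1 n z"
        unfolding norm_mult ns lp_norm_1 sum_distrib_left ..
      also have "i2 ^ m * V = (i2 * root m V) ^ m"
        using m V by (simp add: power_mult_distrib)
      finally show ?thesis
        using i V m by (rule_tac power_le_imp_le_base[where n = "m - 1"]) auto
    qed
    then have "lp_norm 1 n z \<le> i2 * root m V / s" if "z \<in> {z \<in> Cn n. Xn_norm N n z \<le> 1}" for z
      using that True by (simp add: le_divide_eq mult.commute)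
    moreover have "(\<lambda>k. 0) \<in> {z \<in> Cn n. Xn_norm N n z \<le> 1}"
      using Xn_norm_scale[of n 0 "\<lambda>_. 0"] by (simp add: Cn_def)
    ultimately have "i1 \<le> i2 * root m V / s"
      unfolding i1_def id_Xn_lp_norm_def by (intro cSUP_least) auto
    then have "s \<le> (i2 / i1) * root m V" using True i by (simp add: field_simps)
    also have "\<dots> \<le> (1 / sqrt (real n)) * root m V"
      using ratio V by (intro mult_right_mono) (auto simp: i1_def i2_def real_root_ge_zero)
    finally show ?thesis by simp
  qed
  then show ?thesis unfolding V_def by (rule dense_le)
qed

end

section \<open>Asymptotics of the upper bound\<close>

text \<open>Stirling in the form m! \<le> e m (m/e)^m, by induction from ln x \<le> x - 1. The term
  - m must not be lost: half of it later cancels the logarithm of sqrt n.\<close>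

lemma ln_fact_le: "m \<ge> 1 \<Longrightarrow> ln (fact m) \<le> 1 + ln (real m) + real m * ln (real m) - real m"
proof (induction m rule: nat_induct_at_least)
  case (Suc m)
  have "ln (real m / real (Suc m)) \<le> real m / real (Suc m) - 1"
    using Suc by (intro ln_le_minus_one) auto
  also have "\<dots> = - 1 / real (Suc m)" by (simp add: field_simps)
  finally have "ln (real m) - ln (real (Suc m)) \<le> - 1 / real (Suc m)"
    using Suc by (simp add: ln_div del: of_nat_Suc)
  then have "real (Suc m) * (ln (real m) - ln (real (Suc m))) \<le> real (Suc m) * (- 1 / real (Suc m))"
    by (rule mult_left_mono) simp
  also have "\<dots> = - 1" by (simp del: of_nat_Suc)
  finally have "real (Suc m) * ln (real m) - real (Suc m) * ln (real (Suc m)) \<le> - 1"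
    by (simp only: right_diff_distrib)
  moreover have "ln (fact (Suc m)) = ln (real (Suc m)) + ln (fact m)"
    by (simp add: ln_mult del: of_nat_Suc)
  moreover have "real (Suc m) * ln (real m) = real m * ln (real m) + ln (real m)"
    by (simp add: algebra_simps)
  ultimately show ?case using Suc.IH by simp
qed simp

text \<open>A majorant of the m-th root in terms of x = log n, free of the ceiling in m. The first
  summand of the exponent gives sqrt (x + 1), the others tend to 0.\<close>

definition ksz_rate :: "real \<Rightarrow> real" where
  "ksz_rate x = exp (ln (x + 1) / 2 + (1 + ln (x + 1)) / (2 * x) + (ln 20 + ln (1 + x)) / x)"

text \<open>Half of Stirling's - m cancels x / 2 = ln (sqrt n), since x \<le> m. Besides m ln (x +
  1) / 2, only terms of order log x are left, and they are divided by m \<ge> x.\<close>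

lemma root_ksz_bound_le:
  assumes n: "n \<ge> 3" and m: "m = nat \<lceil>ln (real n)\<rceil>"
  shows "m \<ge> 1" "root m (ksz_bound n m) \<le> ksz_rate (ln (real n))"
proof -
  define x where "x = ln (real n)"
  have "(3::real) \<le> real n" using n by simp
  then have "exp 1 \<le> real n" using exp_le by (rule order_trans[rotated])
  then have "ln (exp 1) \<le> x" unfolding x_def using n by (intro ln_mono) auto
  then have x1: "x \<ge> 1" by simp
  have mx: "x \<le> real m" "real m \<le> x + 1" using x1 unfolding m x_def[symmetric] by linarith+
  show m1: "m \<ge> 1" using mx x1 by linarith
  have lnm: "0 \<le> ln (real m)" "ln (real m) \<le> x" "ln (real m) \<le> ln (x + 1)"
    using m1 mx x1 ln_le_minus_one[of "real m"] by auto
  have "ksz_log n m \<le> 2 + 2 * real n * (2 + x + (x + 1) * x)"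
    unfolding ksz_log_def x_def[symmetric] using lnm mx x1 by (intro add_left_mono mult_left_mono add_mono mult_right_mono) auto
  also have "\<dots> \<le> 2 * real n + 2 * real n * (2 + x + (x + 1) * x)" using n by simp
  also have "\<dots> = real n * (2 * (3 + 2 * x + x\<^sup>2))" by (simp add: algebra_simps power2_eq_square)
  also have "\<dots> \<le> real n * (3 * (1 + x))\<^sup>2"
    using x1 by (intro mult_left_mono) (auto simp: power2_eq_square algebra_simps)
  finally have "sqrt (ksz_log n m) \<le> sqrt (real n * (3 * (1 + x))\<^sup>2)" by simp
  also have "\<dots> = sqrt (real n) * (3 * (1 + x))" using x1 by (simp add: real_sqrt_mult)
  finally have "4 * sqrt (ksz_log n m) + 2 \<le> 12 * (sqrt (real n) * (1 + x)) + 2" by (simp add: algebra_simps)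
  also have "\<dots> \<le> 20 * (sqrt (real n) * (1 + x))"
  proof -
    have "1 * 1 \<le> sqrt (real n) * (1 + x)" using n x1 by (intro mult_mono) auto
    then show ?thesis by linarith
  qed
  finally have A: "4 * sqrt (ksz_log n m) + 2 \<le> 20 * (sqrt (real n) * (1 + x))" .
  have kl: "ksz_log n m \<ge> 0" unfolding ksz_log_def using lnm x1 n
    by (intro add_nonneg_nonneg mult_nonneg_nonneg) auto
  have pos: "ksz_bound n m > 0" using kl by (simp add: ksz_bound_def add_nonneg_pos)
  have "ln (ksz_bound n m) = ln (fact m) / 2 + ln (4 * sqrt (ksz_log n m) + 2)"
    unfolding ksz_bound_def using kl
    by (subst ln_mult) (auto simp: ln_sqrt add_nonneg_pos less_imp_neq[THEN not_sym])
  also have "\<dots> \<le> ln (fact m) / 2 + ln (20 * (sqrt (real n) * (1 + x)))"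
    using A kl by (intro add_left_mono ln_mono) (auto intro: add_nonneg_pos)
  also have "ln (20 * (sqrt (real n) * (1 + x))) = ln 20 + (x / 2 + ln (1 + x))"
    using n x1 by (simp add: ln_mult ln_sqrt x_def)
  also have "ln (fact m) / 2 \<le> (1 + ln (real m) + real m * ln (real m) - real m) / 2"
    using ln_fact_le[OF m1] by simp
  finally have "ln (ksz_bound n m) \<le> (1 + ln (real m) + real m * ln (real m) - real m) / 2 + (ln 20 + (x / 2 + ln (1 + x)))"
    by simp
  also have "\<dots> \<le> real m * (ln (x + 1) / 2) + ((1 + ln (x + 1)) / 2 + (ln 20 + ln (1 + x)))"
  proof -
    have "real m * ln (real m) \<le> real m * ln (x + 1)" using lnm by (intro mult_left_mono) auto
    moreover have "(1 + b + A - d) / 2 + (k + (x / 2 + q)) \<le> B / 2 + ((1 + l) / 2 + (k + q))"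
      if "A \<le> B" "b \<le> l" "x \<le> d" for A B b d k q l :: real
      using that by (simp add: field_simps)
    ultimately show ?thesis using mx(1) lnm(3) by simp
  qed
  finally have "ln (ksz_bound n m) / real m \<le> (real m * (ln (x + 1) / 2) + ((1 + ln (x + 1)) / 2 + (ln 20 + ln (1 + x)))) / real m"
    by (rule divide_right_mono) simp
  also have "\<dots> = ln (x + 1) / 2 + ((1 + ln (x + 1)) / 2 + (ln 20 + ln (1 + x))) / real m"
    using m1 by (simp add: add_divide_distrib)
  also have "\<dots> \<le> ln (x + 1) / 2 + ((1 + ln (x + 1)) / 2 + (ln 20 + ln (1 + x))) / x"
    using mx x1 by (intro add_left_mono divide_left_mono add_nonneg_nonneg) auto
  also have "\<dots> = ln (x + 1) / 2 + (1 + ln (x + 1)) / (2 * x) + (ln 20 + ln (1 + x)) / x"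
    by (simp add: add_divide_distrib)
  finally have "ln (ksz_bound n m) / real m \<le> ln (x + 1) / 2 + (1 + ln (x + 1)) / (2 * x) + (ln 20 + ln (1 + x)) / x" .
  then have "exp (ln (ksz_bound n m) / real m) \<le> ksz_rate x" unfolding ksz_rate_def by simp
  moreover have "root m (ksz_bound n m) = exp (ln (ksz_bound n m) / real m)"
    using m1 pos by (simp add: root_powr_inverse powr_def)
  ultimately show "root m (ksz_bound n m) \<le> ksz_rate (ln (real n))" by (simp add: x_def)
qed

lemma ksz_rate_asymp: "(\<lambda>n. ksz_rate (ln (real n)) / sqrt (ln (real n))) \<longlonglongrightarrow> 1"
  unfolding ksz_rate_def by real_asymp

theorem theorem2p35:
  fixes X :: "(nat \<Rightarrow> complex) set" and N :: "(nat \<Rightarrow> complex) \<Rightarrow> real"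
  assumes "banach_sequence_lattice X N"
    and "\<forall>n\<ge>1. id_Xn_lp_norm N n 2 / id_Xn_lp_norm N n 1 \<le> 1 / sqrt (real n)"
  shows "(\<lambda>n. bohr_radius N n / sqrt (ln (real n) / real n)) \<longlonglongrightarrow> 1"
proof -
  interpret seq_lattice X N by standard (rule assms(1))
  have rate: "bohr_rate n > 0" if "n \<ge> 3" for n
  proof -
    have "ln (real n) / real n > 0" using that by simp
    then show ?thesis by (simp add: bohr_rate_def)
  qed
  have "(\<lambda>n. bohr_radius N n / bohr_rate n) \<longlonglongrightarrow> 1"
  proof (rule order_tendstoI)
    fix a :: real assume a: "a < 1"
    \<comment> \<open>Strictly between a and 1, and positive even for negative a.\<close>
    define t where "t = (max a 0 + 1) / 2"
    have t: "0 < t" "t < 1" "a < t" using a by (auto simp: t_def)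
    show "\<forall>\<^sub>F n in sequentially. a < bohr_radius N n / bohr_rate n"
      using bohr_radius_lower[OF t(1,2)] eventually_ge_at_top[of "3::nat"]
    proof eventually_elim
      case (elim n)
      then have "t \<le> bohr_radius N n / bohr_rate n" using rate[of n] by (simp add: le_divide_eq)
      then show ?case using t by simp
    qed
  next
    fix a :: real assume a: "1 < a"
    \<comment> \<open>\<open>cSup_least\<close> needs the set to have a member; the lower bound at t
      = 1/2 supplies one.\<close>
    have nonempty: "\<forall>\<^sub>F n in sequentially. bohr_set N n \<noteq> {}"
      using bohr_radius_lower[of "1/2"] by (auto elim: eventually_mono)
    show "\<forall>\<^sub>F n in sequentially. bohr_radius N n / bohr_rate n < a"
      using order_tendstoD(2)[OF ksz_rate_asymp a] nonempty eventually_ge_at_top[of "3::nat"]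
    proof eventually_elim
      case (elim n)
      define m where "m = nat \<lceil>ln (real n)\<rceil>"
      note root = root_ksz_bound_le[OF elim(3) m_def]
      have n1: "n \<ge> 1" using elim by simp
      have "bohr_radius N n \<le> root m (ksz_bound n m) / sqrt (real n)"
        unfolding bohr_radius_eq using elim(2) n1 assms(2)
        by (intro cSup_least bohr_set_le root(1)) auto
      also have "\<dots> \<le> ksz_rate (ln (real n)) / sqrt (real n)"
        using root(2) by (rule divide_right_mono) simp
      finally have "bohr_radius N n / bohr_rate n \<le> (ksz_rate (ln (real n)) / sqrt (real n)) / bohr_rate n"
        using rate[OF elim(3)] by (intro divide_right_mono) auto
      also have "\<dots> = ksz_rate (ln (real n)) / sqrt (ln (real n))"
        using n1 by (simp add: bohr_rate_def real_sqrt_divide)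
      finally show ?case using elim(1) by simp
    qed
  qed
  then show ?thesis unfolding bohr_rate_def .
qed

end
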